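(* Let $\mathcal{P}(\mathbb{N})$ be the set of subsets of $\mathbb{N}$, endowed with the lexicographic ordering. There exist a family $(V_I)_{I\in\mathcal{P}(\mathbb{N})}$ of subgroups $V_I \leq \mathbb{Z}_2^{\oplus \mathbf{F}_2}$, each invariant under the left-coordinate-translation action of $\mathbf{F}_2$, and a family $(Q_I)_{I\in\mathcal{P}(\mathbb{N})}$ of rational group ring elements $$Q_I \in \mathbb{Q}\big((\mathbb{Z}_2^{\oplus \mathbf{F}_2}/V_I)\rtimes \mathbf{F}_2\big),$$ such that the map $$\mathcal{P}(\mathbb{N})\to\mathbb{R}:\quad I\mapsto \dim_{L((\mathbb{Z}_2^{\oplus \mathbf{F}_2}/V_I)\rtimes \mathbf{F}_2)}\ker(Q_I-4)$$ is strictly increasing, where $\mathbf{F}_2$ acts on $\mathbb{Z}_2^{\oplus \mathbf{F}_2}/V_I$ by left-coordinate-translation.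
   Context: $\mathbb{N}=\{1,2,3,\ldots\}$. The lexicographic ordering on $\mathcal{P}(\mathbb{N})$: for distinct $I,J\subseteq\mathbb{N}$, $I<_{\mathrm{lex}}J$ iff the smallest element $n$ of the symmetric difference of $I$ and $J$ satisfies $n\in J$, $n\notin I$. $\mathbf{F}_2$ is the free group on two generators, $\mathbb{Z}_2$ is the cyclic group of order $2$, and $\mathbb{Z}_2^{\oplus \mathbf{F}_2}$ is the direct sum of copies of $\mathbb{Z}_2$ indexed by $\mathbf{F}_2$. The left-coordinate-translation action of $\mathbf{F}_2$ is $\alpha^g\big((u_h)_{h\in\mathbf{F}_2}\big)=(u_{g^{-1}h})_{h\in\mathbf{F}_2}$; for an invariant subgroup $V$ it descends to an action by automorphisms on $U=\mathbb{Z}_2^{\oplus\mathbf{F}_2}/V$. The semidirect product $U\rtimes\mathbf{F}_2$ is the set $U\times\mathbf{F}_2$ with multiplication $(u,g)\cdot(w,h)=(\alpha^{h^{-1}}(u)+w,\,gh)$. For a countable discrete group $\Gamma$, $\mathbb{Q}\Gamma$ is its rational group ring, $\lambda$ is the left regular representation on $\ell^2(\Gamma)$, and $L\Gamma$ is the group von Neumann algebra (weak operator closure of $\lambda(\mathbb{C}\Gamma)$ in $\mathcal{B}(\ell^2(\Gamma))$). Elements of $\mathbb{Q}\Gamma$ are identified with their images under $\lambda$, so that $\ker Q$ for $Q\in\mathbb{Q}\Gamma$ means the kernel of the bounded operator $\lambda(Q)$ on $\ell^2(\Gamma)$, and $\ker(Q-4)$ that of $\lambda(Q)-4\cdot\mathrm{id}$.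 $\dim_{L\Gamma}$ is the von Neumann dimension: $\dim_{L\Gamma}\ker Q$ is the canonical trace $\langle p\,\delta_e,\delta_e\rangle$ of the orthogonal projection $p\in L\Gamma$ onto $\ker Q$. *)

theory Defs
  imports "HOL-Analysis.Analysis" "HOL-Algebra.Algebra"
begin

section \<open>The lexicographic ordering on sets of natural numbers\<close>

definition lex_less :: "nat set \<Rightarrow> nat set \<Rightarrow> bool" where
  "lex_less I J \<longleftrightarrow>
     I \<noteq> J \<and> (let n = (LEAST n. n \<in> sym_diff I J) in n \<in> J \<and> n \<notin> I)"


section \<open>Free groups\<close>

text \<open>A letter \<open>(s, True)\<close> stands for the generator \<open>s\<close> and \<open>(s, False)\<close> for its inverse. The
  elements of the free group on \<open>S\<close> are the reduced words; the product of two reduced words is the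
  reduced form of their concatenation.\<close>

definition inv_letter :: "'s \<times> bool \<Rightarrow> 's \<times> bool" where
  "inv_letter a = (fst a, \<not> snd a)"

definition reduced :: "('s \<times> bool) list \<Rightarrow> bool" where
  "reduced w \<longleftrightarrow> successively (\<lambda>a b. b \<noteq> inv_letter a) w"

definition push_letter :: "'s \<times> bool \<Rightarrow> ('s \<times> bool) list \<Rightarrow> ('s \<times> bool) list" where
  "push_letter a w = (if w \<noteq> [] \<and> hd w = inv_letter a then tl w else a # w)"

definition reduce :: "('s \<times> bool) list \<Rightarrow> ('s \<times> bool) list" where
  "reduce w = foldr push_letter w []"

definition free_group :: "'s set \<Rightarrow> ('s \<times> bool) list monoid" where
  "free_group S =
     \<lparr>carrier = {w \<in> lists (S \<times> UNIV). reduced w},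
      monoid.mult = (\<lambda>v w. reduce (v @ w)),
      one = []\<rparr>"

type_synonym F2_word = "(bool \<times> bool) list"

abbreviation F2 :: "F2_word monoid" where
  "F2 \<equiv> free_group (UNIV :: bool set)"


section \<open>Quotients of the direct sum and the semidirect product\<close>

abbreviation Z2_sum :: "(F2_word \<Rightarrow> int) monoid" where
  "Z2_sum \<equiv> sum_group (carrier F2) (\<lambda>_. integer_mod_group 2)"

definition translation :: "F2_word \<Rightarrow> (F2_word \<Rightarrow> int) \<Rightarrow> (F2_word \<Rightarrow> int)" where
  "translation g u = (\<lambda>h\<in>carrier F2. u (inv\<^bsub>F2\<^esub> g \<otimes>\<^bsub>F2\<^esub> h))"

definition translation_invariant :: "(F2_word \<Rightarrow> int) set \<Rightarrow> bool" where
  "translation_invariant V \<longleftrightarrow> (\<forall>g\<in>carrier F2. \<forall>u\<in>V. translation g u \<in> V)"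

text \<open>Elements of the quotient \<open>Z2_sum Mod V\<close> are cosets. For invariant \<open>V\<close> the image under
  \<open>translation g\<close> of the coset of \<open>u\<close> is the coset of \<open>translation g u\<close>, so taking images is the
  induced action on the quotient.\<close>

definition coset_translation :: "F2_word \<Rightarrow> (F2_word \<Rightarrow> int) set \<Rightarrow> (F2_word \<Rightarrow> int) set" where
  "coset_translation g C = translation g ` C"

definition semidirect_product ::
    "('u, 'a) monoid_scheme \<Rightarrow> ('g, 'b) monoid_scheme \<Rightarrow> ('g \<Rightarrow> 'u \<Rightarrow> 'u) \<Rightarrow> ('u \<times> 'g) monoid" where
  "semidirect_product U G \<alpha> =
     \<lparr>carrier = carrier U \<times> carrier G,
      monoid.mult = (\<lambda>(u, g) (w, h). (\<alpha> (inv\<^bsub>G\<^esub> h) u \<otimes>\<^bsub>U\<^esub> w, g \<otimes>\<^bsub>G\<^esub> h)),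
      one = (\<one>\<^bsub>U\<^esub>, \<one>\<^bsub>G\<^esub>)\<rparr>"

abbreviation quotient_semidirect ::
    "(F2_word \<Rightarrow> int) set \<Rightarrow> ((F2_word \<Rightarrow> int) set \<times> F2_word) monoid" where
  "quotient_semidirect V \<equiv> semidirect_product (Z2_sum Mod V) F2 coset_translation"


section \<open>Group rings and von Neumann dimension\<close>

text \<open>Elements of the rational group ring and vectors of \<open>\<ell>\<^sup>2\<close> are functions on the whole type that
  vanish outside the carrier of the group.\<close>

definition rational_group_ring :: "('a, 'b) monoid_scheme \<Rightarrow> ('a \<Rightarrow> rat) set" where
  "rational_group_ring G =
     {q. finite {g. q g \<noteq> 0} \<and> {g. q g \<noteq> 0} \<subseteq> carrier G}"

definition ell2 :: "('a, 'b) monoid_scheme \<Rightarrow> ('a \<Rightarrow> complex) set" where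
  "ell2 G = {\<xi>. (\<forall>x. x \<notin> carrier G \<longrightarrow> \<xi> x = 0) \<and> (\<lambda>x. (cmod (\<xi> x))\<^sup>2) summable_on carrier G}"

definition ell2_inner :: "('a, 'b) monoid_scheme \<Rightarrow> ('a \<Rightarrow> complex) \<Rightarrow> ('a \<Rightarrow> complex) \<Rightarrow> complex" where
  "ell2_inner G \<xi> \<eta> = (\<Sum>\<^sub>\<infinity>x\<in>carrier G. \<xi> x * cnj (\<eta> x))"

definition delta :: "'a \<Rightarrow> 'a \<Rightarrow> complex" where
  "delta g = (\<lambda>x. if x = g then 1 else 0)"

definition left_regular ::
    "('a, 'b) monoid_scheme \<Rightarrow> 'a \<Rightarrow> ('a \<Rightarrow> complex) \<Rightarrow> ('a \<Rightarrow> complex)" where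
  "left_regular G g \<xi> = (\<lambda>x. if x \<in> carrier G then \<xi> (inv\<^bsub>G\<^esub> g \<otimes>\<^bsub>G\<^esub> x) else 0)"

definition group_ring_op ::
    "('a, 'b) monoid_scheme \<Rightarrow> ('a \<Rightarrow> rat) \<Rightarrow> ('a \<Rightarrow> complex) \<Rightarrow> ('a \<Rightarrow> complex)" where
  "group_ring_op G q \<xi> = (\<lambda>x. \<Sum>g | q g \<noteq> 0. of_rat (q g) * left_regular G g \<xi> x)"

definition ell2_kernel ::
    "('a, 'b) monoid_scheme \<Rightarrow> (('a \<Rightarrow> complex) \<Rightarrow> ('a \<Rightarrow> complex)) \<Rightarrow> ('a \<Rightarrow> complex) set" where
  "ell2_kernel G T = {\<xi> \<in> ell2 G. T \<xi> = (\<lambda>_. 0)}"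

definition ell2_projection ::
    "('a, 'b) monoid_scheme \<Rightarrow> ('a \<Rightarrow> complex) set \<Rightarrow> ('a \<Rightarrow> complex) \<Rightarrow> ('a \<Rightarrow> complex)" where
  "ell2_projection G K \<xi> =
     (THE \<eta>. \<eta> \<in> K \<and> (\<forall>\<zeta>\<in>K. ell2_inner G (\<lambda>x. \<xi> x - \<eta> x) \<zeta> = 0))"

text \<open>The trace of a projection is real: passing to the real part loses nothing. The definition
  is meaningful for closed subspaces \<open>K\<close> of \<open>ell2 G\<close> whose projection commutes with right
  translations, i.e. lies in the group von Neumann algebra; kernels of elements of the group von
  Neumann algebra are of this form.\<close>

definition vn_dim :: "('a, 'b) monoid_scheme \<Rightarrow> ('a \<Rightarrow> complex) set \<Rightarrow> real" where
  "vn_dim G K =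
     Re (ell2_inner G (ell2_projection G K (delta \<one>\<^bsub>G\<^esub>)) (delta \<one>\<^bsub>G\<^esub>))"

end

theory Submission
  imports Defs
begin

text \<open>
  Let \<open>s\<close>, \<open>t\<close> be the generators of the free group. Given \<open>I\<close>, let them act on the set of lamps
  \<open>int \<times> bool\<close>: \<open>s\<close> moves every lamp up by one level, and \<open>t\<close> exchanges the two lamps of a level that
  lies in \<open>twisted_levels I\<close> and fixes those of the other levels. The coordinate \<open>g\<close> of the direct sum
  operates the lamp \<open>g (0, False)\<close>, and \<open>V I\<close> consists of the elements that leave all lamps unlit. It
  is translation invariant, and the quotient by it is the group of finite sets of lamps under symmetric
  difference (lemmas \<open>quotient_carrier\<close>, \<open>quotient_mult\<close>).

  By Fourier duality on this quotient, vectors in \<open>\<ell>\<^sup>2\<close> of the semidirect product are square integrable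
  fields of functions on the free group over the space of random lamp configurations, in which every
  lamp is tossed by a fair coin. An event that depends on finitely many lamps becomes a projection
  \<open>event_proj A\<close> in the rational group ring; products of projections correspond to conjunctions of
  events (\<open>event_proj_conj\<close>), conjugation to a change of viewpoint (\<open>event_proj_translate\<close>), and the
  trace to the probability (\<open>event_proj_delta\<close>). In these terms a group ring element is a random
  operator that reads finitely many lamps around each vertex of the free group.

  Put \<open>r = s\<^sup>2\<close>. The two lamps that a vertex \<open>g\<close> sees at \<open>(0, False)\<close> and \<open>(1, False)\<close> show one of three
  symbols: stale (the first is off), \<open>X\<close> (both are on), or \<open>Y\<close> (only the first is on). Join \<open>g\<close> to \<open>g r\<close>
  if \<open>g r\<close> is stale, and \<open>g\<close> to \<open>g t\<close> if they show \<open>X\<close> and \<open>Y\<close>. Moreover, kill \<open>g\<close> if it shows \<open>X\<close> or \<open>Y\<close>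
  without its partner doing the opposite, or if \<open>g r\<close> shows \<open>Y\<close>. The Laplacian of this random graph plus
  the indicator of the killed vertices is a sum of positive elements of the rational group ring, so its
  kernel consists of the \<open>harmonic\<close> vectors, which are constant along edges and vanish at killed
  vertices (\<open>harmonic_is_kernel\<close>). Almost surely, every component is finite or contains a killed vertex;
  those without killed vertices are pairs of arms: a vertex that shows \<open>X\<close> followed by \<open>a\<close> stale ones in
  the direction \<open>r\<close>, its \<open>t\<close>-partner that shows \<open>Y\<close> followed by \<open>b\<close> stale ones, with an \<open>X\<close> after the end
  of each arm. Each such component carries exactly one harmonic function up to scalars. Hence the
  dimension of the kernel is the mean number of components without killed vertices per vertex, which
  is the sum over \<open>a\<close> and \<open>b\<close> of the probability of \<open>good F (a, b)\<close> (\<open>vn_dim_harmonic\<close>).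

  The set \<open>I\<close> enters through the correlation of the two arms: the \<open>j\<close>-th vertices of both arms see the
  same lamps if \<open>j \<in> I\<close>, and independent ones otherwise. Sorting the components by the length \<open>m\<close> of
  their shorter arm gives the dimension as the series \<open>dimension_series I\<close>
  (\<open>sum_probability_good_tendsto\<close>). Up to the factor \<open>1 / 16\<close>, which is the probability of the base, its
  \<open>m\<close>-th term is the probability that both arms survive the levels
  \<open>1\<close>, ..., \<open>m\<close>, a product of factors \<open>1 / 2\<close> (for \<open>j \<in> I\<close>) or \<open>1 / 4\<close>, times the probability \<open>1 / 4\<close> or
  \<open>3 / 16\<close> that an arm stops at level \<open>m + 1\<close> and that both end in \<open>X\<close>. Membership of a
  level in \<open>I\<close> outweighs everything that happens at higher levels, so the sum is strictly increasing for
  the lexicographic ordering (\<open>suminf_dimension_series_strict_mono\<close>).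
\<close>

section \<open>The Hilbert space of square summable functions on a group\<close>

definition ell2_norm :: "('a, 'b) monoid_scheme \<Rightarrow> ('a \<Rightarrow> complex) \<Rightarrow> real" where
  "ell2_norm G \<xi> = sqrt (\<Sum>\<^sub>\<infinity>x\<in>carrier G. (cmod (\<xi> x))\<^sup>2)"

lemma ell2_outside: "\<xi> \<in> ell2 G \<Longrightarrow> x \<notin> carrier G \<Longrightarrow> \<xi> x = 0"
  by (simp add: ell2_def)

lemma ell2_summable: "\<xi> \<in> ell2 G \<Longrightarrow> (\<lambda>x. (cmod (\<xi> x))\<^sup>2) summable_on carrier G"
  by (simp add: ell2_def)

lemma ell2_norm_nonneg: "0 \<le> ell2_norm G \<xi>"
  by (simp add: ell2_norm_def infsum_nonneg)

lemma ell2_norm_power2: "(ell2_norm G \<xi>)\<^sup>2 = (\<Sum>\<^sub>\<infinity>x\<in>carrier G. (cmod (\<xi> x))\<^sup>2)"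
  by (simp add: ell2_norm_def infsum_nonneg)

lemma ell2_product_abs_summable:
  assumes "\<xi> \<in> ell2 G" "\<eta> \<in> ell2 G"
  shows "(\<lambda>x. norm (\<xi> x * cnj (\<eta> x))) summable_on carrier G"
proof (rule Infinite_Sum.abs_summable_on_comparison_test')
  show "(\<lambda>x. (cmod (\<xi> x))\<^sup>2 + (cmod (\<eta> x))\<^sup>2) summable_on carrier G"
    using assms by (intro summable_on_add ell2_summable)
  fix x
  have "2 * (cmod (\<xi> x) * cmod (\<eta> x)) \<le> (cmod (\<xi> x))\<^sup>2 + (cmod (\<eta> x))\<^sup>2"
    using sum_squares_bound[of "cmod (\<xi> x)" "cmod (\<eta> x)"] by (simp add: mult.assoc)
  moreover have "0 \<le> cmod (\<xi> x) * cmod (\<eta> x)" by simp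
  ultimately show "norm (\<xi> x * cnj (\<eta> x)) \<le> (cmod (\<xi> x))\<^sup>2 + (cmod (\<eta> x))\<^sup>2"
    by (simp only: norm_mult complex_mod_cnj)
qed

lemma ell2_product_summable:
  assumes "\<xi> \<in> ell2 G" "\<eta> \<in> ell2 G"
  shows "(\<lambda>x. \<xi> x * cnj (\<eta> x)) summable_on carrier G"
  using ell2_product_abs_summable[OF assms] by (rule abs_summable_summable)

lemma ell2_add:
  assumes "\<xi> \<in> ell2 G" "\<eta> \<in> ell2 G"
  shows "(\<lambda>x. \<xi> x + \<eta> x) \<in> ell2 G"
proof -
  have "(\<lambda>x. norm ((cmod (\<xi> x + \<eta> x))\<^sup>2)) summable_on carrier G"
  proof (rule Infinite_Sum.abs_summable_on_comparison_test')
    show "(\<lambda>x. 2 * (cmod (\<xi> x))\<^sup>2 + 2 * (cmod (\<eta> x))\<^sup>2) summable_on carrier G"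
      using assms by (intro summable_on_add summable_on_cmult_right ell2_summable)
    fix x
    have "(cmod (\<xi> x + \<eta> x))\<^sup>2 \<le> (cmod (\<xi> x) + cmod (\<eta> x))\<^sup>2"
      by (simp add: norm_triangle_ineq power_mono)
    also have "\<dots> \<le> 2 * (cmod (\<xi> x))\<^sup>2 + 2 * (cmod (\<eta> x))\<^sup>2"
      using sum_squares_bound[of "cmod (\<xi> x)" "cmod (\<eta> x)"] by (simp add: power2_sum)
    finally show "norm ((cmod (\<xi> x + \<eta> x))\<^sup>2) \<le> 2 * (cmod (\<xi> x))\<^sup>2 + 2 * (cmod (\<eta> x))\<^sup>2"
      by simp
  qed
  then show ?thesis using assms by (simp add: ell2_def)
qed

lemma ell2_scale:
  assumes "\<xi> \<in> ell2 G"
  shows "(\<lambda>x. c * \<xi> x) \<in> ell2 G"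
  using assms by (auto simp: ell2_def norm_mult power_mult_distrib intro!: summable_on_cmult_right)

lemma ell2_zero: "(\<lambda>x. 0) \<in> ell2 G"
  by (simp add: ell2_def)

lemma ell2_diff:
  assumes "\<xi> \<in> ell2 G" "\<eta> \<in> ell2 G"
  shows "(\<lambda>x. \<xi> x - \<eta> x) \<in> ell2 G"
  using ell2_add[OF assms(1) ell2_scale[OF assms(2), of "-1"]] by simp

lemma ell2_sum:
  assumes "\<And>i. i \<in> A \<Longrightarrow> f i \<in> ell2 G"
  shows "(\<lambda>x. \<Sum>i\<in>A. f i x) \<in> ell2 G"
  using assms by (induction A rule: infinite_finite_induct) (auto intro: ell2_zero ell2_add)

lemma ell2_inner_add_left:
  assumes "\<xi> \<in> ell2 G" "\<eta> \<in> ell2 G" "\<zeta> \<in> ell2 G"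
  shows "ell2_inner G (\<lambda>x. \<xi> x + \<eta> x) \<zeta> = ell2_inner G \<xi> \<zeta> + ell2_inner G \<eta> \<zeta>"
  using assms unfolding ell2_inner_def
  by (simp add: distrib_right infsum_add ell2_product_summable)

lemma ell2_inner_scale_left:
  shows "ell2_inner G (\<lambda>x. c * \<xi> x) \<zeta> = c * ell2_inner G \<xi> \<zeta>"
  unfolding ell2_inner_def by (simp add: mult.assoc infsum_cmult_right')

lemma ell2_inner_zero_left: "ell2_inner G (\<lambda>x. 0) \<zeta> = 0"
  by (simp add: ell2_inner_def)

lemma ell2_inner_diff_left:
  assumes "\<xi> \<in> ell2 G" "\<eta> \<in> ell2 G" "\<zeta> \<in> ell2 G"
  shows "ell2_inner G (\<lambda>x. \<xi> x - \<eta> x) \<zeta> = ell2_inner G \<xi> \<zeta> - ell2_inner G \<eta> \<zeta>"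
  using ell2_inner_add_left[OF assms(1) ell2_scale[OF assms(2), of "-1"] assms(3)]
    ell2_inner_scale_left[of G "-1" \<eta> \<zeta>] by simp

lemma ell2_inner_sum_left:
  assumes "\<And>i. i \<in> A \<Longrightarrow> f i \<in> ell2 G" "\<zeta> \<in> ell2 G"
  shows "ell2_inner G (\<lambda>x. \<Sum>i\<in>A. f i x) \<zeta> = (\<Sum>i\<in>A. ell2_inner G (f i) \<zeta>)"
  using assms
  by (induction A rule: infinite_finite_induct)
    (auto simp: ell2_inner_zero_left ell2_inner_add_left ell2_sum)

lemma ell2_inner_cnj: "cnj (ell2_inner G \<xi> \<eta>) = ell2_inner G \<eta> \<xi>"
  unfolding ell2_inner_def by (simp add: infsum_cnj[symmetric] mult.commute del: infsum_cnj)

lemma ell2_inner_add_right: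
  assumes "\<xi> \<in> ell2 G" "\<eta> \<in> ell2 G" "\<zeta> \<in> ell2 G"
  shows "ell2_inner G \<zeta> (\<lambda>x. \<xi> x + \<eta> x) = ell2_inner G \<zeta> \<xi> + ell2_inner G \<zeta> \<eta>"
  using arg_cong[OF ell2_inner_add_left[OF assms], of cnj] by (simp add: ell2_inner_cnj)

lemma ell2_inner_scale_right:
  shows "ell2_inner G \<zeta> (\<lambda>x. c * \<xi> x) = cnj c * ell2_inner G \<zeta> \<xi>"
  using arg_cong[OF ell2_inner_scale_left[of G c \<xi> \<zeta>], of cnj] by (simp add: ell2_inner_cnj)

lemma ell2_inner_diff_right:
  assumes "\<xi> \<in> ell2 G" "\<eta> \<in> ell2 G" "\<zeta> \<in> ell2 G"
  shows "ell2_inner G \<zeta> (\<lambda>x. \<xi> x - \<eta> x) = ell2_inner G \<zeta> \<xi> - ell2_inner G \<zeta> \<eta>"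
  using arg_cong[OF ell2_inner_diff_left[OF assms], of cnj] by (simp add: ell2_inner_cnj)

lemma ell2_inner_sum_right:
  assumes "\<And>i. i \<in> A \<Longrightarrow> f i \<in> ell2 G" "\<zeta> \<in> ell2 G"
  shows "ell2_inner G \<zeta> (\<lambda>x. \<Sum>i\<in>A. f i x) = (\<Sum>i\<in>A. ell2_inner G \<zeta> (f i))"
  using arg_cong[OF ell2_inner_sum_left[of A f G \<zeta>, OF assms], of cnj] by (simp add: ell2_inner_cnj)

lemma ell2_inner_self:
  assumes "\<xi> \<in> ell2 G"
  shows "ell2_inner G \<xi> \<xi> = of_real ((ell2_norm G \<xi>)\<^sup>2)"
proof -
  have "ell2_inner G \<xi> \<xi> = (\<Sum>\<^sub>\<infinity>x\<in>carrier G. complex_of_real ((cmod (\<xi> x))\<^sup>2))"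
    unfolding ell2_inner_def complex_norm_square ..
  also have "\<dots> = of_real (\<Sum>\<^sub>\<infinity>x\<in>carrier G. (cmod (\<xi> x))\<^sup>2)"
    using has_sum_infsum[OF ell2_summable[OF assms]]
    by (intro infsumI) (simp only: has_sum_of_real_iff)
  finally show ?thesis by (simp add: ell2_norm_power2)
qed

lemma ell2_norm_ge_finite_sum:
  assumes "\<xi> \<in> ell2 G" "finite F" "F \<subseteq> carrier G"
  shows "(\<Sum>x\<in>F. (cmod (\<xi> x))\<^sup>2) \<le> (ell2_norm G \<xi>)\<^sup>2"
  unfolding ell2_norm_power2 using assms by (intro finite_sum_le_infsum ell2_summable) auto

lemma ell2_norm_ge_value:
  assumes "\<xi> \<in> ell2 G"
  shows "cmod (\<xi> x) \<le> ell2_norm G \<xi>"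
proof (cases "x \<in> carrier G")
  case True
  then have "(cmod (\<xi> x))\<^sup>2 \<le> (ell2_norm G \<xi>)\<^sup>2"
    using ell2_norm_ge_finite_sum[OF assms, of "{x}"] by simp
  then show ?thesis using ell2_norm_nonneg by (rule power2_le_imp_le)
next
  case False
  then show ?thesis using ell2_outside[OF assms] by (simp add: ell2_norm_nonneg)
qed

lemma ell2_norm_eq_0:
  assumes "\<xi> \<in> ell2 G" "ell2_norm G \<xi> = 0"
  shows "\<xi> = (\<lambda>_. 0)"
  using ell2_norm_ge_value[OF assms(1)] assms(2) by (auto simp: fun_eq_iff)

text \<open>Reduction to finite subsets, where the inequality is known.\<close>

lemma ell2_Cauchy_Schwarz:
  assumes "\<xi> \<in> ell2 G" "\<eta> \<in> ell2 G"
  shows "cmod (ell2_inner G \<xi> \<eta>) \<le> ell2_norm G \<xi> * ell2_norm G \<eta>"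
proof -
  have "cmod (ell2_inner G \<xi> \<eta>) \<le> (\<Sum>\<^sub>\<infinity>x\<in>carrier G. norm (\<xi> x * cnj (\<eta> x)))"
    unfolding ell2_inner_def
    by (rule norm_infsum_bound[OF ell2_product_abs_summable[OF assms]])
  also have "\<dots> \<le> ell2_norm G \<xi> * ell2_norm G \<eta>"
  proof (rule infsum_le_finite_sums[OF ell2_product_abs_summable[OF assms]])
    fix F assume F: "finite F" "F \<subseteq> carrier G"
    have le: "L2_set (\<lambda>x. cmod (\<zeta> x)) F \<le> ell2_norm G \<zeta>" if "\<zeta> \<in> ell2 G" for \<zeta>
      unfolding L2_set_def
      by (rule real_le_lsqrt[OF ell2_norm_nonneg ell2_norm_ge_finite_sum[OF that F]])
    have "(\<Sum>x\<in>F. norm (\<xi> x * cnj (\<eta> x))) = (\<Sum>x\<in>F. \<bar>cmod (\<xi> x)\<bar> * \<bar>cmod (\<eta> x)\<bar>)"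
      by (simp add: norm_mult)
    also have "\<dots> \<le> L2_set (\<lambda>x. cmod (\<xi> x)) F * L2_set (\<lambda>x. cmod (\<eta> x)) F"
      by (rule L2_set_mult_ineq)
    also have "\<dots> \<le> ell2_norm G \<xi> * ell2_norm G \<eta>"
      using assms by (intro mult_mono le) (auto simp: ell2_norm_nonneg L2_set_nonneg)
    finally show "(\<Sum>x\<in>F. norm (\<xi> x * cnj (\<eta> x))) \<le> ell2_norm G \<xi> * ell2_norm G \<eta>" .
  qed
  finally show ?thesis .
qed

lemma delta_ell2: "g \<in> carrier G \<Longrightarrow> delta g \<in> ell2 G"
proof -
  assume g: "g \<in> carrier G"
  have "(\<lambda>x. (cmod (delta g x))\<^sup>2) summable_on carrier G \<longleftrightarrow>
        (\<lambda>x. (cmod (delta g x))\<^sup>2) summable_on {g}"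
    by (rule summable_on_cong_neutral) (auto simp: delta_def g)
  then show ?thesis using g by (auto simp: ell2_def delta_def)
qed

lemma ell2_inner_delta_right:
  assumes "g \<in> carrier G"
  shows "ell2_inner G \<xi> (delta g) = \<xi> g"
proof -
  have "ell2_inner G \<xi> (delta g) = (\<Sum>\<^sub>\<infinity>x\<in>{g}. \<xi> x * cnj (delta g x))"
    unfolding ell2_inner_def by (rule infsum_cong_neutral) (auto simp: delta_def assms)
  then show ?thesis by (simp add: delta_def)
qed

text \<open>Completeness of \<open>\<ell>\<^sup>2\<close> in the form in which a pointwise limit is given: a bound on finite partial sums
  of the squared norm passes to the pointwise limit.\<close>

lemma ell2_limit_close:
  assumes f: "\<And>n. f n \<in> ell2 G"
    and cauchy: "\<And>m n. ell2_norm G (\<lambda>x. f m x - f n x) \<le> c m + c n"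
    and c: "c \<longlonglongrightarrow> 0"
    and lim: "\<And>x. (\<lambda>n. f n x) \<longlonglongrightarrow> Y x"
  shows "(\<lambda>x. Y x - f n x) \<in> ell2 G" "ell2_norm G (\<lambda>x. Y x - f n x) \<le> \<bar>c n\<bar>"
proof -
  have bound: "(\<Sum>x\<in>F. (cmod (Y x - f n x))\<^sup>2) \<le> (c n)\<^sup>2" if F: "finite F" "F \<subseteq> carrier G" for F
  proof (rule LIMSEQ_le)
    show "(\<lambda>m. \<Sum>x\<in>F. (cmod (f m x - f n x))\<^sup>2) \<longlonglongrightarrow> (\<Sum>x\<in>F. (cmod (Y x - f n x))\<^sup>2)"
      by (intro tendsto_intros lim)
    have "(\<lambda>m. (c m + c n)\<^sup>2) \<longlonglongrightarrow> (0 + c n)\<^sup>2" by (intro tendsto_intros c)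
    then show "(\<lambda>m. (c m + c n)\<^sup>2) \<longlonglongrightarrow> (c n)\<^sup>2" by simp
    have "(\<Sum>x\<in>F. (cmod (f m x - f n x))\<^sup>2) \<le> (c m + c n)\<^sup>2" for m
    proof -
      have "(\<Sum>x\<in>F. (cmod (f m x - f n x))\<^sup>2) \<le> (ell2_norm G (\<lambda>x. f m x - f n x))\<^sup>2"
        by (rule ell2_norm_ge_finite_sum[OF ell2_diff[OF f f] F])
      also have "\<dots> \<le> (c m + c n)\<^sup>2"
        by (rule power_mono[OF cauchy ell2_norm_nonneg])
      finally show ?thesis .
    qed
    then show "\<exists>N. \<forall>m\<ge>N. (\<Sum>x\<in>F. (cmod (f m x - f n x))\<^sup>2) \<le> (c m + c n)\<^sup>2" by blast
  qed
  have summ: "(\<lambda>x. (cmod (Y x - f n x))\<^sup>2) summable_on carrier G"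
    by (rule nonneg_bdd_above_summable_on) (auto intro!: bdd_aboveI2[where M = "(c n)\<^sup>2"] bound)
  have "Y x = 0" if "x \<notin> carrier G" for x
    using lim[of x] ell2_outside[OF f that] by (simp add: LIMSEQ_const_iff)
  then show "(\<lambda>x. Y x - f n x) \<in> ell2 G"
    using summ ell2_outside[OF f] by (simp add: ell2_def)
  have "(ell2_norm G (\<lambda>x. Y x - f n x))\<^sup>2 \<le> \<bar>c n\<bar>\<^sup>2"
    unfolding ell2_norm_power2 by (rule infsum_le_finite_sums[OF summ]) (auto intro: bound)
  then show "ell2_norm G (\<lambda>x. Y x - f n x) \<le> \<bar>c n\<bar>"
    by (rule power2_le_imp_le) simp
qed

text \<open>The projection of the unit vector need not be known in closed form: it is enough to approximate it
  by vectors \<open>\<eta> n\<close> of \<open>K\<close> whose error is almost orthogonal to \<open>K\<close>. Testing the error estimate against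
  \<open>\<eta> m - \<eta> n\<close>, which lies in \<open>K\<close>, shows that such a sequence is automatically Cauchy.\<close>

lemma vn_dim_eq_limit:
  assumes e: "\<one>\<^bsub>G\<^esub> \<in> carrier G"
    and K: "K \<subseteq> ell2 G"
    and K_diff: "\<And>\<xi> \<zeta>. \<xi> \<in> K \<Longrightarrow> \<zeta> \<in> K \<Longrightarrow> (\<lambda>x. \<xi> x - \<zeta> x) \<in> K"
    and K_closed: "\<And>f Y. (\<And>n::nat. f n \<in> K) \<Longrightarrow> (\<And>x. (\<lambda>n. f n x) \<longlonglongrightarrow> Y x) \<Longrightarrow> Y \<in> ell2 G \<Longrightarrow> Y \<in> K"
    and \<eta>: "\<And>n. \<eta> n \<in> K"
    and approx: "\<And>n \<zeta>. \<zeta> \<in> K \<Longrightarrow>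
        cmod (ell2_inner G (\<lambda>x. delta \<one>\<^bsub>G\<^esub> x - \<eta> n x) \<zeta>) \<le> c n * ell2_norm G \<zeta>"
    and c: "c \<longlonglongrightarrow> 0" "\<And>n. 0 \<le> c n"
    and d: "(\<lambda>n. Re (\<eta> n \<one>\<^bsub>G\<^esub>)) \<longlonglongrightarrow> d"
  shows "vn_dim G K = d"
proof -
  let ?e = "delta \<one>\<^bsub>G\<^esub>"
  note e2 = delta_ell2[OF e]
  have \<eta>2: "\<eta> n \<in> ell2 G" for n using \<eta> K by blast
  have diff2: "(\<lambda>x. ?e x - \<eta> n x) \<in> ell2 G" for n by (rule ell2_diff[OF e2 \<eta>2])
  \<comment> \<open>For \<open>z = \<eta> m - \<eta> n\<close>, the square of the norm of \<open>z\<close> is a difference of two error terms tested against \<open>z\<close>.\<close>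
  have cauchy: "ell2_norm G (\<lambda>x. \<eta> m x - \<eta> n x) \<le> c m + c n" for m n
  proof -
    let ?z = "\<lambda>x. \<eta> m x - \<eta> n x"
    have zK: "?z \<in> K" by (rule K_diff[OF \<eta> \<eta>])
    have z2: "?z \<in> ell2 G" using zK K by blast
    have "ell2_inner G ?z ?z =
      ell2_inner G (\<lambda>x. (?e x - \<eta> n x) - (?e x - \<eta> m x)) ?z" by (simp add: algebra_simps)
    also have "\<dots> = ell2_inner G (\<lambda>x. ?e x - \<eta> n x) ?z - ell2_inner G (\<lambda>x. ?e x - \<eta> m x) ?z"
      by (rule ell2_inner_diff_left[OF diff2 diff2 z2])
    finally have "(ell2_norm G ?z)\<^sup>2 =
      cmod (ell2_inner G (\<lambda>x. ?e x - \<eta> n x) ?z - ell2_inner G (\<lambda>x. ?e x - \<eta> m x) ?z)"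
      by (metis ell2_inner_self[OF z2] norm_of_real abs_of_nonneg zero_le_power2)
    also have "\<dots> \<le> c n * ell2_norm G ?z + c m * ell2_norm G ?z"
      by (rule order_trans[OF norm_triangle_ineq4 add_mono[OF approx[OF zK] approx[OF zK]]])
    finally have "ell2_norm G ?z * ell2_norm G ?z \<le> (c m + c n) * ell2_norm G ?z"
      by (simp add: power2_eq_square algebra_simps)
    then show ?thesis
      using ell2_norm_nonneg[of G ?z] c(2)[of m] c(2)[of n]
      by (cases "ell2_norm G ?z = 0") (auto simp: mult_le_cancel_right)
  qed
  have "Cauchy (\<lambda>n. \<eta> n x)" for x
  proof (rule CauchyI)
    fix \<epsilon> :: real assume "0 < \<epsilon>"
    then obtain N where N: "\<And>n. n \<ge> N \<Longrightarrow> c n < \<epsilon> / 2"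
      using order_tendstoD(2)[OF c(1), of "\<epsilon> / 2"] by (auto simp: eventually_sequentially)
    have "norm (\<eta> m x - \<eta> n x) < \<epsilon>" if "m \<ge> N" "n \<ge> N" for m n
      using order_trans[OF ell2_norm_ge_value[OF ell2_diff[OF \<eta>2 \<eta>2]] cauchy, of m x n] N[OF that(1)] N[OF that(2)]
      by simp
    then show "\<exists>M. \<forall>m\<ge>M. \<forall>n\<ge>M. norm (\<eta> m x - \<eta> n x) < \<epsilon>" by blast
  qed
  then have "\<exists>y. (\<lambda>n. \<eta> n x) \<longlonglongrightarrow> y" for x
    by (simp add: Cauchy_convergent_iff convergent_def)
  then obtain Y where Y: "\<And>x. (\<lambda>n. \<eta> n x) \<longlonglongrightarrow> Y x" by metis
  note close = ell2_limit_close[OF \<eta>2 cauchy c(1) Y]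
  have Y2: "Y \<in> ell2 G" using ell2_add[OF close(1)[of 0] \<eta>2[of 0]] by simp
  have YK: "Y \<in> K" by (rule K_closed[OF \<eta> Y Y2])
  have orth: "ell2_inner G (\<lambda>x. ?e x - Y x) \<zeta> = 0" if \<zeta>: "\<zeta> \<in> K" for \<zeta>
  proof -
    have \<zeta>2: "\<zeta> \<in> ell2 G" using \<zeta> K by blast
    have le: "cmod (ell2_inner G (\<lambda>x. ?e x - Y x) \<zeta>) \<le> 2 * c n * ell2_norm G \<zeta>" for n
    proof -
      have "ell2_inner G (\<lambda>x. ?e x - Y x) \<zeta> = ell2_inner G (\<lambda>x. (?e x - \<eta> n x) - (Y x - \<eta> n x)) \<zeta>"
        by simp
      also have "\<dots> = ell2_inner G (\<lambda>x. ?e x - \<eta> n x) \<zeta> - ell2_inner G (\<lambda>x. Y x - \<eta> n x) \<zeta>"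
        by (rule ell2_inner_diff_left[OF diff2 close(1) \<zeta>2])
      also have "cmod \<dots> \<le> c n * ell2_norm G \<zeta> + c n * ell2_norm G \<zeta>"
      proof (rule order_trans[OF norm_triangle_ineq4 add_mono[OF approx[OF \<zeta>]]])
        show "cmod (ell2_inner G (\<lambda>x. Y x - \<eta> n x) \<zeta>) \<le> c n * ell2_norm G \<zeta>"
          using ell2_Cauchy_Schwarz[OF close(1) \<zeta>2, of n]
            mult_right_mono[OF close(2) ell2_norm_nonneg, of n G \<zeta>] c(2)[of n] by simp
      qed
      finally show ?thesis by (simp add: algebra_simps)
    qed
    have "(\<lambda>n. 2 * c n * ell2_norm G \<zeta>) \<longlonglongrightarrow> 2 * 0 * ell2_norm G \<zeta>"
      by (intro tendsto_intros c(1))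
    then have "cmod (ell2_inner G (\<lambda>x. ?e x - Y x) \<zeta>) \<le> 0"
      using le by (intro LIMSEQ_le_const[where X = "\<lambda>n. 2 * c n * ell2_norm G \<zeta>"]) auto
    then show ?thesis by simp
  qed
  have "ell2_projection G K ?e = Y"
    unfolding ell2_projection_def
  proof (rule the_equality)
    show "Y \<in> K \<and> (\<forall>\<zeta>\<in>K. ell2_inner G (\<lambda>x. ?e x - Y x) \<zeta> = 0)" using YK orth by blast
    fix Y' assume Y': "Y' \<in> K \<and> (\<forall>\<zeta>\<in>K. ell2_inner G (\<lambda>x. ?e x - Y' x) \<zeta> = 0)"
    let ?z = "\<lambda>x. Y' x - Y x"
    have zK: "?z \<in> K" using Y' YK K_diff by blast
    have z2: "?z \<in> ell2 G" and Y'2: "Y' \<in> ell2 G" using zK Y' K by blast+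
    have "ell2_inner G ?z ?z = ell2_inner G (\<lambda>x. (?e x - Y x) - (?e x - Y' x)) ?z" by simp
    also have "\<dots> = 0"
      using ell2_inner_diff_left[OF ell2_diff[OF e2 Y2] ell2_diff[OF e2 Y'2] z2] Y' orth zK by simp
    finally have "ell2_norm G ?z = 0" by (simp add: ell2_inner_self[OF z2])
    from ell2_norm_eq_0[OF z2 this] show "Y' = Y" by (simp add: fun_eq_iff)
  qed
  then have "vn_dim G K = Re (Y \<one>\<^bsub>G\<^esub>)"
    by (simp add: vn_dim_def ell2_inner_delta_right e)
  moreover have "(\<lambda>n. Re (\<eta> n \<one>\<^bsub>G\<^esub>)) \<longlonglongrightarrow> Re (Y \<one>\<^bsub>G\<^esub>)" by (intro tendsto_intros Y)
  ultimately show ?thesis using d LIMSEQ_unique by metis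
qed

section \<open>Operators from the group ring\<close>

text \<open>The operators of left multiplication by rational group ring elements. The inductive form makes closure
  under products and linearity simple inductions; the element of the group ring itself is only needed
  at the very end (\<open>group_algebra_op_rational\<close>).\<close>

inductive group_algebra_op ::
    "('a, 'b) monoid_scheme \<Rightarrow> (('a \<Rightarrow> complex) \<Rightarrow> 'a \<Rightarrow> complex) \<Rightarrow> bool" for G where
  zero: "group_algebra_op G (\<lambda>\<xi> x. 0)"
| add_translate: "g \<in> carrier G \<Longrightarrow> group_algebra_op G T \<Longrightarrow>
    group_algebra_op G (\<lambda>\<xi> x. of_rat c * left_regular G g \<xi> x + T \<xi> x)"

lemma left_regular_add:
  "left_regular G g (\<lambda>x. \<xi> x + \<eta> x) = (\<lambda>x. left_regular G g \<xi> x + left_regular G g \<eta> x)"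
  by (auto simp: left_regular_def)

lemma left_regular_scale:
  "left_regular G g (\<lambda>x. c * \<xi> x) = (\<lambda>x. c * left_regular G g \<xi> x)"
  by (auto simp: left_regular_def)

lemma left_regular_zero: "left_regular G g (\<lambda>x. 0) = (\<lambda>x. 0)"
  by (auto simp: left_regular_def)

lemma left_regular_diff:
  "left_regular G g (\<lambda>x. \<xi> x - \<eta> x) = (\<lambda>x. left_regular G g \<xi> x - left_regular G g \<eta> x)"
  by (auto simp: left_regular_def)

lemma left_regular_sum:
  "left_regular G g (\<lambda>x. \<Sum>i\<in>A. f i x) = (\<lambda>x. \<Sum>i\<in>A. left_regular G g (f i) x)"
  by (auto simp: left_regular_def)

context group
begin

lemma left_regular_mult:
  assumes "g \<in> carrier G" "h \<in> carrier G"
  shows "left_regular G g (left_regular G h \<xi>) = left_regular G (g \<otimes> h) \<xi>"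
  using assms by (auto simp: left_regular_def fun_eq_iff inv_mult_group m_assoc)

lemma left_regular_one:
  assumes "\<And>x. x \<notin> carrier G \<Longrightarrow> \<xi> x = 0"
  shows "left_regular G \<one> \<xi> = \<xi>"
  using assms by (auto simp: left_regular_def fun_eq_iff)

lemma left_regular_delta:
  assumes "g \<in> carrier G" "h \<in> carrier G"
  shows "left_regular G g (delta h) = delta (g \<otimes> h)"
  using assms by (auto simp: left_regular_def delta_def fun_eq_iff inv_solve_left')

lemma bij_betw_translate: "g \<in> carrier G \<Longrightarrow> bij_betw (\<lambda>x. g \<otimes> x) (carrier G) (carrier G)"
  by (rule bij_betwI[where g = "\<lambda>x. inv g \<otimes> x"]) (auto simp: m_assoc[symmetric])

lemma left_regular_ell2:
  assumes g: "g \<in> carrier G" and \<xi>: "\<xi> \<in> ell2 G"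
  shows "left_regular G g \<xi> \<in> ell2 G"
proof -
  have "(\<lambda>x. (cmod (\<xi> (inv g \<otimes> x)))\<^sup>2) summable_on carrier G"
    using summable_on_reindex_bij_betw[OF bij_betw_translate[of "inv g"], of "\<lambda>x. (cmod (\<xi> x))\<^sup>2"]
      ell2_summable[OF \<xi>] g by simp
  then have "(\<lambda>x. (cmod (left_regular G g \<xi> x))\<^sup>2) summable_on carrier G"
    by (simp add: left_regular_def cong: summable_on_cong)
  then show ?thesis by (simp add: ell2_def left_regular_def)
qed

lemma left_regular_adjoint:
  assumes g: "g \<in> carrier G"
  shows "ell2_inner G (left_regular G g \<xi>) \<eta> = ell2_inner G \<xi> (left_regular G (inv g) \<eta>)"
proof -
  have "ell2_inner G (left_regular G g \<xi>) \<eta> = (\<Sum>\<^sub>\<infinity>x\<in>carrier G. \<xi> (inv g \<otimes> x) * cnj (\<eta> x))"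
    unfolding ell2_inner_def by (rule infsum_cong) (simp add: left_regular_def)
  also have "\<dots> = (\<Sum>\<^sub>\<infinity>x\<in>carrier G. \<xi> (inv g \<otimes> (g \<otimes> x)) * cnj (\<eta> (g \<otimes> x)))"
    by (rule infsum_reindex_bij_betw[OF bij_betw_translate[OF g], symmetric])
  also have "\<dots> = ell2_inner G \<xi> (left_regular G (inv g) \<eta>)"
    unfolding ell2_inner_def
    by (rule infsum_cong) (simp add: left_regular_def g m_assoc[symmetric])
  finally show ?thesis .
qed

lemma group_algebra_op_translate:
  assumes "g \<in> carrier G"
  shows "group_algebra_op G (\<lambda>\<xi> x. of_rat c * left_regular G g \<xi> x)"
  using group_algebra_op.add_translate[OF assms group_algebra_op.zero, of c] by simp

lemma group_algebra_op_left_regular: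
  assumes "g \<in> carrier G"
  shows "group_algebra_op G (left_regular G g)"
  using group_algebra_op_translate[OF assms, of 1] by simp

lemma group_algebra_op_add:
  assumes "group_algebra_op G T" "group_algebra_op G T'"
  shows "group_algebra_op G (\<lambda>\<xi> x. T \<xi> x + T' \<xi> x)"
  using assms(1)
proof induction
  case (add_translate g T c)
  from group_algebra_op.add_translate[OF add_translate(1,3), of c] show ?case
    by (simp add: add.assoc)
qed (use assms in simp)

lemma group_algebra_op_scale:
  assumes "group_algebra_op G T"
  shows "group_algebra_op G (\<lambda>\<xi> x. of_rat a * T \<xi> x)"
  using assms
proof induction
  case zero
  show ?case by (simp add: group_algebra_op.zero)
next
  case (add_translate g T c)
  from group_algebra_op.add_translate[OF add_translate(1,3), of "a * c"] show ?case
    by (simp add: algebra_simps of_rat_mult)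
qed

lemma group_algebra_op_diff:
  assumes "group_algebra_op G T" "group_algebra_op G T'"
  shows "group_algebra_op G (\<lambda>\<xi> x. T \<xi> x - T' \<xi> x)"
  using group_algebra_op_add[OF assms(1) group_algebra_op_scale[OF assms(2), of "-1"]] by simp

lemma group_algebra_op_sum:
  assumes "\<And>i. i \<in> A \<Longrightarrow> group_algebra_op G (T i)"
  shows "group_algebra_op G (\<lambda>\<xi> x. \<Sum>i\<in>A. T i \<xi> x)"
  using assms
  by (induction A rule: infinite_finite_induct)
    (auto intro: group_algebra_op.zero group_algebra_op_add)

lemma group_algebra_op_comp:
  assumes "group_algebra_op G T" "group_algebra_op G T'"
  shows "group_algebra_op G (\<lambda>\<xi>. T (T' \<xi>))"
  using assms(1)
proof induction
  case zero
  show ?case by (rule group_algebra_op.zero)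
next
  case (add_translate g T c)
  have "group_algebra_op G (\<lambda>\<xi>. left_regular G g (T' \<xi>))"
    using assms(2)
  proof induction
    case zero
    show ?case by (simp add: left_regular_zero group_algebra_op.zero)
  next
    case (add_translate h T d)
    from group_algebra_op.add_translate[OF m_closed[OF \<open>g \<in> carrier G\<close> add_translate(1)] add_translate(3), of d]
    show ?case
      by (simp add: left_regular_add left_regular_scale left_regular_mult
          \<open>g \<in> carrier G\<close> add_translate(1))
  qed
  from group_algebra_op_add[OF group_algebra_op_scale[OF this] add_translate(3)]
  show ?case .
qed

lemma group_algebra_op_distrib_add:
  assumes "group_algebra_op G T"
  shows "T (\<lambda>x. \<xi> x + \<eta> x) = (\<lambda>x. T \<xi> x + T \<eta> x)"
  using assms by induction (auto simp: left_regular_add algebra_simps)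

lemma group_algebra_op_distrib_scale:
  assumes "group_algebra_op G T"
  shows "T (\<lambda>x. a * \<xi> x) = (\<lambda>x. a * T \<xi> x)"
  using assms by induction (auto simp: left_regular_scale algebra_simps)

lemma group_algebra_op_of_zero:
  assumes "group_algebra_op G T"
  shows "T (\<lambda>x. 0) = (\<lambda>x. 0)"
  using group_algebra_op_distrib_scale[OF assms, of 0 "\<lambda>x. 0"] by simp

lemma group_algebra_op_distrib_diff:
  assumes "group_algebra_op G T"
  shows "T (\<lambda>x. \<xi> x - \<eta> x) = (\<lambda>x. T \<xi> x - T \<eta> x)"
  using group_algebra_op_distrib_add[OF assms, of \<xi> "\<lambda>x. (-1) * \<eta> x"]
  unfolding group_algebra_op_distrib_scale[OF assms, of "-1" \<eta>] by simp

lemma group_algebra_op_distrib_sum: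
  assumes "group_algebra_op G T"
  shows "T (\<lambda>x. \<Sum>i\<in>A. f i x) = (\<lambda>x. \<Sum>i\<in>A. T (f i) x)"
  by (induction A rule: infinite_finite_induct)
    (auto simp: group_algebra_op_of_zero[OF assms] group_algebra_op_distrib_add[OF assms])

lemma group_algebra_op_ell2:
  assumes "group_algebra_op G T" "\<xi> \<in> ell2 G"
  shows "T \<xi> \<in> ell2 G"
  using assms by induction (auto intro!: ell2_zero ell2_add ell2_scale left_regular_ell2)

text \<open>Each value of \<open>T \<xi>\<close> involves finitely many values of \<open>\<xi>\<close>; hence kernels are closed under pointwise
  limits.\<close>

lemma group_algebra_op_limit:
  assumes "group_algebra_op G T" and lim: "\<And>x. (\<lambda>n. f n x) \<longlonglongrightarrow> \<xi> x"
  shows "(\<lambda>n. T (f n) x) \<longlonglongrightarrow> T \<xi> x"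
  using assms(1)
proof induction
  case (add_translate g T c)
  have "(\<lambda>n. left_regular G g (f n) x) \<longlonglongrightarrow> left_regular G g \<xi> x"
    by (auto simp: left_regular_def lim)
  then show ?case by (intro tendsto_intros add_translate(3))
qed simp

lemma group_ring_op_eq_sum:
  assumes "finite S" "{g. q g \<noteq> 0} \<subseteq> S"
  shows "group_ring_op G q \<xi> x = (\<Sum>g\<in>S. of_rat (q g) * left_regular G g \<xi> x)"
  unfolding group_ring_op_def using assms by (intro sum.mono_neutral_left) auto

lemma group_algebra_op_rational:
  assumes "group_algebra_op G T"
  shows "\<exists>q\<in>rational_group_ring G. T = group_ring_op G q"
  using assms
proof induction
  case zero
  have "(\<lambda>_. 0) \<in> rational_group_ring G" by (simp add: rational_group_ring_def)
  moreover have "(\<lambda>\<xi> x. 0) = group_ring_op G (\<lambda>_. 0)" by (simp add: group_ring_op_def fun_eq_iff)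
  ultimately show ?case by blast
next
  case (add_translate g T c)
  then obtain q where q: "q \<in> rational_group_ring G" "T = group_ring_op G q" by blast
  define q' where "q' = (\<lambda>h. (if h = g then c else 0) + q h)"
  define S where "S = insert g {h. q h \<noteq> 0}"
  have S: "finite S" "{h. q h \<noteq> 0} \<subseteq> S" "{h. q' h \<noteq> 0} \<subseteq> S" "g \<in> S"
    using q(1) by (auto simp: S_def q'_def rational_group_ring_def)
  have "S \<subseteq> carrier G" using q(1) add_translate(1) by (auto simp: S_def rational_group_ring_def)
  then have "q' \<in> rational_group_ring G"
    using S by (auto simp: rational_group_ring_def intro: finite_subset)
  moreover have "of_rat c * left_regular G g \<xi> x + T \<xi> x = group_ring_op G q' \<xi> x" for \<xi> x
  proof -
    have "group_ring_op G q' \<xi> x =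
      (\<Sum>h\<in>S. (if h = g then of_rat c * left_regular G h \<xi> x else 0) + of_rat (q h) * left_regular G h \<xi> x)"
      unfolding group_ring_op_eq_sum[OF S(1,3)]
      by (rule sum.cong) (auto simp: q'_def of_rat_add algebra_simps)
    also have "\<dots> = of_rat c * left_regular G g \<xi> x + T \<xi> x"
      using S by (simp add: sum.distrib q(2) group_ring_op_eq_sum[OF S(1,2)])
    finally show ?thesis ..
  qed
  ultimately show ?case by (intro bexI[of _ q']) (auto simp: fun_eq_iff)
qed

end

section \<open>Cylinder events and their projections\<close>

text \<open>A configuration is the set of lamps that are on; an event is a predicate on configurations.\<close>

definition depends_on :: "'l set \<Rightarrow> ('l set \<Rightarrow> bool) \<Rightarrow> bool" where
  "depends_on D A \<longleftrightarrow> finite D \<and> (\<forall>c c'. c \<inter> D = c' \<inter> D \<longrightarrow> A c = A c')"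

definition cylinder :: "('l set \<Rightarrow> bool) \<Rightarrow> bool" where
  "cylinder A \<longleftrightarrow> (\<exists>D. depends_on D A)"

text \<open>Any support serves, by \<open>walsh_coeff_mono\<close>: enlarging it adds only vanishing Walsh coefficients.\<close>

definition event_support :: "('l set \<Rightarrow> bool) \<Rightarrow> 'l set" where
  "event_support A = (SOME D. depends_on D A)"

lemma cylinder_support: "cylinder A \<Longrightarrow> depends_on (event_support A) A"
  unfolding cylinder_def event_support_def by (rule someI_ex)

lemma depends_on_finite: "depends_on D A \<Longrightarrow> finite D"
  unfolding depends_on_def by (rule conjunct1)

lemma depends_on_cong: "depends_on D A \<Longrightarrow> c \<inter> D = c' \<inter> D \<Longrightarrow> A c = A c'"
  unfolding depends_on_def by blast

lemma depends_on_conv: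
  "finite D \<Longrightarrow> (\<And>c c'. c \<inter> D = c' \<inter> D \<Longrightarrow> A c = A c') \<Longrightarrow> depends_on D A"
  unfolding depends_on_def by blast

lemma depends_on_mono:
  assumes "depends_on D A" "D \<subseteq> D'" "finite D'"
  shows "depends_on D' A"
proof (rule depends_on_conv[OF assms(3)])
  fix c c' assume "c \<inter> D' = c' \<inter> D'"
  then have "c \<inter> D = c' \<inter> D" using assms(2) by blast
  then show "A c = A c'" by (rule depends_on_cong[OF assms(1)])
qed

lemma cylinder_common:
  assumes "cylinder A" "cylinder B"
  obtains D where "depends_on D A" "depends_on D B"
proof -
  let ?D = "event_support A \<union> event_support B"
  note D = cylinder_support[OF assms(1)] cylinder_support[OF assms(2)]
  have "finite ?D" using D by (simp add: depends_on_finite)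
  with D have "depends_on ?D A" "depends_on ?D B" by (simp_all add: depends_on_mono)
  then show ?thesis by (rule that)
qed

lemma cylinderI: "depends_on D A \<Longrightarrow> cylinder A"
  unfolding cylinder_def by (rule exI)

lemma depends_on_conj:
  assumes "depends_on D A" "depends_on D B"
  shows "depends_on D (\<lambda>c. A c \<and> B c)"
proof (rule depends_on_conv[OF depends_on_finite[OF assms(1)]])
  fix c c' assume "c \<inter> D = c' \<inter> D"
  from depends_on_cong[OF assms(1) this] depends_on_cong[OF assms(2) this]
  show "(A c \<and> B c) = (A c' \<and> B c')" by (simp only:)
qed

lemma cylinder_conj:
  assumes "cylinder A" "cylinder B"
  shows "cylinder (\<lambda>c. A c \<and> B c)"
proof -
  obtain D where "depends_on D A" "depends_on D B" by (rule cylinder_common[OF assms])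
  from cylinderI[OF depends_on_conj[OF this]] show ?thesis .
qed

lemma depends_on_disj:
  assumes "depends_on D A" "depends_on D B"
  shows "depends_on D (\<lambda>c. A c \<or> B c)"
proof (rule depends_on_conv[OF depends_on_finite[OF assms(1)]])
  fix c c' assume "c \<inter> D = c' \<inter> D"
  from depends_on_cong[OF assms(1) this] depends_on_cong[OF assms(2) this]
  show "(A c \<or> B c) = (A c' \<or> B c')" by (simp only:)
qed

lemma cylinder_disj:
  assumes "cylinder A" "cylinder B"
  shows "cylinder (\<lambda>c. A c \<or> B c)"
proof -
  obtain D where "depends_on D A" "depends_on D B" by (rule cylinder_common[OF assms])
  from cylinderI[OF depends_on_disj[OF this]] show ?thesis .
qed

lemma depends_on_imp:
  assumes "depends_on D A" "depends_on D B"
  shows "depends_on D (\<lambda>c. A c \<longrightarrow> B c)"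
proof (rule depends_on_conv[OF depends_on_finite[OF assms(1)]])
  fix c c' assume "c \<inter> D = c' \<inter> D"
  from depends_on_cong[OF assms(1) this] depends_on_cong[OF assms(2) this]
  show "(A c \<longrightarrow> B c) = (A c' \<longrightarrow> B c')" by (simp only:)
qed

lemma cylinder_imp:
  assumes "cylinder A" "cylinder B"
  shows "cylinder (\<lambda>c. A c \<longrightarrow> B c)"
proof -
  obtain D where "depends_on D A" "depends_on D B" by (rule cylinder_common[OF assms])
  from cylinderI[OF depends_on_imp[OF this]] show ?thesis .
qed

lemma cylinder_const: "cylinder (\<lambda>c. P)"
  by (rule cylinderI[of "{}"], rule depends_on_conv) simp_all

lemma cylinder_not: "cylinder A \<Longrightarrow> cylinder (\<lambda>c. \<not> A c)"
  by (drule cylinder_imp[OF _ cylinder_const[of False]]) simp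

lemma cylinder_mem: "cylinder (\<lambda>c. l \<in> c)"
  by (rule cylinderI[of "{l}"], rule depends_on_conv) auto

lemma cylinder_ball:
  assumes "finite J" "\<And>i. i \<in> J \<Longrightarrow> cylinder (A i)"
  shows "cylinder (\<lambda>c. \<forall>i\<in>J. A i c)"
  using assms by (induction J rule: finite_induct) (simp_all add: cylinder_const cylinder_conj)

lemma cylinder_bex:
  assumes "finite J" "\<And>i. i \<in> J \<Longrightarrow> cylinder (A i)"
  shows "cylinder (\<lambda>c. \<exists>i\<in>J. A i c)"
  using assms by (induction J rule: finite_induct) (simp_all add: cylinder_const cylinder_disj)

lemma depends_on_vimage:
  assumes "inj \<pi>" "depends_on D A"
  shows "depends_on (\<pi> ` D) (\<lambda>c. A (\<pi> -` c))"
proof (rule depends_on_conv)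
  show "finite (\<pi> ` D)" using depends_on_finite[OF assms(2)] by simp
  fix c c' assume "c \<inter> \<pi> ` D = c' \<inter> \<pi> ` D"
  then have "\<pi> -` c \<inter> D = \<pi> -` c' \<inter> D" by blast
  then show "A (\<pi> -` c) = A (\<pi> -` c')" by (rule depends_on_cong[OF assms(2)])
qed

lemma cylinder_vimage: "inj \<pi> \<Longrightarrow> cylinder A \<Longrightarrow> cylinder (\<lambda>c. A (\<pi> -` c))"
  by (rule cylinderI[OF depends_on_vimage[OF _ cylinder_support]])

text \<open>The characters of the group of configurations, indexed by finite sets of lamps.\<close>

definition walsh :: "'l set \<Rightarrow> 'l set \<Rightarrow> rat" where
  "walsh c S = (\<Prod>l\<in>S. if l \<in> c then - 1 else 1)"

text \<open>The Fourier coefficient at \<open>S\<close> of the indicator function of \<open>A\<close> with respect to fair coin tosses.\<close>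

definition walsh_coeff :: "'l set \<Rightarrow> ('l set \<Rightarrow> bool) \<Rightarrow> 'l set \<Rightarrow> rat" where
  "walsh_coeff D A S = (\<Sum>c | c \<subseteq> D \<and> A c. walsh c S) / 2 ^ card D"

lemma walsh_square: "walsh c S * walsh c S = 1"
  unfolding walsh_def prod.distrib[symmetric] by (rule prod.neutral) auto

lemma walsh_sym_diff:
  assumes "finite S" "finite R"
  shows "walsh c (sym_diff S R) = walsh c S * walsh c R"
proof -
  have split: "walsh c A = walsh c (A - B) * walsh c (A \<inter> B)" if "finite A" for A B
    unfolding walsh_def using prod.Int_Diff[OF that, of "\<lambda>l. if l \<in> c then - 1 else 1 :: rat" B]
    by (simp only: mult.commute)
  have "walsh c (sym_diff S R) = walsh c (S - R) * walsh c (R - S)"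
    unfolding walsh_def by (rule prod.union_disjoint) (use assms in auto)
  moreover have "walsh c (S \<inter> R) * walsh c (S \<inter> R) = 1" by (rule walsh_square)
  ultimately show ?thesis
    using split[OF assms(1), of R] split[OF assms(2), of S]
    by (simp add: Int_commute mult.assoc mult.left_commute)
qed

lemma sum_Pow_prod:
  fixes h :: "'l \<Rightarrow> 'r::comm_semiring_1"
  assumes "finite D"
  shows "(\<Sum>S\<in>Pow D. \<Prod>l\<in>S. h l) = (\<Prod>l\<in>D. 1 + h l)"
  using assms
proof (induction D rule: finite_induct)
  case (insert l D)
  have "(\<Sum>S\<in>Pow (insert l D). prod h S) = (\<Sum>S\<in>Pow D. prod h S) + (\<Sum>S\<in>insert l ` Pow D. prod h S)"
    unfolding Pow_insert by (rule sum.union_disjoint) (use insert in auto)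
  also have "(\<Sum>S\<in>insert l ` Pow D. prod h S) = (\<Sum>S\<in>Pow D. prod h (insert l S))"
    by (rule sum.reindex_cong[where l = "insert l"])
      (use insert(2) in \<open>auto intro!: inj_on_inverseI[where g = "\<lambda>c. c - {l}"]\<close>)
  also have "\<dots> = (\<Sum>S\<in>Pow D. h l * prod h S)"
  proof (rule sum.cong[OF refl])
    fix S assume "S \<in> Pow D"
    then have "finite S" "l \<notin> S" using insert(1,2) by (auto intro: finite_subset)
    then show "prod h (insert l S) = h l * prod h S" by simp
  qed
  also have "\<dots> = h l * (\<Prod>l\<in>D. 1 + h l)" by (simp only: sum_distrib_left[symmetric] insert.IH)
  finally show ?case using insert(1,2) by (simp add: insert.IH distrib_right)
qed simp

lemma walsh_orthogonal:
  assumes "finite D" "c \<subseteq> D" "c' \<subseteq> D"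
  shows "(\<Sum>S\<in>Pow D. walsh c S * walsh c' S) = (if c = c' then 2 ^ card D else 0)"
proof -
  let ?h = "\<lambda>l. (if l \<in> c then - 1 else 1) * (if l \<in> c' then - 1 else 1) :: rat"
  have "(\<Sum>S\<in>Pow D. walsh c S * walsh c' S) = (\<Prod>l\<in>D. 1 + ?h l)"
    unfolding walsh_def prod.distrib[symmetric] by (rule sum_Pow_prod[OF assms(1)])
  also have "\<dots> = (if c = c' then 2 ^ card D else 0)"
  proof (cases "c = c'")
    case True
    have "(\<Prod>l\<in>D. 1 + ?h l) = (\<Prod>l\<in>D. 2)" by (rule prod.cong) (auto simp: True)
    then show ?thesis by (simp add: True)
  next
    case False
    then obtain l where "l \<in> D" "(l \<in> c) \<noteq> (l \<in> c')" using assms by blast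
    then have "\<exists>l\<in>D. 1 + ?h l = 0" by (intro bexI[of _ l]) auto
    then have "(\<Prod>l\<in>D. 1 + ?h l) = 0" using assms(1) by (simp only: prod_zero)
    then show ?thesis using False by simp
  qed
  finally show ?thesis .
qed

text \<open>The indicator of a conjunction is the product of the indicators; on the side of Fourier coefficients
  this is a convolution, by orthogonality of the characters.\<close>

lemma walsh_coeff_convolution:
  assumes "finite D" "R \<subseteq> D"
  shows "(\<Sum>S\<in>Pow D. walsh_coeff D A S * walsh_coeff D B (sym_diff S R)) =
    walsh_coeff D (\<lambda>c. A c \<and> B c) R"
proof -
  let ?A = "{c. c \<subseteq> D \<and> A c}" and ?B = "{c. c \<subseteq> D \<and> B c}"
  let ?n = "2 ^ card D :: rat"
  have fin: "finite ?A" "finite ?B" using assms(1) by auto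
  have "(\<Sum>S\<in>Pow D. walsh_coeff D A S * walsh_coeff D B (sym_diff S R)) =
     (\<Sum>S\<in>Pow D. \<Sum>c\<in>?A. \<Sum>c'\<in>?B. walsh c' R * (walsh c S * walsh c' S)) / (?n * ?n)"
    unfolding walsh_coeff_def sum_divide_distrib
  proof (rule sum.cong[OF refl])
    fix S assume "S \<in> Pow D"
    then have S: "finite S" "finite R" using assms by (auto intro: finite_subset)
    show "(\<Sum>c\<in>?A. walsh c S / ?n) * (\<Sum>c\<in>?B. walsh c (sym_diff S R) / ?n) =
      (\<Sum>c\<in>?A. \<Sum>c'\<in>?B. walsh c' R * (walsh c S * walsh c' S) / (?n * ?n))"
      unfolding sum_product walsh_sym_diff[OF S]
      by (intro sum.cong refl) (simp add: mult_ac)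
  qed
  also have "(\<Sum>S\<in>Pow D. \<Sum>c\<in>?A. \<Sum>c'\<in>?B. walsh c' R * (walsh c S * walsh c' S)) =
     (\<Sum>c\<in>?A. \<Sum>c'\<in>?B. walsh c' R * (\<Sum>S\<in>Pow D. walsh c S * walsh c' S))"
    unfolding sum_distrib_left
    by (subst sum.swap, rule sum.cong[OF refl], subst sum.swap, rule refl)
  also have "\<dots> = (\<Sum>c\<in>?A. \<Sum>c'\<in>?B. if c = c' then walsh c' R * ?n else 0)"
    by (intro sum.cong refl) (auto simp: walsh_orthogonal[OF assms(1)])
  also have "\<dots> = (\<Sum>c\<in>?A. if c \<in> ?B then walsh c R * ?n else 0)"
    by (intro sum.cong refl) (subst sum.delta'[OF fin(2)], simp)
  also have "\<dots> = (\<Sum>c\<in>?A \<inter> ?B. walsh c R * ?n)"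
    by (simp only: sum.inter_restrict[OF fin(1)])
  also have "?A \<inter> ?B = {c. c \<subseteq> D \<and> A c \<and> B c}" by blast
  finally show ?thesis by (simp add: walsh_coeff_def flip: sum_distrib_right)
qed

text \<open>A lamp on which the event does not depend contributes equally with both signs.\<close>

lemma walsh_coeff_insert:
  assumes "finite S" "l \<notin> D" "depends_on D A"
  shows "walsh_coeff (insert l D) A S = (if l \<in> S then 0 else walsh_coeff D A S)"
proof -
  let ?B = "{c. c \<subseteq> D \<and> A c}"
  have D: "finite D" using assms(3) by (rule depends_on_finite)
  have fin: "finite ?B" using D by auto
  have eq: "A (insert l c) \<longleftrightarrow> A c" if "c \<subseteq> D" for c
  proof -
    have "insert l c \<inter> D = c \<inter> D" using assms(2) by blast
    then show ?thesis by (rule depends_on_cong[OF assms(3)])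
  qed
  have "{c. c \<subseteq> insert l D \<and> A c} = ?B \<union> insert l ` ?B"
  proof (intro equalityI subsetI)
    fix c assume c: "c \<in> {c. c \<subseteq> insert l D \<and> A c}"
    show "c \<in> ?B \<union> insert l ` ?B"
    proof (cases "l \<in> c")
      case True
      then have ins: "insert l (c - {l}) = c" and sub: "c - {l} \<subseteq> D" using c by auto
      have "A (c - {l})" using eq[OF sub] c unfolding ins by blast
      then show ?thesis using sub ins by (intro UnI2 image_eqI[where x = "c - {l}"]) simp_all
    qed (use c in auto)
  qed (use eq in auto)
  then have "(\<Sum>c | c \<subseteq> insert l D \<and> A c. walsh c S) = (\<Sum>c\<in>?B. walsh c S) + (\<Sum>c\<in>insert l ` ?B. walsh c S)"
    by (simp only:) (rule sum.union_disjoint, use fin assms(2) in auto)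
  also have "(\<Sum>c\<in>insert l ` ?B. walsh c S) = (\<Sum>c\<in>?B. walsh (insert l c) S)"
    by (rule sum.reindex_cong[where l = "insert l"])
      (use assms(2) in \<open>auto intro!: inj_on_inverseI[where g = "\<lambda>c. c - {l}"]\<close>)
  also have "\<dots> = (\<Sum>c\<in>?B. (if l \<in> S then - 1 else 1) * walsh c S)"
  proof (rule sum.cong[OF refl])
    fix c assume "c \<in> ?B"
    then have l: "l \<notin> c" using assms(2) by auto
    show "walsh (insert l c) S = (if l \<in> S then - 1 else 1) * walsh c S"
    proof (cases "l \<in> S")
      case True
      have "(\<Prod>k\<in>S - {l}. if k \<in> insert l c then - 1 else 1) = (\<Prod>k\<in>S - {l}. if k \<in> c then - 1 else 1 :: rat)"
        by (rule prod.cong) auto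
      then show ?thesis unfolding walsh_def using True l
        by (simp add: prod.remove[OF assms(1) True])
    next
      case False
      then have "walsh (insert l c) S = walsh c S" unfolding walsh_def by (intro prod.cong) auto
      then show ?thesis using False by simp
    qed
  qed
  finally show ?thesis
    using D assms(2) by (auto simp: walsh_coeff_def simp flip: sum_distrib_left)
qed

lemma walsh_coeff_extend:
  assumes "finite S" "depends_on D A" "finite E" "D \<inter> E = {}"
  shows "walsh_coeff (D \<union> E) A S = (if S \<inter> E = {} then walsh_coeff D A S else 0)"
  using assms(3,4)
proof (induction E rule: finite_induct)
  case (insert l E)
  have "depends_on (D \<union> E) A"
    using assms(2) insert(1) depends_on_finite[OF assms(2)] by (auto intro: depends_on_mono)
  then show ?case using insert walsh_coeff_insert[OF assms(1), of l "D \<union> E" A] by auto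
qed simp

definition probability :: "('l set \<Rightarrow> bool) \<Rightarrow> real" where
  "probability A = card {c. c \<subseteq> event_support A \<and> A c} / 2 ^ card (event_support A)"

lemma walsh_coeff_empty: "walsh_coeff D A {} = of_nat (card {c. c \<subseteq> D \<and> A c}) / 2 ^ card D"
  by (simp add: walsh_coeff_def walsh_def)

lemma walsh_coeff_mono:
  assumes "finite S" "depends_on D A" "D \<subseteq> D'" "finite D'"
  shows "walsh_coeff D' A S = (if S \<inter> (D' - D) = {} then walsh_coeff D A S else 0)"
proof -
  have "D \<union> (D' - D) = D'" using assms(3) by blast
  then show ?thesis using walsh_coeff_extend[OF assms(1,2), of "D' - D"] assms(4) by auto
qed

lemma walsh_coeff_empty_eq_probability:
  assumes "depends_on D A"
  shows "real_of_rat (walsh_coeff D A {}) = probability A"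
proof -
  let ?D' = "event_support A"
  have D': "depends_on ?D' A" using assms by (intro cylinder_support) (rule cylinderI)
  have fin: "finite (D \<union> ?D')" using assms D' by (simp add: depends_on_finite)
  have "walsh_coeff D A {} = walsh_coeff (D \<union> ?D') A {}"
    using walsh_coeff_mono[OF _ assms _ fin] by simp
  also have "\<dots> = walsh_coeff ?D' A {}"
    using walsh_coeff_mono[OF _ D' _ fin] by simp
  finally show ?thesis by (simp add: walsh_coeff_empty probability_def of_rat_divide of_rat_power)
qed

lemma probability_eq:
  assumes "depends_on D A"
  shows "probability A = card {c. c \<subseteq> D \<and> A c} / 2 ^ card D"
  using walsh_coeff_empty_eq_probability[OF assms]
  by (simp add: walsh_coeff_empty of_rat_divide of_rat_power)

lemma probability_False: "probability (\<lambda>c. False) = 0"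
  by (simp add: probability_def)

lemma probability_disj_le:
  assumes "cylinder A" "cylinder B"
  shows "probability (\<lambda>c. A c \<or> B c) \<le> probability A + probability B"
proof -
  obtain D where D: "depends_on D A" "depends_on D B" by (rule cylinder_common[OF assms])
  then have D': "depends_on D (\<lambda>c. A c \<or> B c)" by (rule depends_on_disj)
  have "{c. c \<subseteq> D \<and> (A c \<or> B c)} = {c. c \<subseteq> D \<and> A c} \<union> {c. c \<subseteq> D \<and> B c}" by blast
  then have "card {c. c \<subseteq> D \<and> (A c \<or> B c)} \<le> card {c. c \<subseteq> D \<and> A c} + card {c. c \<subseteq> D \<and> B c}"
    by (simp add: card_Un_le)
  then have "real (card {c. c \<subseteq> D \<and> (A c \<or> B c)}) \<le> real (card {c. c \<subseteq> D \<and> A c}) + real (card {c. c \<subseteq> D \<and> B c})"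
    by linarith
  then show ?thesis
    by (simp add: probability_eq[OF D(1)] probability_eq[OF D(2)] probability_eq[OF D']
        divide_right_mono flip: add_divide_distrib)
qed

lemma probability_mono:
  assumes "cylinder A" "cylinder B" "\<And>c. A c \<Longrightarrow> B c"
  shows "probability A \<le> probability B"
proof -
  obtain D where D: "depends_on D A" "depends_on D B" by (rule cylinder_common[OF assms(1,2)])
  have "card {c. c \<subseteq> D \<and> A c} \<le> card {c. c \<subseteq> D \<and> B c}"
    using assms(3) depends_on_finite[OF D(1)] by (intro card_mono) auto
  then show ?thesis
    by (simp add: probability_eq[OF D(1)] probability_eq[OF D(2)] divide_right_mono)
qed

lemma probability_bex_le:
  assumes "finite J" "\<And>i. i \<in> J \<Longrightarrow> cylinder (A i)"
  shows "probability (\<lambda>c. \<exists>i\<in>J. A i c) \<le> (\<Sum>i\<in>J. probability (A i))"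
  using assms
proof (induction J rule: finite_induct)
  case (insert i J)
  have "probability (\<lambda>c. A i c \<or> (\<exists>i\<in>J. A i c)) \<le> probability (A i) + probability (\<lambda>c. \<exists>i\<in>J. A i c)"
    using insert by (intro probability_disj_le cylinder_bex) auto
  then show ?case using insert by auto
qed (simp add: probability_False)

lemma probability_pattern:
  assumes "finite P" "finite N" "P \<inter> N = {}"
  shows "probability (\<lambda>c. P \<subseteq> c \<and> N \<inter> c = {}) = (1 / 2) ^ (card P + card N)"
proof -
  have "depends_on (P \<union> N) (\<lambda>c. P \<subseteq> c \<and> N \<inter> c = {})"
  proof (rule depends_on_conv)
    fix c c' assume "c \<inter> (P \<union> N) = c' \<inter> (P \<union> N)"
    then show "(P \<subseteq> c \<and> N \<inter> c = {}) = (P \<subseteq> c' \<and> N \<inter> c' = {})" by blast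
  qed (use assms in auto)
  moreover have "{c. c \<subseteq> P \<union> N \<and> P \<subseteq> c \<and> N \<inter> c = {}} = {P}" using assms(3) by blast
  ultimately show ?thesis
    using assms by (simp add: probability_eq card_Un_disjoint power_divide)
qed

lemma complex_of_rat_eq_of_real: "complex_of_rat q = of_real (of_rat q)"
  by (cases q) (simp add: of_rat_rat)

locale lamp_group = group G for G :: "('a, 'b) monoid_scheme" (structure) +
  fixes U :: "'l set \<Rightarrow> 'a"
  assumes U_closed: "finite S \<Longrightarrow> U S \<in> carrier G"
    and U_mult: "finite S \<Longrightarrow> finite R \<Longrightarrow> U S \<otimes> U R = U (sym_diff S R)"
    and U_faithful: "finite S \<Longrightarrow> U S = \<one> \<Longrightarrow> S = {}"
begin

lemma U_empty: "U {} = \<one>"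
  using U_mult[of "{}" "{}"] U_closed[of "{}"] by (simp add: l_cancel_one)

lemma U_inv: "finite S \<Longrightarrow> inv (U S) = U S"
  by (rule inv_equality) (auto simp: U_mult U_closed U_empty)

text \<open>The operator of the group ring element that Fourier inversion assigns to the indicator of \<open>A\<close>.\<close>

definition pattern_op :: "'l set \<Rightarrow> ('l set \<Rightarrow> bool) \<Rightarrow> ('a \<Rightarrow> complex) \<Rightarrow> 'a \<Rightarrow> complex" where
  "pattern_op D A \<xi> = (\<lambda>x. \<Sum>S\<in>Pow D. of_rat (walsh_coeff D A S) * left_regular G (U S) \<xi> x)"

definition event_proj :: "('l set \<Rightarrow> bool) \<Rightarrow> ('a \<Rightarrow> complex) \<Rightarrow> 'a \<Rightarrow> complex" where
  "event_proj A = pattern_op (event_support A) A"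

lemma pattern_op_extend:
  assumes "depends_on D A" "D \<subseteq> D'" "finite D'"
  shows "pattern_op D' A \<xi> = pattern_op D A \<xi>"
proof
  fix x
  have "pattern_op D' A \<xi> x =
      (\<Sum>S\<in>Pow D. of_rat (walsh_coeff D' A S) * left_regular G (U S) \<xi> x)"
    unfolding pattern_op_def
  proof (rule sum.mono_neutral_right)
    show "\<forall>S\<in>Pow D' - Pow D. of_rat (walsh_coeff D' A S) * left_regular G (U S) \<xi> x = 0"
    proof
      fix S assume S: "S \<in> Pow D' - Pow D"
      then have "finite S" "S \<inter> (D' - D) \<noteq> {}" using assms(3) by (auto intro: finite_subset)
      then have "walsh_coeff D' A S = 0" by (simp add: walsh_coeff_mono[OF _ assms])
      then show "of_rat (walsh_coeff D' A S) * left_regular G (U S) \<xi> x = 0" by simp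
    qed
  qed (use assms in auto)
  also have "\<dots> = pattern_op D A \<xi> x"
    unfolding pattern_op_def
  proof (rule sum.cong[OF refl])
    fix S assume "S \<in> Pow D"
    then have "walsh_coeff D' A S = walsh_coeff D A S"
      using depends_on_finite[OF assms(1)]
      by (subst walsh_coeff_mono[OF _ assms]) (auto intro: finite_subset)
    then show "of_rat (walsh_coeff D' A S) * left_regular G (U S) \<xi> x =
      of_rat (walsh_coeff D A S) * left_regular G (U S) \<xi> x" by simp
  qed
  finally show "pattern_op D' A \<xi> x = pattern_op D A \<xi> x" .
qed

lemma event_proj_eq:
  assumes "depends_on D A"
  shows "event_proj A \<xi> = pattern_op D A \<xi>"
proof -
  have D': "depends_on (event_support A) A"
    using assms by (intro cylinder_support) (rule cylinderI)
  have "finite (D \<union> event_support A)" using assms D' by (simp add: depends_on_finite)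
  then show ?thesis
    using pattern_op_extend[OF assms, of "D \<union> event_support A" \<xi>]
      pattern_op_extend[OF D', of "D \<union> event_support A" \<xi>] by (simp add: event_proj_def)
qed

lemma event_proj_group_algebra_op:
  assumes "cylinder A"
  shows "group_algebra_op G (event_proj A)"
  unfolding event_proj_def pattern_op_def using depends_on_finite[OF cylinder_support[OF assms]]
  by (intro group_algebra_op_sum group_algebra_op_translate U_closed) (auto intro: finite_subset)

lemma event_proj_conj:
  assumes "cylinder A" "cylinder B"
  shows "event_proj A (event_proj B \<xi>) = event_proj (\<lambda>c. A c \<and> B c) \<xi>"
proof -
  obtain D where D: "depends_on D A" "depends_on D B" by (rule cylinder_common[OF assms])
  then have D': "depends_on D (\<lambda>c. A c \<and> B c)" by (rule depends_on_conj)
  have fin: "finite D" using D by (simp add: depends_on_finite)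
  have finS: "finite S" if "S \<in> Pow D" for S using that fin by (auto intro: finite_subset)
  let ?a = "\<lambda>S. of_rat (walsh_coeff D A S) :: complex"
  let ?b = "\<lambda>S. of_rat (walsh_coeff D B S) :: complex"
  let ?L = "\<lambda>S. left_regular G (U S) \<xi>"
  have "pattern_op D A (pattern_op D B \<xi>) x = pattern_op D (\<lambda>c. A c \<and> B c) \<xi> x" for x
  proof -
    have "pattern_op D A (pattern_op D B \<xi>) x =
      (\<Sum>S\<in>Pow D. \<Sum>R\<in>Pow D. ?a S * ?b R * ?L (sym_diff S R) x)"
      unfolding pattern_op_def
      by (intro sum.cong refl)
        (simp add: left_regular_sum left_regular_scale left_regular_mult U_closed finS
          U_mult sum_distrib_left mult.assoc)
    also have "\<dots> = (\<Sum>S\<in>Pow D. \<Sum>R\<in>Pow D. ?a S * ?b (sym_diff S R) * ?L R x)"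
    proof (rule sum.cong[OF refl])
      fix S assume S: "S \<in> Pow D"
      have inv: "sym_diff S (sym_diff S R) = R" for R by blast
      show "(\<Sum>R\<in>Pow D. ?a S * ?b R * ?L (sym_diff S R) x) =
        (\<Sum>R\<in>Pow D. ?a S * ?b (sym_diff S R) * ?L R x)"
        by (rule sum.reindex_bij_witness[where i = "sym_diff S" and j = "sym_diff S"])
          (use S in \<open>auto simp: inv\<close>)
    qed
    also have "\<dots> = (\<Sum>R\<in>Pow D. (\<Sum>S\<in>Pow D. ?a S * ?b (sym_diff S R)) * ?L R x)"
      by (subst sum.swap) (simp add: sum_distrib_right)
    also have "\<dots> = (\<Sum>R\<in>Pow D. of_rat (walsh_coeff D (\<lambda>c. A c \<and> B c) R) * ?L R x)"
    proof (rule sum.cong[OF refl])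
      fix R assume "R \<in> Pow D"
      then have "(\<Sum>S\<in>Pow D. ?a S * ?b (sym_diff S R)) = of_rat (walsh_coeff D (\<lambda>c. A c \<and> B c) R)"
        by (subst walsh_coeff_convolution[OF fin, symmetric]) (auto simp: of_rat_sum of_rat_mult)
      then show "(\<Sum>S\<in>Pow D. ?a S * ?b (sym_diff S R)) * ?L R x =
        of_rat (walsh_coeff D (\<lambda>c. A c \<and> B c) R) * ?L R x" by simp
    qed
    finally show ?thesis by (simp add: pattern_op_def)
  qed
  then show ?thesis
    by (auto simp: event_proj_eq[OF D(1)] event_proj_eq[OF D(2)] event_proj_eq[OF D'] fun_eq_iff)
qed

lemma event_proj_True: "event_proj (\<lambda>c. True) \<xi> = left_regular G \<one> \<xi>"
proof -
  have "depends_on {} (\<lambda>c. True)" by (simp add: depends_on_def)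
  then have "event_proj (\<lambda>c. True) \<xi> = pattern_op {} (\<lambda>c. True) \<xi>" by (rule event_proj_eq)
  then show ?thesis by (simp add: pattern_op_def walsh_coeff_def walsh_def U_empty)
qed

lemma event_proj_False: "event_proj (\<lambda>c. False) \<xi> = (\<lambda>x. 0)"
  by (simp add: event_proj_def pattern_op_def walsh_coeff_def)

lemma event_proj_disj:
  assumes "cylinder A" "cylinder B" "\<And>c. \<not> (A c \<and> B c)"
  shows "event_proj (\<lambda>c. A c \<or> B c) \<xi> x = event_proj A \<xi> x + event_proj B \<xi> x"
proof -
  obtain D where D: "depends_on D A" "depends_on D B" by (rule cylinder_common[OF assms(1,2)])
  then have D': "depends_on D (\<lambda>c. A c \<or> B c)" by (rule depends_on_disj)
  have fin: "finite D" using D by (simp add: depends_on_finite)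
  have "{c. c \<subseteq> D \<and> (A c \<or> B c)} = {c. c \<subseteq> D \<and> A c} \<union> {c. c \<subseteq> D \<and> B c}" by blast
  then have "(\<Sum>c | c \<subseteq> D \<and> (A c \<or> B c). walsh c S) =
    (\<Sum>c | c \<subseteq> D \<and> A c. walsh c S) + (\<Sum>c | c \<subseteq> D \<and> B c. walsh c S)" for S
    by (simp only:) (rule sum.union_disjoint, use fin assms(3) in auto)
  then have "walsh_coeff D (\<lambda>c. A c \<or> B c) S = walsh_coeff D A S + walsh_coeff D B S" for S
    by (simp add: walsh_coeff_def add_divide_distrib)
  then show ?thesis
    by (simp add: event_proj_eq[OF D(1)] event_proj_eq[OF D(2)] event_proj_eq[OF D']
        pattern_op_def of_rat_add distrib_right sum.distrib)
qed

lemma event_proj_sum: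
  assumes "finite J" "\<And>i. i \<in> J \<Longrightarrow> cylinder (A i)"
    and "\<And>i j c. i \<in> J \<Longrightarrow> j \<in> J \<Longrightarrow> A i c \<Longrightarrow> A j c \<Longrightarrow> i = j"
  shows "event_proj (\<lambda>c. \<exists>i\<in>J. A i c) \<xi> x = (\<Sum>i\<in>J. event_proj (A i) \<xi> x)"
  using assms
proof (induction J rule: finite_induct)
  case (insert i J)
  have "event_proj (\<lambda>c. A i c \<or> (\<exists>i\<in>J. A i c)) \<xi> x =
    event_proj (A i) \<xi> x + event_proj (\<lambda>c. \<exists>i\<in>J. A i c) \<xi> x"
  proof (rule event_proj_disj)
    show "\<not> (A i c \<and> (\<exists>i\<in>J. A i c))" for c using insert(2,5) by (metis insertCI)
  qed (use insert in \<open>auto intro: cylinder_bex\<close>)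
  also have "event_proj (\<lambda>c. \<exists>i\<in>J. A i c) \<xi> x = (\<Sum>i\<in>J. event_proj (A i) \<xi> x)"
    by (rule insert.IH) (use insert(4,5) in blast)+
  finally show ?case using insert(1,2) by simp
qed (simp add: event_proj_False)

text \<open>The lamps are involutions and the coefficients are rational, so that the projections are
  self-adjoint.\<close>

lemma event_proj_adjoint:
  assumes "cylinder A" "\<xi> \<in> ell2 G" "\<eta> \<in> ell2 G"
  shows "ell2_inner G (event_proj A \<xi>) \<eta> = ell2_inner G \<xi> (event_proj A \<eta>)"
proof -
  let ?D = "event_support A"
  have fin: "finite ?D" by (rule depends_on_finite[OF cylinder_support[OF assms(1)]])
  have S: "U S \<in> carrier G" "inv (U S) = U S" if "S \<in> Pow ?D" for S
    using that fin by (auto intro: finite_subset U_closed U_inv)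
  have cnj_rat: "cnj (of_rat q) = of_rat q" for q
    by (simp add: complex_of_rat_eq_of_real)
  show ?thesis
    unfolding event_proj_def pattern_op_def
    by (subst ell2_inner_sum_left, use assms S in \<open>auto intro!: ell2_scale left_regular_ell2\<close>)
      (subst ell2_inner_sum_right, use assms S in \<open>auto intro!: ell2_scale left_regular_ell2 sum.cong
        simp: ell2_inner_scale_left ell2_inner_scale_right left_regular_adjoint cnj_rat\<close>)
qed

text \<open>Only the coefficient of the neutral element contributes, and this is the mean of the indicator.\<close>

lemma event_proj_delta:
  assumes "cylinder A" "g \<in> carrier G" "h \<in> carrier G"
    and "\<And>S. finite S \<Longrightarrow> U S \<otimes> g = h \<Longrightarrow> S = {}"
  shows "event_proj A (delta g) h = (if g = h then of_real (probability A) else 0)"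
proof -
  let ?D = "event_support A"
  have D: "depends_on ?D A" by (rule cylinder_support[OF assms(1)])
  have fin: "finite ?D" by (rule depends_on_finite[OF D])
  have "event_proj A (delta g) h = (\<Sum>S\<in>Pow ?D. of_rat (walsh_coeff ?D A S) * delta (U S \<otimes> g) h)"
    unfolding event_proj_def pattern_op_def using fin
    by (intro sum.cong refl) (subst left_regular_delta, auto intro: finite_subset U_closed assms)
  also have "\<dots> = (\<Sum>S\<in>{{}}. of_rat (walsh_coeff ?D A S) * delta (U S \<otimes> g) h)"
    using fin assms(4) by (intro sum.mono_neutral_right) (auto simp: delta_def intro: finite_subset)
  also have "\<dots> = (if g = h then of_rat (walsh_coeff ?D A {}) else 0)"
    using assms(2) by (auto simp: delta_def U_empty)
  finally show ?thesis
    by (simp add: walsh_coeff_empty_eq_probability[OF D, symmetric] complex_of_rat_eq_of_real)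
qed

lemma event_proj_norm_delta_one:
  assumes "cylinder A"
  shows "ell2_norm G (event_proj A (delta \<one>)) = sqrt (probability A)"
proof -
  have 2: "delta \<one> \<in> ell2 G" "event_proj A (delta \<one>) \<in> ell2 G"
    using group_algebra_op_ell2[OF event_proj_group_algebra_op[OF assms]] by (auto intro: delta_ell2)
  have "of_real ((ell2_norm G (event_proj A (delta \<one>)))\<^sup>2) =
      ell2_inner G (event_proj A (event_proj A (delta \<one>))) (delta \<one>)"
    using ell2_inner_self[OF 2(2)] event_proj_adjoint[OF assms 2(2) 2(1)] by simp
  also have "\<dots> = of_real (probability A)"
    using event_proj_delta[OF assms one_closed one_closed] U_faithful
    by (simp add: assms event_proj_conj ell2_inner_delta_right U_closed)
  finally have "(ell2_norm G (event_proj A (delta \<one>)))\<^sup>2 = probability A" by (simp only: of_real_eq_iff)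
  then show ?thesis using ell2_norm_nonneg by (metis real_sqrt_unique)
qed

text \<open>An element that permutes the lamps by conjugation carries the projection of an event to that of the
  permuted event.\<close>

lemma event_proj_translate:
  assumes A: "cylinder A" and g: "g \<in> carrier G" and inj: "inj \<pi>"
    and g_act: "\<And>S. finite S \<Longrightarrow> g \<otimes> U S = U (\<pi> ` S) \<otimes> g"
  shows "left_regular G g (event_proj A \<xi>) = event_proj (\<lambda>c. A (\<pi> -` c)) (left_regular G g \<xi>)"
proof -
  let ?D = "event_support A" and ?B = "\<lambda>c. A (\<pi> -` c)"
  have D: "depends_on ?D A" by (rule cylinder_support[OF A])
  have fin: "finite ?D" by (rule depends_on_finite[OF D])
  have D': "depends_on (\<pi> ` ?D) ?B" by (rule depends_on_vimage[OF inj D])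
  have finS: "finite S" if "S \<in> Pow ?D" for S using that fin by (auto intro: finite_subset)
  have inj': "inj_on \<pi> S" for S using inj by (rule inj_on_subset) simp
  have pre: "\<pi> -` (\<pi> ` c) = c" for c using inj by (rule inj_vimage_image_eq)
  have w: "walsh (\<pi> ` c) (\<pi> ` S) = walsh c S" for c S
    unfolding walsh_def by (subst prod.reindex[OF inj']) (simp add: inj_image_mem_iff[OF inj])
  have coeff: "walsh_coeff (\<pi> ` ?D) ?B (\<pi> ` S) = walsh_coeff ?D A S" for S
  proof -
    have "{c. c \<subseteq> \<pi> ` ?D \<and> ?B c} = (`) \<pi> ` {c. c \<subseteq> ?D \<and> A c}"
      by (auto simp: subset_image_iff pre)
    moreover have "inj_on ((`) \<pi>) {c. c \<subseteq> ?D \<and> A c}"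
      by (rule inj_on_inverseI[where g = "(-`) \<pi>"]) (simp add: pre)
    ultimately have "(\<Sum>c | c \<subseteq> \<pi> ` ?D \<and> ?B c. walsh c (\<pi> ` S)) = (\<Sum>c | c \<subseteq> ?D \<and> A c. walsh c S)"
      by (simp add: sum.reindex w)
    then show ?thesis by (simp add: walsh_coeff_def card_image[OF inj'])
  qed
  have "left_regular G g (pattern_op ?D A \<xi>) x = pattern_op (\<pi> ` ?D) ?B (left_regular G g \<xi>) x" for x
  proof -
    have "left_regular G g (pattern_op ?D A \<xi>) x =
      (\<Sum>S\<in>Pow ?D. of_rat (walsh_coeff ?D A S) * left_regular G (U (\<pi> ` S)) (left_regular G g \<xi>) x)"
      unfolding pattern_op_def left_regular_sum left_regular_scale
      by (intro sum.cong refl) (simp add: left_regular_mult U_closed finS g g_act)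
    also have "\<dots> = (\<Sum>S\<in>(`) \<pi> ` Pow ?D. of_rat (walsh_coeff (\<pi> ` ?D) ?B S) * left_regular G (U S) (left_regular G g \<xi>) x)"
    proof (rule sum.reindex_cong[symmetric])
      show "inj_on ((`) \<pi>) (Pow ?D)" by (rule inj_on_inverseI[where g = "(-`) \<pi>"]) (simp add: pre)
    qed (simp_all add: coeff)
    also have "(`) \<pi> ` Pow ?D = Pow (\<pi> ` ?D)" by (simp add: image_Pow_surj)
    finally show ?thesis by (simp add: pattern_op_def)
  qed
  then show ?thesis by (auto simp: event_proj_eq[OF D] event_proj_eq[OF D'] fun_eq_iff)
qed

end

section \<open>Null events and changes of viewpoint\<close>

context lamp_group
begin

lemma event_proj_absorb:
  assumes "cylinder A" "cylinder B" "\<And>c. A c \<Longrightarrow> B c"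
  shows "event_proj A (event_proj B \<xi>) = event_proj A \<xi>"
proof -
  have "(\<lambda>c. A c \<and> B c) = A" using assms(3) by (auto simp: fun_eq_iff)
  then show ?thesis using event_proj_conj[OF assms(1,2)] by simp
qed

lemma event_proj_null_subset:
  assumes "cylinder A" "cylinder B" "\<And>c. A c \<Longrightarrow> B c" "event_proj B \<xi> = (\<lambda>x. 0)"
  shows "event_proj A \<xi> = (\<lambda>x. 0)"
  using event_proj_absorb[OF assms(1-3), of \<xi>] assms(4)
    group_algebra_op_of_zero[OF event_proj_group_algebra_op[OF assms(1)]] by simp

lemma event_proj_null_disj:
  assumes "cylinder A" "cylinder B" "event_proj A \<xi> = (\<lambda>x. 0)" "event_proj B \<xi> = (\<lambda>x. 0)"
  shows "event_proj (\<lambda>c. A c \<or> B c) \<xi> = (\<lambda>x. 0)"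
proof -
  have cyl: "cylinder (\<lambda>c. B c \<and> \<not> A c)" using assms(1,2) by (intro cylinder_conj cylinder_not)
  have B: "event_proj (\<lambda>c. B c \<and> \<not> A c) \<xi> = (\<lambda>x. 0)"
    by (rule event_proj_null_subset[OF cyl assms(2) _ assms(4)]) simp
  have "event_proj (\<lambda>c. A c \<or> (B c \<and> \<not> A c)) \<xi> x = 0" for x
    by (subst event_proj_disj[OF assms(1) cyl]) (simp_all add: assms(3) B)
  moreover have "(\<lambda>c. A c \<or> (B c \<and> \<not> A c)) = (\<lambda>c. A c \<or> B c)" by auto
  ultimately show ?thesis by (simp add: fun_eq_iff)
qed

lemma event_proj_null_bex:
  assumes "finite J" "\<And>i. i \<in> J \<Longrightarrow> cylinder (A i)" "\<And>i. i \<in> J \<Longrightarrow> event_proj (A i) \<xi> = (\<lambda>x. 0)"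
  shows "event_proj (\<lambda>c. \<exists>i\<in>J. A i c) \<xi> = (\<lambda>x. 0)"
  using assms
proof (induction J rule: finite_induct)
  case (insert i J)
  have "event_proj (\<lambda>c. A i c \<or> (\<exists>i\<in>J. A i c)) \<xi> = (\<lambda>x. 0)"
    using insert by (intro event_proj_null_disj cylinder_bex) auto
  then show ?case by simp
qed (simp add: event_proj_False)

text \<open>Conjugation by \<open>g\<close> permutes the lamps by \<open>\<pi>\<close>; then \<open>\<pi> -` c\<close> is the configuration \<open>c\<close> as seen from \<open>g\<close>.\<close>

definition acts :: "'a \<Rightarrow> ('l \<Rightarrow> 'l) \<Rightarrow> bool" where
  "acts g \<pi> \<longleftrightarrow> g \<in> carrier G \<and> bij \<pi> \<and> (\<forall>S. finite S \<longrightarrow> g \<otimes> U S = U (\<pi> ` S) \<otimes> g)"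

lemma acts_closed: "acts g \<pi> \<Longrightarrow> g \<in> carrier G"
  by (simp add: acts_def)

lemma acts_one: "acts \<one> (\<lambda>x. x)"
  by (simp add: acts_def U_closed bij_id[unfolded id_def])

lemma acts_mult:
  assumes "acts g \<pi>" "acts h \<rho>"
  shows "acts (g \<otimes> h) (\<lambda>x. \<pi> (\<rho> x))"
proof -
  have "(g \<otimes> h) \<otimes> U S = U (\<pi> ` \<rho> ` S) \<otimes> (g \<otimes> h)" if S: "finite S" for S
  proof -
    have gU: "g \<otimes> U (\<rho> ` S) = U (\<pi> ` \<rho> ` S) \<otimes> g" and hU: "h \<otimes> U S = U (\<rho> ` S) \<otimes> h"
      using assms S by (simp_all add: acts_def)
    have closed: "g \<in> carrier G" "h \<in> carrier G" "U S \<in> carrier G" "U (\<rho> ` S) \<in> carrier G"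
      "U (\<pi> ` \<rho> ` S) \<in> carrier G"
      using assms S by (simp_all add: acts_def U_closed)
    have "(g \<otimes> h) \<otimes> U S = (g \<otimes> U (\<rho> ` S)) \<otimes> h" using closed hU by (simp add: m_assoc)
    also have "\<dots> = U (\<pi> ` \<rho> ` S) \<otimes> (g \<otimes> h)" unfolding gU using closed by (simp add: m_assoc)
    finally show ?thesis .
  qed
  then show ?thesis
    using assms bij_comp[of \<rho> \<pi>] by (auto simp: acts_def image_image comp_def)
qed

lemma acts_inv:
  assumes "acts g \<pi>" "\<And>x. \<rho> (\<pi> x) = x" "\<And>x. \<pi> (\<rho> x) = x"
  shows "acts (inv g) \<rho>"
proof -
  have g: "g \<in> carrier G" using assms by (simp add: acts_def)
  have "inv g \<otimes> U S = U (\<rho> ` S) \<otimes> inv g" if S: "finite S" for S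
  proof -
    have "g \<otimes> U (\<rho> ` S) = U S \<otimes> g"
      using assms S by (simp add: acts_def image_image)
    then have "U (\<rho> ` S) = inv g \<otimes> (U S \<otimes> g)" using g S by (simp add: inv_solve_left U_closed)
    then show ?thesis using g S by (simp add: m_assoc U_closed)
  qed
  then show ?thesis using g assms(2,3) by (auto simp: acts_def intro!: o_bij[of \<pi> \<rho>])
qed

lemma acts_event_proj:
  assumes "acts g \<pi>" "cylinder A"
  shows "left_regular G g (event_proj A \<xi>) = event_proj (\<lambda>c. A (\<pi> -` c)) (left_regular G g \<xi>)"
  using assms by (intro event_proj_translate) (auto simp: acts_def bij_def)

lemma acts_cylinder: "acts g \<pi> \<Longrightarrow> cylinder A \<Longrightarrow> cylinder (\<lambda>c. A (\<pi> -` c))"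
  by (rule cylinder_vimage) (auto simp: acts_def bij_def)

text \<open>Moving a vector to the vertex \<open>g\<close> makes the event refer to the view from \<open>g\<close>.\<close>

lemma acts_event_proj_inv:
  assumes "acts g \<pi>" "cylinder A" "\<phi> \<in> ell2 G"
  shows "event_proj A (left_regular G (inv g) \<phi>) =
    left_regular G (inv g) (event_proj (\<lambda>c. A (\<pi> -` c)) \<phi>)"
proof -
  have g: "g \<in> carrier G" using assms by (simp add: acts_def)
  have 2: "event_proj A (left_regular G (inv g) \<phi>) \<in> ell2 G"
    using assms g by (intro group_algebra_op_ell2[OF event_proj_group_algebra_op] left_regular_ell2) auto
  have "left_regular G g (event_proj A (left_regular G (inv g) \<phi>)) =
     event_proj (\<lambda>c. A (\<pi> -` c)) \<phi>"
    using g by (simp add: acts_event_proj[OF assms(1,2)] left_regular_mult left_regular_one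
        ell2_outside[OF assms(3)])
  then have "left_regular G (inv g) (left_regular G g (event_proj A (left_regular G (inv g) \<phi>))) =
     left_regular G (inv g) (event_proj (\<lambda>c. A (\<pi> -` c)) \<phi>)" by simp
  then show ?thesis using g by (simp add: left_regular_mult left_regular_one ell2_outside[OF 2])
qed

end

section \<open>The percolation graph and its components\<close>

text \<open>The action of \<open>r = s\<^sup>2\<close>, to the power \<open>k\<close>. Each vertex owns two consecutive levels, which is why one
  step moves the lamps by two.\<close>

definition shift :: "int \<Rightarrow> int \<times> bool \<Rightarrow> int \<times> bool" where
  "shift k = (\<lambda>(n, b). (n + 2 * k, b))"

definition flip :: "int set \<Rightarrow> int \<times> bool \<Rightarrow> int \<times> bool" where
  "flip F = (\<lambda>(n, b). (n, b \<noteq> (n \<in> F)))"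

lemma shift_add: "shift j (shift k x) = shift (j + k) x"
  by (simp add: shift_def split: prod.split)

lemma shift_0: "shift 0 = (\<lambda>x. x)"
  by (simp add: shift_def fun_eq_iff)

lemma flip_flip: "flip F (flip F x) = x"
  by (auto simp: flip_def split: prod.split)

lemma vimage_shift_add: "shift j -` (shift k -` c) = shift (k + j) -` c"
  unfolding vimage_def by (simp add: shift_add add.commute)

lemma vimage_shift_0: "shift 0 -` c = c"
  by (simp add: shift_0)

lemma vimage_flip_flip: "flip F -` (flip F -` c) = c"
  unfolding vimage_def by (simp add: flip_flip)

text \<open>The lamp at level 0 decides whether the base vertex is stale or starts a new arm; the one at level 1
  tells the two kinds of starts apart. The kinds serve to break the symmetry between the two arms of a
  component, and to mark arms that end well.\<close>

definition fresh :: "(int \<times> bool) set \<Rightarrow> bool" where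
  "fresh c \<longleftrightarrow> (0, False) \<in> c"

definition head_X :: "(int \<times> bool) set \<Rightarrow> bool" where
  "head_X c \<longleftrightarrow> (0, False) \<in> c \<and> (1, False) \<in> c"

definition head_Y :: "(int \<times> bool) set \<Rightarrow> bool" where
  "head_Y c \<longleftrightarrow> (0, False) \<in> c \<and> \<not> (1, False) \<in> c"

lemma fresh_iff: "fresh c \<longleftrightarrow> head_X c \<or> head_Y c"
  by (auto simp: fresh_def head_X_def head_Y_def)

lemma not_X_and_Y: "head_X c \<Longrightarrow> \<not> head_Y c"
  by (auto simp: head_X_def head_Y_def)

definition up_edge :: "(int \<times> bool) set \<Rightarrow> bool" where
  "up_edge c \<longleftrightarrow> \<not> fresh (shift 1 -` c)"

definition cross_edge :: "int set \<Rightarrow> (int \<times> bool) set \<Rightarrow> bool" where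
  "cross_edge F c \<longleftrightarrow> head_X c \<and> head_Y (flip F -` c)"

text \<open>The last condition kills the top of an arm that is followed by a \<open>Y\<close>. Thus the fate of a component
  depends jointly on the ends of its two arms, and so on the correlation between them; an end condition
  on one arm only would have a probability independent of that correlation.\<close>

definition killed :: "int set \<Rightarrow> (int \<times> bool) set \<Rightarrow> bool" where
  "killed F c \<longleftrightarrow> (head_X c \<and> \<not> head_Y (flip F -` c)) \<or> (head_Y c \<and> \<not> head_X (flip F -` c))
     \<or> head_Y (shift 1 -` c)"

definition arm_ends :: "nat \<Rightarrow> (int \<times> bool) set \<Rightarrow> bool" where
  "arm_ends a c \<longleftrightarrow> (\<forall>j\<in>{1..a}. \<not> fresh (shift (int j) -` c)) \<and> head_X (shift (int a + 1) -` c)"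

definition good :: "int set \<Rightarrow> nat \<times> nat \<Rightarrow> (int \<times> bool) set \<Rightarrow> bool" where
  "good F \<tau> c \<longleftrightarrow> head_X c \<and> head_Y (flip F -` c) \<and>
     arm_ends (fst \<tau>) c \<and> arm_ends (snd \<tau>) (flip F -` c)"

definition arm_map :: "int set \<Rightarrow> bool \<Rightarrow> int \<times> bool \<Rightarrow> int \<times> bool" where
  "arm_map F \<beta> = (if \<beta> then flip F else (\<lambda>x. x))"

definition arm_length :: "nat \<times> nat \<Rightarrow> bool \<Rightarrow> nat" where
  "arm_length \<tau> \<beta> = (if \<beta> then snd \<tau> else fst \<tau>)"

text \<open>A vertex of a component is given by its arm (\<open>False\<close> for the one at the \<open>X\<close>, \<open>True\<close> for the one at the
  \<open>Y\<close>) and its height on this arm.\<close>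

definition positions :: "nat \<times> nat \<Rightarrow> (bool \<times> nat) set" where
  "positions \<tau> = (SIGMA \<beta>:UNIV. {..arm_length \<tau> \<beta>})"

lemma finite_positions: "finite (positions \<tau>)"
  by (simp add: positions_def)

lemma positions_iff: "(\<beta>, j) \<in> positions \<tau> \<longleftrightarrow> j \<le> arm_length \<tau> \<beta>"
  by (simp add: positions_def)

lemma sum_positions:
  "(\<Sum>p\<in>positions \<tau>. f p) = (\<Sum>\<beta>\<in>UNIV. \<Sum>j\<le>arm_length \<tau> \<beta>. f (\<beta>, j))"
  unfolding positions_def by (subst sum.Sigma) (simp_all add: case_prod_beta')

lemma card_positions_pos: "0 < card (positions \<tau>)"
  using finite_positions[of \<tau>] positions_iff[of False 0 \<tau>] by (auto simp: card_gt_0_iff)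

lemma arm_map_flip: "arm_map F \<beta> -` (arm_map F \<beta> -` c) = c"
  by (simp add: arm_map_def vimage_flip_flip)

lemmas event_defs = good_def killed_def cross_edge_def up_edge_def arm_ends_def fresh_def
  head_X_def head_Y_def vimage_eq

lemmas cylinder_intros = cylinder_conj cylinder_disj cylinder_not cylinder_ball cylinder_bex
  cylinder_mem cylinder_imp

lemma cylinder_up_edge: "cylinder up_edge"
  by (unfold event_defs[abs_def], intro cylinder_intros)

lemma cylinder_cross_edge: "cylinder (cross_edge F)"
  by (unfold event_defs[abs_def], intro cylinder_intros)

lemma cylinder_killed: "cylinder (killed F)"
  by (unfold event_defs[abs_def], intro cylinder_intros)

lemma cylinder_good: "cylinder (good F \<tau>)"
  by (unfold event_defs[abs_def], intro cylinder_intros) simp_all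

lemma good_arm:
  assumes "good F \<tau> c"
  shows "arm_ends (arm_length \<tau> \<beta>) (arm_map F \<beta> -` c)" "fresh (arm_map F \<beta> -` c)"
    "head_X (arm_map F \<beta> -` c) \<longleftrightarrow> \<not> \<beta>" "head_Y (arm_map F \<beta> -` c) \<longleftrightarrow> \<beta>"
    "head_X (flip F -` (arm_map F \<beta> -` c)) \<longleftrightarrow> \<beta>" "head_Y (flip F -` (arm_map F \<beta> -` c)) \<longleftrightarrow> \<not> \<beta>"
  using assms
  by (auto simp: good_def arm_length_def arm_map_def fresh_iff vimage_flip_flip not_X_and_Y)

lemma arm_ends_not_fresh: "arm_ends a c \<Longrightarrow> 1 \<le> j \<Longrightarrow> j \<le> a \<Longrightarrow> \<not> fresh (shift (int j) -` c)"
  by (simp add: arm_ends_def)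

lemma arm_ends_unique:
  assumes "arm_ends a c" "arm_ends b c"
  shows "a = b"
proof -
  have le: "b \<le> a" if "arm_ends a c" "arm_ends b c" for a b
  proof (rule ccontr)
    assume "\<not> b \<le> a"
    then have "\<not> fresh (shift (int (a + 1)) -` c)"
      using arm_ends_not_fresh[OF that(2), of "a + 1"] by simp
    then show False using that(1) by (simp add: arm_ends_def fresh_iff add.commute)
  qed
  show ?thesis using le[OF assms] le[OF assms(2,1)] by simp
qed

text \<open>A configuration determines the component of the base vertex and its position there: the height is
  the distance to the first vertex below that is not stale, the symbol found there tells the arm, and
  the lengths of the arms are determined by the first symbols above that are not stale.\<close>

lemma good_unique:
  assumes "good F \<tau> (arm_map F \<beta> -` (shift (- int k) -` c))" "k \<le> arm_length \<tau> \<beta>"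
    and "good F \<tau>' (arm_map F \<beta>' -` (shift (- int k') -` c))" "k' \<le> arm_length \<tau>' \<beta>'"
  shows "\<tau> = \<tau>' \<and> \<beta> = \<beta>' \<and> k = k'"
proof -
  have k_least: "fresh (shift (- int k) -` c) \<and> (\<forall>i<k. \<not> fresh (shift (- int i) -` c))"
    if g: "good F \<tau> (arm_map F \<beta> -` (shift (- int k) -` c))" and k: "k \<le> arm_length \<tau> \<beta>"
    for \<tau> \<beta> k
  proof (intro conjI allI impI)
    show "fresh (shift (- int k) -` c)" using good_arm(2)[OF g, of \<beta>] by (simp add: arm_map_flip)
    fix i assume "i < k"
    then have "\<not> fresh (shift (int (k - i)) -` (shift (- int k) -` c))"
      using arm_ends_not_fresh[OF good_arm(1)[OF g, of \<beta>], of "k - i"] k by (simp add: arm_map_flip)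
    then show "\<not> fresh (shift (- int i) -` c)" using \<open>i < k\<close> by (simp add: vimage_shift_add of_nat_diff)
  qed
  have k: "k = k'" using k_least[OF assms(1,2)] k_least[OF assms(3,4)] by (meson linorder_neqE_nat)
  have \<beta>: "\<beta> = \<beta>'"
    using good_arm(3)[OF assms(1), of \<beta>] good_arm(3)[OF assms(3), of \<beta>'] k
    by (simp add: arm_map_flip)
  have "good F \<tau>' (arm_map F \<beta> -` (shift (- int k) -` c))" using assms(3) k \<beta> by simp
  then have "arm_length \<tau> \<gamma> = arm_length \<tau>' \<gamma>" for \<gamma>
    using arm_ends_unique good_arm(1)[OF assms(1)] good_arm(1) by blast
  from this[of False] this[of True] have "\<tau> = \<tau>'" by (simp add: arm_length_def prod_eq_iff)
  with k \<beta> show ?thesis by simp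
qed

text \<open>The assumption \<open>vertices_separated\<close> says that the vertices of a component are distinct modulo the
  lamps.\<close>

locale two_arms = lamp_group G U
  for G :: "('a, 'b) monoid_scheme" (structure) and U :: "(int \<times> bool) set \<Rightarrow> 'a" +
  fixes r t :: 'a and F :: "int set"
  assumes r_closed: "r \<in> carrier G" and t_closed: "t \<in> carrier G"
    and r_U: "finite S \<Longrightarrow> r \<otimes> U S = U (shift 1 ` S) \<otimes> r"
    and t_U: "finite S \<Longrightarrow> t \<otimes> U S = U (flip F ` S) \<otimes> t"
    and vertices_separated: "finite S \<Longrightarrow>
      U S \<otimes> ((if \<beta>' then t else \<one>) \<otimes> r [^] (j'::nat)) = (if \<beta> then t else \<one>) \<otimes> r [^] (j::nat) \<Longrightarrow>
      \<beta> = \<beta>' \<and> j = j'"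
begin

abbreviation L :: "'a \<Rightarrow> ('a \<Rightarrow> complex) \<Rightarrow> 'a \<Rightarrow> complex" where "L \<equiv> left_regular G"
abbreviation M :: "((int \<times> bool) set \<Rightarrow> bool) \<Rightarrow> ('a \<Rightarrow> complex) \<Rightarrow> 'a \<Rightarrow> complex" where "M \<equiv> event_proj"

definition vertex :: "bool \<times> nat \<Rightarrow> 'a" where
  "vertex p = (if fst p then t else \<one>) \<otimes> r [^] snd p"

lemma acts_r: "acts r (shift 1)"
  by (auto simp: acts_def r_closed r_U shift_add shift_0 intro!: o_bij[of "shift (- 1)"])

lemma acts_t: "acts t (flip F)"
  by (auto simp: acts_def t_closed t_U flip_flip intro!: o_bij[of "flip F"])

lemma acts_inv_t: "acts (inv t) (flip F)"
  by (rule acts_inv[OF acts_t]) (simp_all add: flip_flip)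

lemma acts_r_pow: "acts (r [^] k) (shift (int k))" for k :: nat
proof (induction k)
  case 0
  show ?case using acts_one by (simp add: shift_0)
next
  case (Suc k)
  from acts_mult[OF this acts_r] show ?case by (simp add: shift_add add.commute)
qed

lemma acts_inv_r_pow: "acts (inv (r [^] k)) (shift (- int k))" for k :: nat
  by (rule acts_inv[OF acts_r_pow]) (simp_all add: shift_add shift_0)

lemma acts_arm: "acts (if \<beta> then t else \<one>) (arm_map F \<beta>)"
  by (simp add: arm_map_def acts_t acts_one)

lemma acts_vertex: "acts (vertex (\<beta>, j)) (\<lambda>x. arm_map F \<beta> (shift (int j) x))"
  unfolding vertex_def fst_conv snd_conv by (rule acts_mult[OF acts_arm acts_r_pow])

lemma vertex_closed: "vertex p \<in> carrier G"
  using acts_closed[OF acts_vertex] by (cases p) auto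

lemma vertex_separated: "finite S \<Longrightarrow> U S \<otimes> vertex q = vertex p \<Longrightarrow> p = q"
  unfolding vertex_def by (cases p; cases q) (auto dest: vertices_separated)

lemma vertex_Suc: "vertex (\<beta>, Suc j) = vertex (\<beta>, j) \<otimes> r"
  by (simp add: vertex_def m_assoc r_closed t_closed)

lemma vimage_vertex: "(\<lambda>x. arm_map F \<beta> (shift k x)) -` c = shift k -` (arm_map F \<beta> -` c)"
  by auto

lemmas M_op = event_proj_group_algebra_op
lemmas M_ell2 = group_algebra_op_ell2[OF event_proj_group_algebra_op]

text \<open>The value of a field at the vertex \<open>g\<close> is represented by \<open>L g \<zeta>\<close>, so that the three equations say that
  the field is constant along edges and vanishes at killed vertices.\<close>

definition harmonic :: "('a \<Rightarrow> complex) set" where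
  "harmonic = {\<zeta> \<in> ell2 G. M up_edge (\<lambda>x. \<zeta> x - L r \<zeta> x) = (\<lambda>x. 0) \<and>
     M (cross_edge F) (\<lambda>x. \<zeta> x - L t \<zeta> x) = (\<lambda>x. 0) \<and> M (killed F) \<zeta> = (\<lambda>x. 0)}"

lemma harmonic_ell2: "\<zeta> \<in> harmonic \<Longrightarrow> \<zeta> \<in> ell2 G"
  by (simp add: harmonic_def)

text \<open>The equations that define \<open>harmonic\<close> hold at the base vertex; by conjugation they hold at
  every vertex, as seen from there.\<close>

lemma step_transfer:
  assumes \<zeta>: "\<zeta> \<in> ell2 G" and h: "h \<in> carrier G" and B: "cylinder B"
    and eq: "M B (\<lambda>x. \<zeta> x - L h \<zeta> x) = (\<lambda>x. 0)"
    and g: "acts g \<pi>" and A: "cylinder A" and AB: "\<And>c. A c \<Longrightarrow> B (\<pi> -` c)"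
  shows "M A (L g \<zeta>) = M A (L (g \<otimes> h) \<zeta>)"
proof -
  note gc = acts_closed[OF g]
  have "M (\<lambda>c. B (\<pi> -` c)) (L g (\<lambda>x. \<zeta> x - L h \<zeta> x)) = (\<lambda>x. 0)"
    by (simp add: acts_event_proj[OF g B, symmetric] eq left_regular_zero)
  then have "M A (L g (\<lambda>x. \<zeta> x - L h \<zeta> x)) = (\<lambda>x. 0)"
    by (rule event_proj_null_subset[OF A acts_cylinder[OF g B], rotated]) (rule AB)
  then show ?thesis
    by (simp add: left_regular_diff left_regular_mult gc h group_algebra_op_distrib_diff[OF M_op[OF A]] fun_eq_iff)
qed

lemma harmonic_up:
  assumes "\<zeta> \<in> harmonic" "acts g \<pi>" "cylinder A" "\<And>c. A c \<Longrightarrow> up_edge (\<pi> -` c)"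
  shows "M A (L g \<zeta>) = M A (L (g \<otimes> r) \<zeta>)"
  using assms(1) by (intro step_transfer[OF _ r_closed cylinder_up_edge _ assms(2,3,4)]) (auto simp: harmonic_def)

lemma harmonic_cross:
  assumes "\<zeta> \<in> harmonic" "acts g \<pi>" "cylinder A" "\<And>c. A c \<Longrightarrow> cross_edge F (\<pi> -` c)"
  shows "M A (L g \<zeta>) = M A (L (g \<otimes> t) \<zeta>)"
  using assms(1) by (intro step_transfer[OF _ t_closed cylinder_cross_edge _ assms(2,3,4)]) (auto simp: harmonic_def)

lemma harmonic_killed:
  assumes "\<zeta> \<in> harmonic" "acts g \<pi>" "cylinder A" "\<And>c. A c \<Longrightarrow> killed F (\<pi> -` c)"
  shows "M A (L g \<zeta>) = (\<lambda>x. 0)"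
proof (rule event_proj_null_subset[OF assms(3) acts_cylinder[OF assms(2) cylinder_killed]])
  show "killed F (\<pi> -` c)" if "A c" for c using assms(4) that .
  show "M (\<lambda>c. killed F (\<pi> -` c)) (L g \<zeta>) = (\<lambda>x. 0)"
    using assms(1) by (simp add: acts_event_proj[OF assms(2) cylinder_killed, symmetric] harmonic_def left_regular_zero)
qed

lemma harmonic_up_pow:
  fixes k :: nat
  assumes \<zeta>: "\<zeta> \<in> harmonic" and g: "acts g \<pi>" and A: "cylinder A"
    and edges: "\<And>c j. A c \<Longrightarrow> j < k \<Longrightarrow> \<not> fresh (shift (int j + 1) -` (\<pi> -` c))"
  shows "M A (L g \<zeta>) = M A (L (g \<otimes> r [^] k) \<zeta>)"
  using edges
proof (induction k)
  case 0
  then show ?case using acts_closed[OF g] by simp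
next
  case (Suc k)
  have act: "acts (g \<otimes> r [^] k) (\<lambda>x. \<pi> (shift (int k) x))" by (rule acts_mult[OF g acts_r_pow])
  have "up_edge ((\<lambda>x. \<pi> (shift (int k) x)) -` c)" if "A c" for c
  proof -
    have "(\<lambda>x. \<pi> (shift (int k) x)) -` c = shift (int k) -` (\<pi> -` c)" by auto
    then show ?thesis using Suc.prems[OF that, of k] by (simp add: up_edge_def vimage_shift_add)
  qed
  from harmonic_up[OF \<zeta> act A this] Suc show ?case
    using acts_closed[OF g] by (simp add: m_assoc r_closed)
qed

text \<open>On a good event all values of a harmonic vector along the component agree: one passes from the base
  vertex across the edge \<open>t\<close>, if necessary, and then up the arm.\<close>

lemma harmonic_constant:
  assumes \<zeta>: "\<zeta> \<in> harmonic" and p: "p \<in> positions \<tau>"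
  shows "M (good F \<tau>) (L (vertex p) \<zeta>) = M (good F \<tau>) \<zeta>"
proof -
  obtain \<beta> j where p_eq: "p = (\<beta>, j)" by (cases p)
  have j: "j \<le> arm_length \<tau> \<beta>" using p by (simp add: p_eq positions_iff)
  note A = cylinder_good[of F \<tau>]
  have "M (good F \<tau>) (L (if \<beta> then t else \<one>) \<zeta>) = M (good F \<tau>) (L (vertex p) \<zeta>)"
    unfolding p_eq vertex_def fst_conv snd_conv
  proof (rule harmonic_up_pow[OF \<zeta> acts_arm A])
    fix c i assume "good F \<tau> c" "i < j"
    then show "\<not> fresh (shift (int i + 1) -` (arm_map F \<beta> -` c))"
      using arm_ends_not_fresh[OF good_arm(1), of F \<tau> c "i + 1" \<beta>] j by (simp add: add.commute)
  qed
  moreover have "M (good F \<tau>) (L \<one> \<zeta>) = M (good F \<tau>) (L (\<one> \<otimes> t) \<zeta>)"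
    by (rule harmonic_cross[OF \<zeta> acts_one A]) (simp add: good_def cross_edge_def)
  moreover have "L \<one> \<zeta> = \<zeta>" using ell2_outside[OF harmonic_ell2[OF \<zeta>]] by (rule left_regular_one)
  ultimately show ?thesis by (cases \<beta>) (simp_all add: t_closed)
qed

text \<open>The field that takes the value \<open>\<phi>\<close>, given from the viewpoint of the base of a component, at all
  vertices of this component.\<close>

definition spread :: "nat \<times> nat \<Rightarrow> ('a \<Rightarrow> complex) \<Rightarrow> 'a \<Rightarrow> complex" where
  "spread \<tau> \<phi> = (\<lambda>x. \<Sum>p\<in>positions \<tau>. L (inv (vertex p)) \<phi> x)"

text \<open>The orthogonal projection onto the fields that are supported on components of type \<open>\<tau>\<close> and constant
  on each of them: averaging over the component.\<close>

definition component_proj :: "nat \<times> nat \<Rightarrow> ('a \<Rightarrow> complex) \<Rightarrow> 'a \<Rightarrow> complex" where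
  "component_proj \<tau> \<xi> = (\<lambda>x. (1 / of_nat (card (positions \<tau>))) *
     spread \<tau> (M (good F \<tau>) (\<lambda>x. \<Sum>q\<in>positions \<tau>. L (vertex q) \<xi> x)) x)"

lemma spread_ell2: "\<phi> \<in> ell2 G \<Longrightarrow> spread \<tau> \<phi> \<in> ell2 G"
  unfolding spread_def by (intro ell2_sum left_regular_ell2) (simp_all add: vertex_closed)

lemma harmonic_diff:
  assumes "\<xi> \<in> harmonic" "\<zeta> \<in> harmonic"
  shows "(\<lambda>x. \<xi> x - \<zeta> x) \<in> harmonic"
proof -
  have rearrange: "(\<lambda>x. \<xi> x - \<zeta> x - (L h \<xi> x - L h \<zeta> x)) = (\<lambda>x. (\<xi> x - L h \<xi> x) - (\<zeta> x - L h \<zeta> x))" for h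
    by (simp add: algebra_simps)
  show ?thesis
    using assms unfolding harmonic_def
    by (auto simp: fun_eq_iff left_regular_diff rearrange ell2_diff
        group_algebra_op_distrib_diff[OF M_op[OF cylinder_up_edge]]
        group_algebra_op_distrib_diff[OF M_op[OF cylinder_cross_edge]]
        group_algebra_op_distrib_diff[OF M_op[OF cylinder_killed]])
qed

lemma harmonic_scale:
  assumes "\<xi> \<in> harmonic"
  shows "(\<lambda>x. a * \<xi> x) \<in> harmonic"
proof -
  have rearrange: "(\<lambda>x. a * \<xi> x - a * L h \<xi> x) = (\<lambda>x. a * (\<xi> x - L h \<xi> x))" for h
    by (simp add: algebra_simps)
  show ?thesis
    using assms unfolding harmonic_def
    by (auto simp: fun_eq_iff left_regular_scale rearrange ell2_scale
        group_algebra_op_distrib_scale[OF M_op[OF cylinder_up_edge]]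
        group_algebra_op_distrib_scale[OF M_op[OF cylinder_cross_edge]]
        group_algebra_op_distrib_scale[OF M_op[OF cylinder_killed]])
qed

lemma harmonic_zero: "(\<lambda>x. 0) \<in> harmonic"
  unfolding harmonic_def
  by (auto simp: left_regular_zero ell2_zero group_algebra_op_of_zero[OF M_op[OF cylinder_up_edge]]
     group_algebra_op_of_zero[OF M_op[OF cylinder_cross_edge]]
     group_algebra_op_of_zero[OF M_op[OF cylinder_killed]])

lemma harmonic_add:
  assumes "\<xi> \<in> harmonic" "\<zeta> \<in> harmonic"
  shows "(\<lambda>x. \<xi> x + \<zeta> x) \<in> harmonic"
  using harmonic_diff[OF assms(1) harmonic_scale[OF assms(2), of "- 1"]] by simp

lemma harmonic_sum:
  assumes "\<And>i. i \<in> A \<Longrightarrow> f i \<in> harmonic"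
  shows "(\<lambda>x. \<Sum>i\<in>A. f i x) \<in> harmonic"
  using assms by (induction A rule: infinite_finite_induct) (auto intro: harmonic_zero harmonic_add)

text \<open>A local event that is decided by the good event at the base acts on the corresponding summand of
  \<open>spread\<close> as the identity or as zero.\<close>

lemma M_good_seen:
  assumes \<phi>: "\<phi> \<in> ell2 G" "M (good F \<tau>) \<phi> = \<phi>" and g: "acts g \<pi>" and A: "cylinder A"
  shows "(\<And>c. good F \<tau> c \<Longrightarrow> A (\<pi> -` c)) \<Longrightarrow> M A (L (inv g) \<phi>) = L (inv g) \<phi>"
    and "(\<And>c. good F \<tau> c \<Longrightarrow> \<not> A (\<pi> -` c)) \<Longrightarrow> M A (L (inv g) \<phi>) = (\<lambda>x. 0)"
proof -
  note cyl = acts_cylinder[OF g A]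
  have *: "M (\<lambda>c. A (\<pi> -` c)) \<phi> = M (\<lambda>c. A (\<pi> -` c) \<and> good F \<tau> c) \<phi>"
    using event_proj_conj[OF cyl cylinder_good, of F \<tau> \<phi>] \<phi>(2) by simp
  {
    assume "\<And>c. good F \<tau> c \<Longrightarrow> A (\<pi> -` c)"
    then have "(\<lambda>c. A (\<pi> -` c) \<and> good F \<tau> c) = good F \<tau>" by auto
    then show "M A (L (inv g) \<phi>) = L (inv g) \<phi>"
      using * \<phi> by (simp add: acts_event_proj_inv[OF g A])
  next
    assume "\<And>c. good F \<tau> c \<Longrightarrow> \<not> A (\<pi> -` c)"
    then have "(\<lambda>c. A (\<pi> -` c) \<and> good F \<tau> c) = (\<lambda>c. False)" by auto
    then show "M A (L (inv g) \<phi>) = (\<lambda>x. 0)"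
      using * \<phi> by (simp add: acts_event_proj_inv[OF g A] event_proj_False left_regular_zero)
  }
qed

text \<open>For every edge of the component, the two sums over positions that have to agree contain the same
  terms: along an arm, the vertices below an edge, counted at their upper ends, are the vertices that
  have an upper neighbour; and the edge \<open>t\<close> has exactly one such term on each side.\<close>

lemma spread_harmonic:
  assumes \<phi>: "\<phi> \<in> ell2 G" "M (good F \<tau>) \<phi> = \<phi>"
  shows "spread \<tau> \<phi> \<in> harmonic"
proof -
  let ?P = "positions \<tau>"
  note fin = finite_positions[of \<tau>]
  let ?at = "\<lambda>p. L (inv (vertex p)) \<phi>"
  have spread_M: "M A (L h (spread \<tau> \<phi>)) = (\<lambda>x. \<Sum>p\<in>?P. M A (L h (?at p)) x)" if "cylinder A" for A h
    unfolding spread_def left_regular_sum by (rule group_algebra_op_distrib_sum[OF M_op[OF that]])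
  have spread_M1: "M A (spread \<tau> \<phi>) = (\<lambda>x. \<Sum>p\<in>?P. M A (?at p) x)" if "cylinder A" for A
    unfolding spread_def by (rule group_algebra_op_distrib_sum[OF M_op[OF that]])
  have pos: "arm_ends (arm_length \<tau> \<beta>) (arm_map F \<beta> -` c)" if "good F \<tau> c" for \<beta> c
    by (rule good_arm(1)[OF that])
  have up1: "M up_edge (?at (\<beta>, j)) = (if j < arm_length \<tau> \<beta> then ?at (\<beta>, j) else (\<lambda>x. 0))"
    if "j \<le> arm_length \<tau> \<beta>" for \<beta> j
  proof (cases "j < arm_length \<tau> \<beta>")
    case True
    have "M up_edge (?at (\<beta>, j)) = ?at (\<beta>, j)"
    proof (rule M_good_seen(1)[OF \<phi> acts_vertex cylinder_up_edge])
      fix c assume "good F \<tau> c"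
      from arm_ends_not_fresh[OF pos[OF this], of "j + 1" \<beta>] True
      show "up_edge ((\<lambda>x. arm_map F \<beta> (shift (int j) x)) -` c)"
        by (simp add: up_edge_def vimage_vertex vimage_shift_add add.commute)
    qed
    then show ?thesis using True by simp
  next
    case False
    have "M up_edge (?at (\<beta>, j)) = (\<lambda>x. 0)"
    proof (rule M_good_seen(2)[OF \<phi> acts_vertex cylinder_up_edge])
      fix c assume "good F \<tau> c"
      from pos[OF this, of \<beta>] False that
      show "\<not> up_edge ((\<lambda>x. arm_map F \<beta> (shift (int j) x)) -` c)"
        by (simp add: up_edge_def vimage_vertex vimage_shift_add arm_ends_def fresh_iff)
    qed
    then show ?thesis using False by simp
  qed
  have up2: "M up_edge (L r (?at (\<beta>, j))) = (if j = 0 then (\<lambda>x. 0) else ?at (\<beta>, j - 1))"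
    if "j \<le> arm_length \<tau> \<beta>" for \<beta> j
  proof (cases j)
    case 0
    \<comment> \<open>Below the bottom of an arm there is no edge of the component: the bottom is not stale.\<close>
    have rinv: "L r (?at (\<beta>, 0)) = L (inv (vertex (\<beta>, 0) \<otimes> inv r)) \<phi>"
      by (simp add: left_regular_mult r_closed vertex_closed inv_mult_group)
    have act: "acts (vertex (\<beta>, 0) \<otimes> inv r) (\<lambda>x. arm_map F \<beta> (shift 0 (shift (- 1) x)))"
      using acts_mult[OF acts_vertex[of \<beta> 0] acts_inv_r_pow[of 1]] by (simp add: r_closed)
    have "M up_edge (L r (?at (\<beta>, 0))) = (\<lambda>x. 0)"
      unfolding rinv
    proof (rule M_good_seen(2)[OF \<phi> act cylinder_up_edge])
      fix c assume "good F \<tau> c"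
      have "(\<lambda>x. arm_map F \<beta> (shift 0 (shift (- 1) x))) -` c = shift (- 1) -` (arm_map F \<beta> -` c)"
        by (auto simp: shift_0)
      then show "\<not> up_edge ((\<lambda>x. arm_map F \<beta> (shift 0 (shift (- 1) x))) -` c)"
        using good_arm(2)[OF \<open>good F \<tau> c\<close>, of \<beta>] by (simp add: up_edge_def vimage_shift_add vimage_shift_0)
    qed
    then show ?thesis by (simp add: 0)
  next
    case (Suc i)
    have "L r (?at (\<beta>, Suc i)) = ?at (\<beta>, i)"
      by (simp add: left_regular_mult r_closed vertex_closed vertex_Suc inv_mult_group m_assoc[symmetric])
    then show ?thesis using up1[of i \<beta>] that by (simp add: Suc)
  qed
  have "M up_edge (spread \<tau> \<phi>) = M up_edge (L r (spread \<tau> \<phi>))"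
  proof
    fix x
    have "M up_edge (spread \<tau> \<phi>) x = (\<Sum>\<beta>\<in>UNIV. \<Sum>j\<le>arm_length \<tau> \<beta>. if j < arm_length \<tau> \<beta> then ?at (\<beta>, j) x else 0)"
      unfolding spread_M1[OF cylinder_up_edge] sum_positions
      by (intro sum.cong refl) (simp add: up1)
    also have "\<dots> = (\<Sum>\<beta>\<in>UNIV. \<Sum>j\<le>arm_length \<tau> \<beta>. if j = 0 then 0 else ?at (\<beta>, j - 1) x)"
    proof (rule sum.cong[OF refl])
      fix \<beta> :: bool
      have "(\<Sum>j\<le>n. if j < n then f j else 0) = (\<Sum>j\<le>n. if j = 0 then 0 else f (j - 1))"
        for n and f :: "nat \<Rightarrow> complex"
      proof -
        have "(\<Sum>j\<le>n. if j < n then f j else 0) = (\<Sum>j<n. f j)"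
          by (rule sum.mono_neutral_cong_right) auto
        also have "\<dots> = (\<Sum>j\<le>n. if j = 0 then 0 else f (j - 1))"
          by (simp add: sum.atMost_shift)
        finally show ?thesis .
      qed
      then show "(\<Sum>j\<le>arm_length \<tau> \<beta>. if j < arm_length \<tau> \<beta> then ?at (\<beta>, j) x else 0) =
        (\<Sum>j\<le>arm_length \<tau> \<beta>. if j = 0 then 0 else ?at (\<beta>, j - 1) x)" .
    qed
    also have "\<dots> = M up_edge (L r (spread \<tau> \<phi>)) x"
      unfolding spread_M[OF cylinder_up_edge] sum_positions
      by (intro sum.cong refl) (simp add: up2)
    finally show "M up_edge (spread \<tau> \<phi>) x = M up_edge (L r (spread \<tau> \<phi>)) x" .
  qed
  then have up: "M up_edge (\<lambda>x. spread \<tau> \<phi> x - L r (spread \<tau> \<phi>) x) = (\<lambda>x. 0)"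
    by (simp add: group_algebra_op_distrib_diff[OF M_op[OF cylinder_up_edge]])
  have nf: "\<not> fresh (shift (int j) -` (arm_map F \<beta> -` c))"
    if "good F \<tau> c" "j \<le> arm_length \<tau> \<beta>" "j \<noteq> 0" for c \<beta> j
    using arm_ends_not_fresh[OF pos[OF that(1)], of j \<beta>] that by simp
  have cross1: "M (cross_edge F) (?at (\<beta>, j)) = (if \<not> \<beta> \<and> j = 0 then \<phi> else (\<lambda>x. 0))"
    if "j \<le> arm_length \<tau> \<beta>" for \<beta> j
  proof (cases "\<not> \<beta> \<and> j = 0")
    case True
    have "M (cross_edge F) (?at (\<beta>, j)) = ?at (\<beta>, j)"
      by (rule M_good_seen(1)[OF \<phi> acts_vertex cylinder_cross_edge])
        (use True in \<open>auto simp: vimage_vertex vimage_shift_0 cross_edge_def good_arm\<close>)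
    also have "?at (\<beta>, j) = \<phi>" using True ell2_outside[OF \<phi>(1)] by (simp add: vertex_def left_regular_one)
    finally show ?thesis using True by simp
  next
    case False
    have "M (cross_edge F) (?at (\<beta>, j)) = (\<lambda>x. 0)"
    proof (rule M_good_seen(2)[OF \<phi> acts_vertex cylinder_cross_edge])
      fix c assume c: "good F \<tau> c"
      show "\<not> cross_edge F ((\<lambda>x. arm_map F \<beta> (shift (int j) x)) -` c)"
        using nf[OF c that] good_arm[OF c, of \<beta>] False
        by (cases "j = 0") (auto simp: vimage_vertex vimage_shift_0 cross_edge_def fresh_iff)
    qed
    then show ?thesis using False by auto
  qed
  have cross2: "M (cross_edge F) (L t (?at (\<beta>, j))) = (if \<beta> \<and> j = 0 then \<phi> else (\<lambda>x. 0))"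
    if "j \<le> arm_length \<tau> \<beta>" for \<beta> j
  proof -
    have tinv: "L t (?at (\<beta>, j)) = L (inv (vertex (\<beta>, j) \<otimes> inv t)) \<phi>"
      by (simp add: left_regular_mult t_closed vertex_closed inv_mult_group)
    have act: "acts (vertex (\<beta>, j) \<otimes> inv t) (\<lambda>x. arm_map F \<beta> (shift (int j) (flip F x)))"
      by (rule acts_mult[OF acts_vertex acts_inv_t])
    have view: "(\<lambda>x. arm_map F \<beta> (shift (int j) (flip F x))) -` c = flip F -` (shift (int j) -` (arm_map F \<beta> -` c))" for c
      by auto
    show ?thesis
    proof (cases "\<beta> \<and> j = 0")
      case True
      have "M (cross_edge F) (L t (?at (\<beta>, j))) = L t (?at (\<beta>, j))"
        unfolding tinv
      proof (rule M_good_seen(1)[OF \<phi> act cylinder_cross_edge])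
        fix c assume c: "good F \<tau> c"
        show "cross_edge F ((\<lambda>x. arm_map F \<beta> (shift (int j) (flip F x))) -` c)"
          unfolding view using True good_arm[OF c, of True]
          by (simp add: vimage_shift_0 cross_edge_def vimage_flip_flip)
      qed
      also have "\<dots> = \<phi>"
        using True ell2_outside[OF \<phi>(1)] by (simp add: vertex_def left_regular_one left_regular_mult t_closed)
      finally show ?thesis using True by simp
    next
      case False
      have "M (cross_edge F) (L t (?at (\<beta>, j))) = (\<lambda>x. 0)"
        unfolding tinv
      proof (rule M_good_seen(2)[OF \<phi> act cylinder_cross_edge])
        fix c assume c: "good F \<tau> c"
        show "\<not> cross_edge F ((\<lambda>x. arm_map F \<beta> (shift (int j) (flip F x))) -` c)"
          unfolding view using nf[OF c that] good_arm[OF c, of \<beta>] False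
          by (cases "j = 0") (auto simp: vimage_shift_0 cross_edge_def fresh_iff vimage_flip_flip)
      qed
      then show ?thesis using False by auto
    qed
  qed
  have "M (cross_edge F) (spread \<tau> \<phi>) = M (cross_edge F) (L t (spread \<tau> \<phi>))"
  proof
    fix x
    have "M (cross_edge F) (spread \<tau> \<phi>) x = (\<Sum>p\<in>?P. if p = (False, 0) then \<phi> x else 0)"
      unfolding spread_M1[OF cylinder_cross_edge]
      by (rule sum.cong) (auto simp: positions_iff cross1 split: if_splits)
    also have "\<dots> = (\<Sum>p\<in>?P. if p = (True, 0) then \<phi> x else 0)"
      by (simp add: fin positions_iff)
    also have "\<dots> = M (cross_edge F) (L t (spread \<tau> \<phi>)) x"
      unfolding spread_M[OF cylinder_cross_edge]
      by (rule sum.cong) (auto simp: positions_iff cross2 split: if_splits)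
    finally show "M (cross_edge F) (spread \<tau> \<phi>) x = M (cross_edge F) (L t (spread \<tau> \<phi>)) x" .
  qed
  then have cross: "M (cross_edge F) (\<lambda>x. spread \<tau> \<phi> x - L t (spread \<tau> \<phi>) x) = (\<lambda>x. 0)"
    by (simp add: group_algebra_op_distrib_diff[OF M_op[OF cylinder_cross_edge]])
  have "M (killed F) (?at (\<beta>, j)) = (\<lambda>x. 0)" if j: "j \<le> arm_length \<tau> \<beta>" for \<beta> j
  proof (rule M_good_seen(2)[OF \<phi> acts_vertex cylinder_killed])
    fix c assume c: "good F \<tau> c"
    let ?v = "arm_map F \<beta> -` c"
    have "\<not> head_Y (shift (int j + 1) -` ?v)"
    proof (cases "j < arm_length \<tau> \<beta>")
      case True
      then show ?thesis using nf[OF c, of "j + 1" \<beta>] by (simp add: fresh_iff add.commute)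
    next
      case False
      then show ?thesis using pos[OF c, of \<beta>] j by (simp add: arm_ends_def not_X_and_Y)
    qed
    then show "\<not> killed F ((\<lambda>x. arm_map F \<beta> (shift (int j) x)) -` c)"
      using nf[OF c j] good_arm[OF c, of \<beta>]
      by (cases "j = 0") (auto simp: vimage_vertex killed_def vimage_shift_add vimage_shift_0 fresh_iff)
  qed
  then have killed: "M (killed F) (spread \<tau> \<phi>) = (\<lambda>x. 0)"
    unfolding spread_M1[OF cylinder_killed] by (auto simp: fun_eq_iff positions_iff intro!: sum.neutral)
  show ?thesis
    unfolding harmonic_def using up cross killed spread_ell2[OF \<phi>(1)] by simp
qed

end

section \<open>The dimension of the space of harmonic vectors\<close>

lemma first_hit:
  assumes "\<exists>k<n. P k"
  obtains k :: nat where "k < n" "P k" "\<And>i. i < k \<Longrightarrow> \<not> P i"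
proof -
  obtain k0 where "k0 < n" "P k0" using assms by blast
  then show ?thesis
    using that[of "LEAST k. P k"] by (metis LeastI Least_le not_less_Least le_less_trans)
qed

text \<open>Looking at distance at most \<open>n\<close>, one finds the base below the present vertex, the end of its arm, and
  the end of the partner arm. The partner arm is required to end for all candidates of the base, so
  that the failure of regularity is a union of simple events.\<close>

definition regular :: "int set \<Rightarrow> nat \<Rightarrow> (int \<times> bool) set \<Rightarrow> bool" where
  "regular F n c \<longleftrightarrow> (\<exists>k\<in>{..<n}. fresh (shift (- int k) -` c)) \<and>
     (\<exists>m\<in>{..<n}. fresh (shift (int m + 1) -` c)) \<and>
     (\<forall>k\<in>{..<n}. \<exists>q\<in>{..<n}. fresh (shift (int q + 1) -` (flip F -` (shift (- int k) -` c))))"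

text \<open>The pieces into which the regular configurations are cut: the base is \<open>k\<close> steps below, the own arm has
  \<open>m\<close> further vertices, and the partner arm has length \<open>q\<close>.\<close>

definition atom :: "int set \<Rightarrow> nat \<Rightarrow> nat \<Rightarrow> nat \<Rightarrow> (int \<times> bool) set \<Rightarrow> bool" where
  "atom F k m q c \<longleftrightarrow>
     (\<forall>i\<in>{..<k}. \<not> fresh (shift (- int i) -` c)) \<and>
     (\<forall>i\<in>{..<m}. \<not> fresh (shift (int i + 1) -` c)) \<and>
     (\<forall>i\<in>{..<q}. \<not> fresh (shift (int i + 1) -` (flip F -` (shift (- int k) -` c)))) \<and>
     fresh (shift (- int k) -` c) \<and> fresh (shift (int m + 1) -` c) \<and>
     fresh (shift (int q + 1) -` (flip F -` (shift (- int k) -` c)))"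

lemma regular_atom:
  assumes "regular F n c"
  obtains k m q where "k < n" "m < n" "q < n" "atom F k m q c"
proof -
  obtain k where k: "k < n" "fresh (shift (- int k) -` c)" "\<And>i. i < k \<Longrightarrow> \<not> fresh (shift (- int i) -` c)"
    using assms first_hit[of n "\<lambda>k. fresh (shift (- int k) -` c)"] by (auto simp: regular_def)
  obtain m where m: "m < n" "fresh (shift (int m + 1) -` c)" "\<And>i. i < m \<Longrightarrow> \<not> fresh (shift (int i + 1) -` c)"
    using assms first_hit[of n "\<lambda>m. fresh (shift (int m + 1) -` c)"] by (auto simp: regular_def)
  let ?w = "flip F -` (shift (- int k) -` c)"
  have "\<exists>q<n. fresh (shift (int q + 1) -` ?w)" using assms k(1) by (auto simp: regular_def)
  from first_hit[OF this] obtain q where q: "q < n" "fresh (shift (int q + 1) -` ?w)" "\<And>i. i < q \<Longrightarrow> \<not> fresh (shift (int i + 1) -` ?w)"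
    by blast
  show ?thesis using that[OF k(1) m(1) q(1)] k m q by (auto simp: atom_def)
qed

text \<open>The present vertex lies at position \<open>snd i\<close> of a component of type \<open>fst i\<close>.\<close>

definition seen_good :: "int set \<Rightarrow> (nat \<times> nat) \<times> (bool \<times> nat) \<Rightarrow> (int \<times> bool) set \<Rightarrow> bool" where
  "seen_good F i c \<longleftrightarrow> good F (fst i) (arm_map F (fst (snd i)) -` (shift (- int (snd (snd i))) -` c))"

definition cases_upto :: "nat \<Rightarrow> ((nat \<times> nat) \<times> (bool \<times> nat)) set" where
  "cases_upto n = (SIGMA \<tau>:{..<2 * n} \<times> {..<2 * n}. positions \<tau>)"

lemma finite_cases_upto: "finite (cases_upto n)"
  by (auto simp: cases_upto_def finite_positions)

text \<open>The four ways in which a component meets a killed vertex, numbered so that a finite union covers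
  them: a base without partner, a bad end of the own arm, and a bad end of the partner arm as seen from
  the arm of the \<open>X\<close> or from that of the \<open>Y\<close>.\<close>

definition dead :: "int set \<Rightarrow> nat \<Rightarrow> nat \<Rightarrow> nat \<Rightarrow> nat \<Rightarrow> (int \<times> bool) set \<Rightarrow> bool" where
  "dead F i k m q c \<longleftrightarrow> atom F k m q c \<and>
    (let v = shift (- int k) -` c; w = flip F -` v in
      (i = 0 \<and> ((head_X v \<and> \<not> head_Y w) \<or> (head_Y v \<and> \<not> head_X w))) \<or>
      (i = 1 \<and> head_Y (shift (int m + 1) -` c)) \<or>
      (i = 2 \<and> head_X v \<and> head_Y w \<and> head_Y (shift (int q + 1) -` w)) \<or>
      (i > 2 \<and> head_Y v \<and> head_X w \<and> head_Y (shift (int q + 1) -` w)))"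

lemma atom_dead_or_good:
  assumes A: "atom F k m q c" and "k < n" "m < n" "q < n"
  shows "(\<exists>i\<in>{..<4}. dead F i k m q c) \<or> (\<exists>i\<in>cases_upto n. seen_good F i c)"
proof (rule disjCI)
  assume alive: "\<not> (\<exists>i\<in>cases_upto n. seen_good F i c)"
  let ?v = "shift (- int k) -` c" and ?w = "flip F -` (shift (- int k) -` c)"
  \<comment> \<open>The view from the base combines what is seen below and above the present vertex.\<close>
  have own: "arm_ends (k + m) ?v" if "head_X (shift (int m + 1) -` c)"
  proof -
    have "\<not> fresh (shift (int j) -` ?v)" if "1 \<le> j" "j \<le> k + m" for j
    proof (cases "j \<le> k")
      case True
      have "k - j \<in> {..<k}" using True that by simp
      then have "\<not> fresh (shift (- int (k - j)) -` c)" using A unfolding atom_def by blast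
      then show ?thesis using True by (simp add: vimage_shift_add of_nat_diff)
    next
      case False
      have "j - k - 1 \<in> {..<m}" using False that by auto
      then have "\<not> fresh (shift (int (j - k - 1) + 1) -` c)" using A unfolding atom_def by blast
      then show ?thesis using False by (simp add: vimage_shift_add of_nat_diff)
    qed
    then show ?thesis using that by (simp add: arm_ends_def vimage_shift_add algebra_simps)
  qed
  have other: "arm_ends q ?w" if "head_X (shift (int q + 1) -` ?w)"
  proof -
    have "\<not> fresh (shift (int j) -` ?w)" if "1 \<le> j" "j \<le> q" for j
    proof -
      have "j - 1 \<in> {..<q}" using that by auto
      then have "\<not> fresh (shift (int (j - 1) + 1) -` ?w)" using A unfolding atom_def by blast
      then show ?thesis using that by (simp add: of_nat_diff)
    qed
    then show ?thesis using that by (simp add: arm_ends_def)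
  qed
  have "dead F 0 k m q c \<or> dead F 1 k m q c \<or> dead F 2 k m q c \<or> dead F 3 k m q c"
  proof (rule ccontr)
    assume no: "\<not> ?thesis"
    have X: "head_X (shift (int m + 1) -` c)" "head_X (shift (int q + 1) -` ?w)"
      using no A by (auto simp: dead_def Let_def atom_def fresh_iff)
    have base: "head_X ?v \<and> head_Y ?w \<or> head_Y ?v \<and> head_X ?w"
      using no A by (auto simp: dead_def Let_def atom_def fresh_iff)
    then have "(\<exists>\<beta>. seen_good F ((if \<beta> then (q, k + m) else (k + m, q)), (\<beta>, k)) c)"
      using own[OF X(1)] other[OF X(2)]
      by (intro exI[of _ "head_Y ?v"])
        (auto simp: seen_good_def good_def arm_map_def vimage_flip_flip not_X_and_Y)
    then show False using alive assms(2-4)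
      by (auto simp: cases_upto_def positions_iff arm_length_def split: if_splits)
  qed
  moreover have "(0::nat) \<in> {..<4}" "(1::nat) \<in> {..<4}" "(2::nat) \<in> {..<4}" "(3::nat) \<in> {..<4}" by simp_all
  ultimately show "\<exists>i\<in>{..<4}. dead F i k m q c" by blast
qed

lemma cylinder_arm_view:
  "cylinder A \<Longrightarrow> cylinder (\<lambda>c. A (arm_map F \<beta> -` (shift k -` c)))"
proof -
  assume "cylinder A"
  moreover have "inj (\<lambda>x. shift k (arm_map F \<beta> x))"
  proof (rule inj_on_inverseI[where g = "\<lambda>x. arm_map F \<beta> (shift (- k) x)"])
    show "arm_map F \<beta> (shift (- k) (shift k (arm_map F \<beta> x))) = x" for x
      by (cases \<beta>) (simp_all add: shift_add shift_0 arm_map_def flip_flip)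
  qed
  ultimately have "cylinder (\<lambda>c. A ((\<lambda>x. shift k (arm_map F \<beta> x)) -` c))" by (rule cylinder_vimage[rotated])
  then show ?thesis by (simp add: vimage_def)
qed

lemma cylinder_seen_good: "cylinder (seen_good F i)"
  unfolding seen_good_def[abs_def] by (rule cylinder_arm_view[OF cylinder_good])

lemma cylinder_regular: "cylinder (regular F n)"
  by (unfold regular_def[abs_def] event_defs, intro cylinder_intros) simp_all

lemma cylinder_dead: "cylinder (dead F i k m q)"
  by (unfold dead_def[abs_def] Let_def atom_def event_defs, intro cylinder_intros cylinder_const) simp_all

lemma probability_all_stale:
  fixes f :: "nat \<Rightarrow> int"
  assumes "\<And>i. i < n \<Longrightarrow> \<rho> i = (2 * (f i), b i)" "inj_on f {..<n}"
  shows "probability (\<lambda>c. \<forall>i\<in>{..<n}. \<rho> i \<notin> c) = (1 / 2) ^ n"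
proof -
  have inj: "inj_on \<rho> {..<n}"
  proof (rule inj_onI)
    fix i j assume ij: "i \<in> {..<n}" "j \<in> {..<n}" "\<rho> i = \<rho> j"
    then have "f i = f j" using assms(1)[of i] assms(1)[of j] by simp
    then show "i = j" using assms(2) ij by (simp add: inj_on_eq_iff)
  qed
  have "(\<lambda>c. \<forall>i\<in>{..<n}. \<rho> i \<notin> c) = (\<lambda>c. {} \<subseteq> c \<and> \<rho> ` {..<n} \<inter> c = {})" by auto
  then show ?thesis
    using probability_pattern[of "{}" "\<rho> ` {..<n}"] by (simp add: card_image[OF inj])
qed

text \<open>Each of the \<open>n + 2\<close> failures means that \<open>n\<close> different lamps are off.\<close>

lemma probability_not_regular:
  "probability (\<lambda>c. \<not> regular F n c) \<le> (real n + 2) / 2 ^ n"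
proof -
  define A1 where "A1 = (\<lambda>c. \<forall>k\<in>{..<n}. \<not> fresh (shift (- int k) -` c))"
  define A2 where "A2 = (\<lambda>c. \<forall>m\<in>{..<n}. \<not> fresh (shift (int m + 1) -` c))"
  define A3 where "A3 = (\<lambda>k c. \<forall>q\<in>{..<n}. \<not> fresh (shift (int q + 1) -` (flip F -` (shift (- int k) -` c))))"
  have cyl: "cylinder A1" "cylinder A2" "cylinder (A3 k)" for k
    unfolding A1_def A2_def A3_def fresh_def vimage_eq by (auto intro!: cylinder_intros)
  have P1: "probability A1 = (1 / 2) ^ n"
    unfolding A1_def fresh_def vimage_eq
    by (rule probability_all_stale[where f = "\<lambda>i. - int i" and b = "\<lambda>i. False"])
      (auto simp: shift_def inj_on_def)
  have P2: "probability A2 = (1 / 2) ^ n"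
    unfolding A2_def fresh_def vimage_eq
    by (rule probability_all_stale[where f = "\<lambda>i. int i + 1" and b = "\<lambda>i. False"])
      (auto simp: shift_def inj_on_def)
  have P3: "probability (A3 k) = (1 / 2) ^ n" for k
    unfolding A3_def fresh_def vimage_eq
    by (rule probability_all_stale[where f = "\<lambda>i. int i + 1 - int k" and b = "\<lambda>i. 2 * (int i + 1) \<in> F"])
      (auto simp: shift_def flip_def inj_on_def algebra_simps)
  have eq: "(\<lambda>c. \<not> regular F n c) = (\<lambda>c. A1 c \<or> A2 c \<or> (\<exists>k\<in>{..<n}. A3 k c))"
    by (auto simp: regular_def A1_def A2_def A3_def fun_eq_iff)
  have "probability (\<lambda>c. \<not> regular F n c) \<le> probability A1 + probability (\<lambda>c. A2 c \<or> (\<exists>k\<in>{..<n}. A3 k c))"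
    unfolding eq by (intro probability_disj_le cylinder_disj cylinder_bex cyl) simp_all
  also have "\<dots> \<le> probability A1 + (probability A2 + probability (\<lambda>c. \<exists>k\<in>{..<n}. A3 k c))"
    by (intro add_left_mono probability_disj_le cylinder_bex cyl) simp_all
  also have "\<dots> \<le> probability A1 + (probability A2 + (\<Sum>k\<in>{..<n}. probability (A3 k)))"
    by (intro add_left_mono probability_bex_le cyl) simp_all
  also have "\<dots> = (real n + 2) / 2 ^ n"
    by (simp add: P1 P2 P3 power_one_over field_simps)
  finally show ?thesis .
qed

context two_arms
begin

text \<open>The value at the present vertex is transported along edges to the killed vertex, where it vanishes.
  From the \<open>Y\<close>-side, the edge \<open>t\<close> is traversed backwards.\<close>

lemma harmonic_dead:
  assumes \<zeta>: "\<zeta> \<in> harmonic"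
  shows "M (dead F i k m q) \<zeta> = (\<lambda>x. 0)"
proof -
  let ?A = "dead F i k m q"
  note A = cylinder_dead[of F i k m q]
  let ?b = "inv (r [^] k)"
  have L1: "L \<one> \<zeta> = \<zeta>" using ell2_outside[OF harmonic_ell2[OF \<zeta>]] by (rule left_regular_one)
  have closed: "r [^] j \<in> carrier G" for j :: nat by (simp add: r_closed)
  have down: "M ?A (L ?b \<zeta>) = M ?A \<zeta>"
  proof -
    have "M ?A (L ?b \<zeta>) = M ?A (L (?b \<otimes> r [^] k) \<zeta>)"
    proof (rule harmonic_up_pow[OF \<zeta> acts_inv_r_pow A])
      fix c j assume "?A c" "j < k"
      moreover from \<open>j < k\<close> have "k - j - 1 \<in> {..<k}" by simp
      ultimately have "\<not> fresh (shift (- int (k - j - 1)) -` c)" unfolding dead_def atom_def by blast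
      then show "\<not> fresh (shift (int j + 1) -` (shift (- int k) -` c))"
        using \<open>j < k\<close> by (simp add: vimage_shift_add of_nat_diff algebra_simps)
    qed
    then show ?thesis using closed by (simp add: L1)
  qed
  have kill_base: "M ?A \<zeta> = (\<lambda>x. 0)" if "i = 0"
    unfolding down[symmetric]
    by (rule harmonic_killed[OF \<zeta> acts_inv_r_pow A]) (use that in \<open>auto simp: dead_def Let_def killed_def\<close>)
  have kill_up: "M ?A \<zeta> = (\<lambda>x. 0)" if "i = 1"
  proof -
    have "M ?A (L \<one> \<zeta>) = M ?A (L (\<one> \<otimes> r [^] m) \<zeta>)"
      by (rule harmonic_up_pow[OF \<zeta> acts_one A]) (auto simp: dead_def atom_def)
    also have "\<dots> = M ?A (L (r [^] m) \<zeta>)" using closed by simp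
    also have "\<dots> = (\<lambda>x. 0)"
      by (rule harmonic_killed[OF \<zeta> acts_r_pow A])
        (use that in \<open>auto simp: dead_def Let_def killed_def vimage_shift_add add.commute\<close>)
    finally show ?thesis by (simp add: L1)
  qed
  have other: "M ?A (L g \<zeta>) = (\<lambda>x. 0)" if g: "acts g \<pi>" "2 \<le> i"
    and \<pi>: "\<And>c. \<pi> -` c = flip F -` (shift (- int k) -` c)" for g \<pi>
  proof -
    have "M ?A (L g \<zeta>) = M ?A (L (g \<otimes> r [^] q) \<zeta>)"
      by (rule harmonic_up_pow[OF \<zeta> g(1) A]) (auto simp: \<pi> dead_def atom_def)
    also have "\<dots> = (\<lambda>x. 0)"
    proof (rule harmonic_killed[OF \<zeta> acts_mult[OF g(1) acts_r_pow] A])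
      fix c assume c: "?A c"
      have view: "(\<lambda>x. \<pi> (shift (int q) x)) -` c = shift (int q) -` (flip F -` (shift (- int k) -` c))"
        unfolding \<pi>[symmetric] by auto
      show "killed F ((\<lambda>x. \<pi> (shift (int q) x)) -` c)"
        unfolding view using c g(2)
        by (auto simp: dead_def Let_def killed_def vimage_shift_add[of 1 "int q"] add.commute)
    qed
    finally show ?thesis .
  qed
  have kill_X: "M ?A \<zeta> = (\<lambda>x. 0)" if "i = 2"
  proof -
    have "M ?A (L ?b \<zeta>) = M ?A (L (?b \<otimes> t) \<zeta>)"
      by (rule harmonic_cross[OF \<zeta> acts_inv_r_pow A]) (use that in \<open>auto simp: dead_def Let_def cross_edge_def\<close>)
    also have "\<dots> = (\<lambda>x. 0)"
      by (rule other[OF acts_mult[OF acts_inv_r_pow acts_t]]) (use that in auto)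
    finally show ?thesis by (simp add: down)
  qed
  have kill_Y: "M ?A \<zeta> = (\<lambda>x. 0)" if "i \<noteq> 0" "i \<noteq> 1" "i \<noteq> 2"
  proof -
    have act: "acts (?b \<otimes> inv t) (\<lambda>x. shift (- int k) (flip F x))"
      by (rule acts_mult[OF acts_inv_r_pow acts_inv_t])
    have view: "(\<lambda>x. shift (- int k) (flip F x)) -` c = flip F -` (shift (- int k) -` c)" for c by auto
    have "M ?A (L (?b \<otimes> inv t) \<zeta>) = M ?A (L (?b \<otimes> inv t \<otimes> t) \<zeta>)"
      by (rule harmonic_cross[OF \<zeta> act A])
        (use that in \<open>auto simp: view dead_def Let_def cross_edge_def vimage_flip_flip\<close>)
    moreover have "?b \<otimes> inv t \<otimes> t = ?b" using closed by (simp add: m_assoc t_closed)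
    moreover have "M ?A (L (?b \<otimes> inv t) \<zeta>) = (\<lambda>x. 0)"
      by (rule other[OF act _ view]) (use that in auto)
    ultimately show ?thesis by (simp add: down)
  qed
  show ?thesis using kill_base kill_up kill_X kill_Y by blast
qed

lemma component_proj_adjoint:
  assumes "\<xi> \<in> ell2 G" "\<zeta> \<in> ell2 G"
  shows "ell2_inner G (component_proj \<tau> \<xi>) \<zeta> = ell2_inner G \<xi> (component_proj \<tau> \<zeta>)"
proof -
  let ?P = "positions \<tau>" and ?E = "good F \<tau>"
  let ?T = "\<lambda>\<xi> x. \<Sum>q\<in>?P. L (vertex q) \<xi> x"
  have T2: "?T \<xi> \<in> ell2 G" if "\<xi> \<in> ell2 G" for \<xi>
    using that by (intro ell2_sum left_regular_ell2) (simp_all add: vertex_closed)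
  note E2 = M_ell2[OF cylinder_good[of F \<tau>]]
  have spread_T: "ell2_inner G (spread \<tau> \<phi>) \<zeta> = ell2_inner G \<phi> (?T \<zeta>)"
    if "\<phi> \<in> ell2 G" "\<zeta> \<in> ell2 G" for \<phi> \<zeta>
    unfolding spread_def using that
    by (simp add: ell2_inner_sum_left ell2_inner_sum_right left_regular_ell2 vertex_closed left_regular_adjoint)
  have T_spread: "ell2_inner G (?T \<phi>) \<zeta> = ell2_inner G \<phi> (spread \<tau> \<zeta>)"
    if "\<phi> \<in> ell2 G" "\<zeta> \<in> ell2 G" for \<phi> \<zeta>
    using arg_cong[OF spread_T[OF that(2,1)], of cnj] by (simp add: ell2_inner_cnj)
  show ?thesis
    unfolding component_proj_def ell2_inner_scale_left ell2_inner_scale_right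
    using assms
    by (simp add: spread_T T_spread E2 T2 event_proj_adjoint[OF cylinder_good])
qed

lemma component_proj_harmonic:
  assumes "\<xi> \<in> ell2 G"
  shows "component_proj \<tau> \<xi> \<in> harmonic"
  unfolding component_proj_def
proof (intro harmonic_scale spread_harmonic)
  let ?\<psi> = "\<lambda>x. \<Sum>q\<in>positions \<tau>. L (vertex q) \<xi> x"
  have "?\<psi> \<in> ell2 G" using assms by (intro ell2_sum left_regular_ell2) (simp_all add: vertex_closed)
  then show "M (good F \<tau>) ?\<psi> \<in> ell2 G" by (rule M_ell2[OF cylinder_good])
  show "M (good F \<tau>) (M (good F \<tau>) ?\<psi>) = M (good F \<tau>) ?\<psi>"
    by (rule event_proj_absorb[OF cylinder_good cylinder_good])
qed

text \<open>A harmonic vector is already constant on components, so that averaging it only cuts out those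
  viewpoints at which the vertex lies in a component of type \<open>\<tau>\<close>.\<close>

lemma component_proj_of_harmonic:
  assumes \<zeta>: "\<zeta> \<in> harmonic"
  shows "component_proj \<tau> \<zeta> x = (\<Sum>p\<in>positions \<tau>. M (seen_good F (\<tau>, p)) \<zeta> x)"
proof -
  let ?E = "good F \<tau>"
  note \<zeta>2 = harmonic_ell2[OF \<zeta>]
  have "M ?E (\<lambda>x. \<Sum>q\<in>positions \<tau>. L (vertex q) \<zeta> x) = (\<lambda>x. \<Sum>q\<in>positions \<tau>. M ?E (L (vertex q) \<zeta>) x)"
    by (rule group_algebra_op_distrib_sum[OF M_op[OF cylinder_good]])
  also have "\<dots> = (\<lambda>x. of_nat (card (positions \<tau>)) * M ?E \<zeta> x)"
    by (simp add: harmonic_constant[OF \<zeta>])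
  finally have "component_proj \<tau> \<zeta> x = (\<Sum>p\<in>positions \<tau>. L (inv (vertex p)) (M ?E \<zeta>) x)"
    using card_positions_pos[of \<tau>]
    by (simp add: component_proj_def spread_def left_regular_scale sum_distrib_left[symmetric])
  also have "\<dots> = (\<Sum>p\<in>positions \<tau>. M (seen_good F (\<tau>, p)) \<zeta> x)"
  proof (rule sum.cong[OF refl])
    fix p assume p: "p \<in> positions \<tau>"
    obtain \<beta> j where p_eq: "p = (\<beta>, j)" by (cases p)
    have act: "acts (inv (vertex p)) (\<lambda>x. shift (- int j) (arm_map F \<beta> x))"
      unfolding p_eq
      by (rule acts_inv[OF acts_vertex]) (cases \<beta>, simp_all add: shift_add shift_0 arm_map_def flip_flip)+
    have "L (inv (vertex p)) (M ?E \<zeta>) = L (inv (vertex p)) (M ?E (L (vertex p) \<zeta>))"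
      by (simp add: harmonic_constant[OF \<zeta> p])
    also have "\<dots> = M (\<lambda>c. ?E ((\<lambda>x. shift (- int j) (arm_map F \<beta> x)) -` c)) (L (inv (vertex p)) (L (vertex p) \<zeta>))"
      by (rule acts_event_proj[OF act cylinder_good])
    also have "L (inv (vertex p)) (L (vertex p) \<zeta>) = \<zeta>"
      using ell2_outside[OF \<zeta>2] by (simp add: left_regular_mult vertex_closed left_regular_one)
    also have "(\<lambda>c. ?E ((\<lambda>x. shift (- int j) (arm_map F \<beta> x)) -` c)) = seen_good F (\<tau>, p)"
      by (simp add: seen_good_def[abs_def] p_eq vimage_def)
    finally show "L (inv (vertex p)) (M ?E \<zeta>) x = M (seen_good F (\<tau>, p)) \<zeta> x" by simp
  qed
  finally show ?thesis .
qed

text \<open>The diagonal entries contribute the probability of the good event once for every position, which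
  the normalising factor cancels; different positions do not interact, because their vertices differ
  modulo the lamps.\<close>

lemma component_proj_delta_one:
  "component_proj \<tau> (delta \<one>) \<one> = of_real (probability (good F \<tau>))"
proof -
  let ?P = "positions \<tau>" and ?E = "good F \<tau>"
  note fin = finite_positions[of \<tau>]
  have entry: "M ?E (L (vertex q) (delta \<one>)) (vertex p) = (if q = p then of_real (probability ?E) else 0)" for p q
  proof -
    have inj: "vertex q = vertex p \<longleftrightarrow> q = p"
      using vertex_separated[of "{}" q p] vertex_closed by (auto simp: U_empty)
    have "S = {}" if "finite S" "U S \<otimes> vertex q = vertex p" for S
    proof -
      have "p = q" using vertex_separated[OF that] .
      then have "U S = \<one>" using that vertex_closed[of q] U_closed[OF that(1)] by (simp add: r_cancel_one)
      then show ?thesis by (rule U_faithful[OF that(1)])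
    qed
    from event_proj_delta[OF cylinder_good vertex_closed vertex_closed this] inj show ?thesis
      by (simp add: left_regular_delta vertex_closed)
  qed
  have "spread \<tau> (M ?E (\<lambda>x. \<Sum>q\<in>?P. L (vertex q) (delta \<one>) x)) \<one> =
      (\<Sum>p\<in>?P. \<Sum>q\<in>?P. M ?E (L (vertex q) (delta \<one>)) (vertex p))"
    unfolding spread_def group_algebra_op_distrib_sum[OF M_op[OF cylinder_good]]
    by (simp add: left_regular_def vertex_closed)
  also have "\<dots> = (\<Sum>p\<in>?P. of_real (probability ?E))"
    by (intro sum.cong refl) (simp add: entry fin)
  finally show ?thesis using card_positions_pos[of \<tau>] by (simp add: component_proj_def)
qed

text \<open>The unit vector is approximated by the sum of its projections onto the components of bounded size.
  Against a harmonic vector, the error only sees the configurations in which the component is not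
  understood within distance \<open>n\<close>, since harmonic vectors vanish on the dead ones; and the probability of
  these tends to zero.\<close>

lemma vn_dim_harmonic:
  assumes "(\<lambda>n. \<Sum>\<tau>\<in>{..<2 * n} \<times> {..<2 * n}. probability (good F \<tau>)) \<longlonglongrightarrow> d"
  shows "vn_dim G harmonic = d"
proof (rule vn_dim_eq_limit)
  let ?e = "delta \<one>"
  \<comment> \<open>An own arm can be as long as \<open>(n - 1) + (n - 1)\<close>, if the base is found within distance \<open>n\<close> below and the
    end within distance \<open>n\<close> above.\<close>
  define \<eta> where "\<eta> n = (\<lambda>x. \<Sum>\<tau>\<in>{..<2 * n} \<times> {..<2 * n}. component_proj \<tau> ?e x)" for n :: nat
  have e2: "?e \<in> ell2 G" by (simp add: delta_ell2)
  show "\<one> \<in> carrier G" by simp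
  show "harmonic \<subseteq> ell2 G" by (auto simp: harmonic_def)
  show "(\<lambda>x. \<xi> x - \<zeta> x) \<in> harmonic" if "\<xi> \<in> harmonic" "\<zeta> \<in> harmonic" for \<xi> \<zeta>
    using that by (rule harmonic_diff)
  show \<eta>_harmonic: "\<eta> n \<in> harmonic" for n
    unfolding \<eta>_def by (intro harmonic_sum component_proj_harmonic e2)
  show "Y \<in> harmonic"
    if f: "\<And>n::nat. f n \<in> harmonic" and lim: "\<And>x. (\<lambda>n. f n x) \<longlonglongrightarrow> Y x" and Y: "Y \<in> ell2 G" for f Y
  proof -
    have limL: "(\<lambda>n. f n x - L h (f n) x) \<longlonglongrightarrow> Y x - L h Y x" for h x
      by (intro tendsto_diff lim) (auto simp: left_regular_def lim)
    have lim_diff: "(\<lambda>n. M B (\<lambda>x. f n x - L h (f n) x) x) \<longlonglongrightarrow> M B (\<lambda>x. Y x - L h Y x) x"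
      if "cylinder B" for B h x
      by (rule group_algebra_op_limit[OF M_op[OF that] limL])
    have lim_killed: "(\<lambda>n. M (killed F) (f n) x) \<longlonglongrightarrow> M (killed F) Y x" for x
      by (rule group_algebra_op_limit[OF M_op[OF cylinder_killed] lim])
    have "M up_edge (\<lambda>x. Y x - L r Y x) x = 0" for x
      using lim_diff[OF cylinder_up_edge, of r x] f by (simp add: harmonic_def LIMSEQ_const_iff)
    moreover have "M (cross_edge F) (\<lambda>x. Y x - L t Y x) x = 0" for x
      using lim_diff[OF cylinder_cross_edge, of F t x] f by (simp add: harmonic_def LIMSEQ_const_iff)
    moreover have "M (killed F) Y x = 0" for x
      using lim_killed[of x] f by (simp add: harmonic_def LIMSEQ_const_iff)
    ultimately show ?thesis using Y by (simp add: harmonic_def fun_eq_iff)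
  qed
  show "cmod (ell2_inner G (\<lambda>x. ?e x - \<eta> n x) \<zeta>) \<le> sqrt ((real n + 2) / 2 ^ n) * ell2_norm G \<zeta>"
    if \<zeta>: "\<zeta> \<in> harmonic" for n \<zeta>
  proof -
    note \<zeta>2 = harmonic_ell2[OF \<zeta>]
    let ?J = "cases_upto n"
    let ?Good = "\<lambda>c. \<exists>i\<in>?J. seen_good F i c"
    let ?Bad = "\<lambda>c. \<not> ?Good c \<and> regular F n c" and ?Rest = "\<lambda>c. \<not> ?Good c \<and> \<not> regular F n c"
    have Good: "cylinder ?Good" by (intro cylinder_bex finite_cases_upto cylinder_seen_good)
    have Bad: "cylinder ?Bad" and Rest: "cylinder ?Rest"
      by (intro cylinder_conj cylinder_not Good cylinder_regular)+
    have "ell2_inner G (\<eta> n) \<zeta> = (\<Sum>\<tau>\<in>{..<2 * n} \<times> {..<2 * n}. ell2_inner G ?e (component_proj \<tau> \<zeta>))"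
      unfolding \<eta>_def using component_proj_harmonic[THEN harmonic_ell2] e2 \<zeta>2
      by (simp add: ell2_inner_sum_left component_proj_adjoint)
    also have "\<dots> = ell2_inner G ?e (\<lambda>x. \<Sum>\<tau>\<in>{..<2 * n} \<times> {..<2 * n}. component_proj \<tau> \<zeta> x)"
      using component_proj_harmonic[THEN harmonic_ell2] e2 \<zeta>2 by (simp add: ell2_inner_sum_right)
    also have "(\<lambda>x. \<Sum>\<tau>\<in>{..<2 * n} \<times> {..<2 * n}. component_proj \<tau> \<zeta> x) = M ?Good \<zeta>"
    proof
      fix x
      have "M ?Good \<zeta> x = (\<Sum>i\<in>?J. M (seen_good F i) \<zeta> x)"
      proof (rule event_proj_sum[OF finite_cases_upto cylinder_seen_good])
        fix i j c assume "i \<in> ?J" "j \<in> ?J" "seen_good F i c" "seen_good F j c"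
        then show "i = j"
          using good_unique[of F "fst i" "fst (snd i)" "snd (snd i)" c "fst j" "fst (snd j)" "snd (snd j)"]
          by (auto simp: cases_upto_def positions_iff seen_good_def)
      qed
      also have "\<dots> = (\<Sum>\<tau>\<in>{..<2 * n} \<times> {..<2 * n}. \<Sum>p\<in>positions \<tau>. M (seen_good F (\<tau>, p)) \<zeta> x)"
        unfolding cases_upto_def by (subst sum.Sigma) (auto simp: finite_positions case_prod_beta')
      finally show "(\<Sum>\<tau>\<in>{..<2 * n} \<times> {..<2 * n}. component_proj \<tau> \<zeta> x) = M ?Good \<zeta> x"
        by (simp add: component_proj_of_harmonic[OF \<zeta>])
    qed
    finally have \<eta>_Good: "ell2_inner G (\<eta> n) \<zeta> = ell2_inner G ?e (M ?Good \<zeta>)" .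
    have null: "M ?Bad \<zeta> = (\<lambda>x. 0)"
    proof (rule event_proj_null_subset[OF Bad])
      let ?K = "{..<4::nat} \<times> {..<n} \<times> {..<n} \<times> {..<n}"
      let ?dead = "\<lambda>(i, k, m, q). dead F i k m q"
      show "cylinder (\<lambda>c. \<exists>j\<in>?K. ?dead j c)"
        by (rule cylinder_bex) (auto simp: cylinder_dead)
      show "M (\<lambda>c. \<exists>j\<in>?K. ?dead j c) \<zeta> = (\<lambda>x. 0)"
        by (rule event_proj_null_bex) (auto simp: cylinder_dead harmonic_dead[OF \<zeta>])
      fix c assume c: "?Bad c"
      then obtain k m q where "k < n" "m < n" "q < n" "atom F k m q c" using regular_atom by blast
      with atom_dead_or_good[OF this(4,1,2,3)] c obtain i where "i < 4" "dead F i k m q c" by blast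
      then show "\<exists>j\<in>?K. ?dead j c" using \<open>k < n\<close> \<open>m < n\<close> \<open>q < n\<close>
        by (intro bexI[of _ "(i, k, m, q)"]) auto
    qed
    have split: "\<zeta> = (\<lambda>x. M ?Good \<zeta> x + M ?Rest \<zeta> x)"
    proof
      fix x
      have T: "(\<lambda>c. True) = (\<lambda>c. ?Good c \<or> (?Bad c \<or> ?Rest c))" by auto
      have "\<zeta> x = M (\<lambda>c. True) \<zeta> x"
        using ell2_outside[OF \<zeta>2] by (simp add: event_proj_True left_regular_one)
      also have "\<dots> = M ?Good \<zeta> x + M (\<lambda>c. ?Bad c \<or> ?Rest c) \<zeta> x"
        unfolding T by (rule event_proj_disj[OF Good cylinder_disj[OF Bad Rest]]) blast
      also have "M (\<lambda>c. ?Bad c \<or> ?Rest c) \<zeta> x = M ?Bad \<zeta> x + M ?Rest \<zeta> x"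
        by (rule event_proj_disj[OF Bad Rest]) blast
      finally show "\<zeta> x = M ?Good \<zeta> x + M ?Rest \<zeta> x" using null by simp
    qed
    have "ell2_inner G ?e \<zeta> = ell2_inner G ?e (\<lambda>x. M ?Good \<zeta> x + M ?Rest \<zeta> x)"
      by (rule arg_cong[OF split])
    also have "\<dots> = ell2_inner G ?e (M ?Good \<zeta>) + ell2_inner G ?e (M ?Rest \<zeta>)"
      by (rule ell2_inner_add_right[OF M_ell2[OF Good \<zeta>2] M_ell2[OF Rest \<zeta>2] e2])
    finally have "ell2_inner G (\<lambda>x. ?e x - \<eta> n x) \<zeta> = ell2_inner G ?e (M ?Rest \<zeta>)"
      using ell2_inner_diff_left[OF e2 harmonic_ell2[OF \<eta>_harmonic] \<zeta>2, of n] \<eta>_Good by simp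
    also have "\<dots> = ell2_inner G (M ?Rest ?e) \<zeta>"
      by (rule event_proj_adjoint[OF Rest e2 \<zeta>2, symmetric])
    also have "cmod \<dots> \<le> ell2_norm G (M ?Rest ?e) * ell2_norm G \<zeta>"
      by (rule ell2_Cauchy_Schwarz[OF M_ell2[OF Rest e2] \<zeta>2])
    also have "\<dots> \<le> sqrt ((real n + 2) / 2 ^ n) * ell2_norm G \<zeta>"
    proof (rule mult_right_mono[OF _ ell2_norm_nonneg])
      have "probability ?Rest \<le> probability (\<lambda>c. \<not> regular F n c)"
        by (rule probability_mono[OF Rest cylinder_not[OF cylinder_regular]]) simp
      then show "ell2_norm G (M ?Rest ?e) \<le> sqrt ((real n + 2) / 2 ^ n)"
        unfolding event_proj_norm_delta_one[OF Rest]
        using probability_not_regular[of F n] by simp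
    qed
    finally show ?thesis .
  qed
  have "(\<lambda>n. (real n + 2) / 2 ^ n) \<longlonglongrightarrow> 0" by real_asymp
  from tendsto_real_sqrt[OF this] show "(\<lambda>n. sqrt ((real n + 2) / 2 ^ n)) \<longlonglongrightarrow> 0" by simp
  show "0 \<le> sqrt ((real n + 2) / 2 ^ n)" for n by simp
  have "Re (\<eta> n \<one>) = (\<Sum>\<tau>\<in>{..<2 * n} \<times> {..<2 * n}. probability (good F \<tau>))" for n
    by (simp add: \<eta>_def component_proj_delta_one)
  then show "(\<lambda>n. Re (\<eta> n \<one>)) \<longlonglongrightarrow> d" using assms by simp
qed

lemma event_proj_quadratic_form:
  assumes "cylinder A" "\<xi> \<in> ell2 G"
  shows "ell2_inner G (M A \<xi>) \<xi> = of_real ((ell2_norm G (M A \<xi>))\<^sup>2)"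
  using event_proj_adjoint[OF assms(1) M_ell2[OF assms] assms(2)] event_proj_absorb[OF assms(1,1), of \<xi>]
    ell2_inner_self[OF M_ell2[OF assms]] by simp

text \<open>The operator is the Laplacian of the graph plus the indicator of the killed vertices. It is a sum of
  three positive operators, and its quadratic form vanishes only if each of them does. Adding four
  times the identity turns its kernel into the eigenspace for the eigenvalue four.\<close>

lemma harmonic_is_kernel:
  "\<exists>q\<in>rational_group_ring G. ell2_kernel G (\<lambda>\<xi> x. group_ring_op G q \<xi> x - 4 * \<xi> x) = harmonic"
proof -
  define D where "D h B \<xi> = M B (\<lambda>x. L \<one> \<xi> x - L h \<xi> x)" for h B \<xi>
  define R where "R \<xi> = (\<lambda>x. (L \<one> (D r up_edge \<xi>) x - L (inv r) (D r up_edge \<xi>) x) +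
     ((L \<one> (D t (cross_edge F) \<xi>) x - L (inv t) (D t (cross_edge F) \<xi>) x) + M (killed F) \<xi> x))" for \<xi>
  note ops = group_algebra_op_left_regular group_algebra_op_add group_algebra_op_diff
  have D_op: "group_algebra_op G (D h B)" if "h \<in> carrier G" "cylinder B" for h B
  proof -
    have "group_algebra_op G (\<lambda>\<xi> x. L \<one> \<xi> x - L h \<xi> x)" by (intro ops that(1) one_closed)
    from group_algebra_op_comp[OF M_op[OF that(2)] this] show ?thesis by (simp add: D_def[abs_def])
  qed
  note Dr = D_op[OF r_closed cylinder_up_edge] and Dt = D_op[OF t_closed cylinder_cross_edge[of F]]
  have "group_algebra_op G R"
    unfolding R_def[abs_def]
    by (intro group_algebra_op_add group_algebra_op_diff group_algebra_op_comp[OF group_algebra_op_left_regular]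
        M_op cylinder_killed Dr Dt inv_closed one_closed r_closed t_closed)
  then have "group_algebra_op G (\<lambda>\<xi> x. R \<xi> x + of_rat 4 * L \<one> \<xi> x)"
    by (intro group_algebra_op_add group_algebra_op_scale group_algebra_op_left_regular one_closed)
  then obtain q where q: "q \<in> rational_group_ring G" "(\<lambda>\<xi> x. R \<xi> x + of_rat 4 * L \<one> \<xi> x) = group_ring_op G q"
    using group_algebra_op_rational by blast
  have one: "L \<one> \<xi> = \<xi>" if "\<xi> \<in> ell2 G" for \<xi> using ell2_outside[OF that] by (rule left_regular_one)
  have qR: "(\<lambda>x. group_ring_op G q \<xi> x - 4 * \<xi> x) = R \<xi>" if "\<xi> \<in> ell2 G" for \<xi>
    by (simp add: q(2)[symmetric] one[OF that])
  have form: "ell2_inner G (\<lambda>x. L \<one> (D h B \<xi>) x - L (inv h) (D h B \<xi>) x) \<xi> = of_real ((ell2_norm G (D h B \<xi>))\<^sup>2)"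
    if "h \<in> carrier G" "cylinder B" "\<xi> \<in> ell2 G" for h B \<xi>
  proof -
    let ?z = "\<lambda>x. \<xi> x - L h \<xi> x"
    have Lh: "L h \<xi> \<in> ell2 G" by (rule left_regular_ell2[OF that(1,3)])
    have z2: "?z \<in> ell2 G" by (rule ell2_diff[OF that(3) Lh])
    have Dz: "D h B \<xi> = M B ?z" by (simp add: D_def one[OF that(3)])
    have D2: "D h B \<xi> \<in> ell2 G" unfolding Dz by (rule M_ell2[OF that(2) z2])
    have "ell2_inner G (\<lambda>x. L \<one> (D h B \<xi>) x - L (inv h) (D h B \<xi>) x) \<xi> =
        ell2_inner G (D h B \<xi>) \<xi> - ell2_inner G (D h B \<xi>) (L h \<xi>)"
      using that D2
      by (simp add: one ell2_inner_diff_left left_regular_ell2 left_regular_adjoint)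
    also have "\<dots> = ell2_inner G (D h B \<xi>) ?z" by (rule ell2_inner_diff_right[OF that(3) Lh D2, symmetric])
    also have "\<dots> = of_real ((ell2_norm G (D h B \<xi>))\<^sup>2)"
      unfolding Dz by (rule event_proj_quadratic_form[OF that(2) z2])
    finally show ?thesis .
  qed
  have "R \<xi> = (\<lambda>x. 0) \<longleftrightarrow> \<xi> \<in> harmonic" if \<xi>: "\<xi> \<in> ell2 G" for \<xi>
  proof
    assume 0: "R \<xi> = (\<lambda>x. 0)"
    have D2: "D r up_edge \<xi> \<in> ell2 G" "D t (cross_edge F) \<xi> \<in> ell2 G" "M (killed F) \<xi> \<in> ell2 G"
      using group_algebra_op_ell2[OF Dr \<xi>] group_algebra_op_ell2[OF Dt \<xi>] M_ell2[OF cylinder_killed \<xi>] by auto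
    have Z2: "(\<lambda>x. L \<one> (D r up_edge \<xi>) x - L (inv r) (D r up_edge \<xi>) x) \<in> ell2 G"
      "(\<lambda>x. L \<one> (D t (cross_edge F) \<xi>) x - L (inv t) (D t (cross_edge F) \<xi>) x) \<in> ell2 G"
      by (intro ell2_diff left_regular_ell2 D2 inv_closed one_closed r_closed t_closed)+
    have "ell2_inner G (R \<xi>) \<xi> = of_real ((ell2_norm G (D r up_edge \<xi>))\<^sup>2) +
      (of_real ((ell2_norm G (D t (cross_edge F) \<xi>))\<^sup>2) + of_real ((ell2_norm G (M (killed F) \<xi>))\<^sup>2))"
      unfolding R_def form[OF r_closed cylinder_up_edge \<xi>, symmetric]
        form[OF t_closed cylinder_cross_edge[of F] \<xi>, symmetric]
        event_proj_quadratic_form[OF cylinder_killed[of F] \<xi>, symmetric]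
      by (simp only: ell2_inner_add_left[OF Z2(1) ell2_add[OF Z2(2) D2(3)] \<xi>]
          ell2_inner_add_left[OF Z2(2) D2(3) \<xi>])
    then have "complex_of_real ((ell2_norm G (D r up_edge \<xi>))\<^sup>2 + ((ell2_norm G (D t (cross_edge F) \<xi>))\<^sup>2 +
       (ell2_norm G (M (killed F) \<xi>))\<^sup>2)) = of_real 0" by (simp add: 0 ell2_inner_zero_left)
    then have "(ell2_norm G (D r up_edge \<xi>))\<^sup>2 + ((ell2_norm G (D t (cross_edge F) \<xi>))\<^sup>2 +
       (ell2_norm G (M (killed F) \<xi>))\<^sup>2) = 0" by (simp only: of_real_eq_iff)
    then have "ell2_norm G (D r up_edge \<xi>) = 0" "ell2_norm G (D t (cross_edge F) \<xi>) = 0"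
      "ell2_norm G (M (killed F) \<xi>) = 0"
      by (simp_all add: add_nonneg_eq_0_iff)
    with D2 have "D r up_edge \<xi> = (\<lambda>x. 0)" "D t (cross_edge F) \<xi> = (\<lambda>x. 0)" "M (killed F) \<xi> = (\<lambda>x. 0)"
      by (simp_all add: ell2_norm_eq_0)
    then show "\<xi> \<in> harmonic" using \<xi> by (simp add: harmonic_def D_def one[OF \<xi>])
  next
    assume "\<xi> \<in> harmonic"
    then have "D r up_edge \<xi> = (\<lambda>x. 0)" "D t (cross_edge F) \<xi> = (\<lambda>x. 0)" "M (killed F) \<xi> = (\<lambda>x. 0)"
      by (simp_all add: harmonic_def D_def one[OF \<xi>])
    then show "R \<xi> = (\<lambda>x. 0)" by (simp add: R_def left_regular_zero)
  qed
  then have "ell2_kernel G (\<lambda>\<xi> x. group_ring_op G q \<xi> x - 4 * \<xi> x) = harmonic"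
    using qR harmonic_ell2 unfolding ell2_kernel_def by auto
  with q(1) show ?thesis by blast
qed

end

section \<open>Independence and the probabilities of the components\<close>

text \<open>Restriction to the two sets of lamps identifies pairs of configurations with configurations on the
  union.\<close>

lemma probability_independent:
  assumes A: "depends_on D A" and B: "depends_on E B" and disj: "D \<inter> E = {}"
  shows "probability (\<lambda>c. A c \<and> B c) = probability A * probability B"
proof -
  have fin: "finite D" "finite E" using A B by (simp_all add: depends_on_finite)
  then have A': "depends_on (D \<union> E) A" and B': "depends_on (D \<union> E) B"
    using A B by (auto intro: depends_on_mono)
  note AB = depends_on_conj[OF A' B']
  have A_Un: "A (x \<union> y) = A x" and B_Un: "B (x \<union> y) = B y" if "x \<subseteq> D" "y \<subseteq> E" for x y
  proof -
    have "(x \<union> y) \<inter> D = x \<inter> D" "(x \<union> y) \<inter> E = y \<inter> E" using that disj by auto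
    then show "A (x \<union> y) = A x" "B (x \<union> y) = B y"
      using depends_on_cong[OF A] depends_on_cong[OF B] by blast+
  qed
  have "bij_betw (\<lambda>(x, y). x \<union> y) ({c. c \<subseteq> D \<and> A c} \<times> {c. c \<subseteq> E \<and> B c}) {c. c \<subseteq> D \<union> E \<and> A c \<and> B c}"
  proof (rule bij_betw_byWitness[where f' = "\<lambda>c. (c \<inter> D, c \<inter> E)"])
    show "(\<lambda>c. (c \<inter> D, c \<inter> E)) ` {c. c \<subseteq> D \<union> E \<and> A c \<and> B c} \<subseteq> {c. c \<subseteq> D \<and> A c} \<times> {c. c \<subseteq> E \<and> B c}"
    proof (intro image_subsetI)
      fix c assume c: "c \<in> {c. c \<subseteq> D \<union> E \<and> A c \<and> B c}"
      have "A (c \<inter> D) = A c" "B (c \<inter> E) = B c"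
        by (rule depends_on_cong[OF A], blast, rule depends_on_cong[OF B], blast)
      with c show "(c \<inter> D, c \<inter> E) \<in> {c. c \<subseteq> D \<and> A c} \<times> {c. c \<subseteq> E \<and> B c}" by simp
    qed
  qed (use disj in \<open>auto simp: A_Un B_Un\<close>)
  then have "card {c. c \<subseteq> D \<union> E \<and> A c \<and> B c} = card {c. c \<subseteq> D \<and> A c} * card {c. c \<subseteq> E \<and> B c}"
    by (simp add: bij_betw_same_card[symmetric] card_cartesian_product)
  then show ?thesis
    using fin disj
    by (simp add: probability_eq[OF A] probability_eq[OF B] probability_eq[OF AB] card_Un_disjoint power_add)
qed

lemma depends_on_ball:
  assumes "finite J" "\<And>j. j \<in> J \<Longrightarrow> depends_on (D j) (A j)"
  shows "depends_on (\<Union>j\<in>J. D j) (\<lambda>c. \<forall>j\<in>J. A j c)"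
proof (rule depends_on_conv)
  show "finite (\<Union>j\<in>J. D j)" using assms depends_on_finite by blast
  fix c c' assume eq: "c \<inter> (\<Union>j\<in>J. D j) = c' \<inter> (\<Union>j\<in>J. D j)"
  have "A j c = A j c'" if "j \<in> J" for j
    by (rule depends_on_cong[OF assms(2)[OF that]]) (use eq that in blast)
  then show "(\<forall>j\<in>J. A j c) = (\<forall>j\<in>J. A j c')" by blast
qed

lemma probability_True: "probability (\<lambda>c. True) = 1"
  using probability_pattern[of "{}" "{}"] by simp

lemma probability_independent_family:
  assumes "finite J" "\<And>j. j \<in> J \<Longrightarrow> depends_on (D j) (A j)"
    and "\<And>i j. i \<in> J \<Longrightarrow> j \<in> J \<Longrightarrow> i \<noteq> j \<Longrightarrow> D i \<inter> D j = {}"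
  shows "probability (\<lambda>c. \<forall>j\<in>J. A j c) = (\<Prod>j\<in>J. probability (A j))"
  using assms
proof (induction J rule: finite_induct)
  case (insert i J)
  have "probability (\<lambda>c. A i c \<and> (\<forall>j\<in>J. A j c)) = probability (A i) * probability (\<lambda>c. \<forall>j\<in>J. A j c)"
  proof (rule probability_independent)
    show "D i \<inter> (\<Union>j\<in>J. D j) = {}" using insert(2,5) by blast
    show "depends_on (D i) (A i)" using insert(4) by blast
    show "depends_on (\<Union>j\<in>J. D j) (\<lambda>c. \<forall>j\<in>J. A j c)"
      using insert(1,4) by (intro depends_on_ball) blast+
  qed
  also have "probability (\<lambda>c. \<forall>j\<in>J. A j c) = (\<Prod>j\<in>J. probability (A j))"
    by (rule insert.IH) (use insert(4,5) in blast)+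
  finally show ?case using insert(1,2) by simp
qed (simp add: probability_True)

text \<open>The \<open>j\<close>-th vertices of the two arms see the lamps of the levels \<open>2 * j\<close> and \<open>2 * j + 1\<close>; these are the
  same lamps on both arms exactly if \<open>j \<in> I\<close>. The levels of the base are twisted for every \<open>I\<close>, so that
  \<open>X\<close> and \<open>Y\<close> can face each other.\<close>

definition twisted_levels :: "nat set \<Rightarrow> int set" where
  "twisted_levels I = {n. n < 2 \<or> nat (n div 2) \<notin> I}"

text \<open>The condition that \<open>good\<close> puts on the lamps of the \<open>j\<close>-th vertices of both arms. Sorting by levels
  makes the conditions independent.\<close>

definition level_event :: "nat set \<Rightarrow> nat \<Rightarrow> nat \<Rightarrow> nat \<Rightarrow> (int \<times> bool) set \<Rightarrow> bool" where
  "level_event I a b j c \<longleftrightarrow>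
    (let s = (j \<notin> I) in
     if j = 0 then (0, False) \<in> c \<and> (1, False) \<in> c \<and> (0, True) \<in> c \<and> (1, True) \<notin> c
     else (j \<le> a \<longrightarrow> (2 * int j, False) \<notin> c) \<and>
       (j = a + 1 \<longrightarrow> (2 * int j, False) \<in> c \<and> (2 * int j + 1, False) \<in> c) \<and>
       (j \<le> b \<longrightarrow> (2 * int j, s) \<notin> c) \<and>
       (j = b + 1 \<longrightarrow> (2 * int j, s) \<in> c \<and> (2 * int j + 1, s) \<in> c))"

lemma twisted_levels_iff:
  "2 * int j \<in> twisted_levels I \<longleftrightarrow> j = 0 \<or> j \<notin> I"
  "2 * int j + 1 \<in> twisted_levels I \<longleftrightarrow> j = 0 \<or> j \<notin> I"
  by (auto simp: twisted_levels_def)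

lemma flip_twisted:
  "flip (twisted_levels I) (2 * int j, False) = (2 * int j, j = 0 \<or> j \<notin> I)"
  "flip (twisted_levels I) (2 * int j + 1, False) = (2 * int j + 1, j = 0 \<or> j \<notin> I)"
  by (simp_all add: flip_def twisted_levels_iff)

lemma good_iff_level_events:
  "good (twisted_levels I) (a, b) c \<longleftrightarrow> (\<forall>j\<in>{..max a b + 1}. level_event I a b j c)"
proof -
  let ?F = "twisted_levels I"
  have sh: "shift (int j) (0, False) = (2 * int j, False)" "shift (int j) (1, False) = (2 * int j + 1, False)" for j
    by (simp_all add: shift_def)
  have Suc: "int n + 1 = int (n + 1)" for n by simp
  have arm0: "arm_ends a c \<longleftrightarrow> (\<forall>j\<in>{1..a}. (2 * int j, False) \<notin> c) \<and>
      (2 * int (a + 1), False) \<in> c \<and> (2 * int (a + 1) + 1, False) \<in> c"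
    unfolding arm_ends_def fresh_def head_X_def vimage_eq Suc sh ..
  have arm1: "arm_ends b (flip ?F -` c) \<longleftrightarrow> (\<forall>j\<in>{1..b}. (2 * int j, j \<notin> I) \<notin> c) \<and>
      (2 * int (b + 1), b + 1 \<notin> I) \<in> c \<and> (2 * int (b + 1) + 1, b + 1 \<notin> I) \<in> c"
  proof -
    have "(2 * int j, j = 0 \<or> j \<notin> I) = (2 * int j, j \<notin> I)" if "j \<in> {1..b}" for j
      using that by auto
    then have "(\<forall>j\<in>{1..b}. (2 * int j, j = 0 \<or> j \<notin> I) \<notin> c) \<longleftrightarrow> (\<forall>j\<in>{1..b}. (2 * int j, j \<notin> I) \<notin> c)"
      by (intro ball_cong refl) (simp only:)
    then show ?thesis
      unfolding arm_ends_def fresh_def head_X_def vimage_eq Suc sh flip_twisted by simp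
  qed
  have base: "head_X c \<and> head_Y (flip ?F -` c) \<longleftrightarrow>
      (0, False) \<in> c \<and> (1, False) \<in> c \<and> (0, True) \<in> c \<and> (1, True) \<notin> c"
    using flip_twisted[of I 0] by (simp add: head_X_def head_Y_def)
  have "good ?F (a, b) c \<longleftrightarrow> (head_X c \<and> head_Y (flip ?F -` c)) \<and> arm_ends a c \<and> arm_ends b (flip ?F -` c)"
    by (simp add: good_def)
  also have "\<dots> \<longleftrightarrow> (\<forall>j\<in>{..max a b + 1}. level_event I a b j c)"
    unfolding base arm0 arm1
  proof (intro iffI conjI ballI)
    fix j
    assume "((0, False) \<in> c \<and> (1, False) \<in> c \<and> (0, True) \<in> c \<and> (1, True) \<notin> c) \<and>
      ((\<forall>j\<in>{1..a}. (2 * int j, False) \<notin> c) \<and>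
      (2 * int (a + 1), False) \<in> c \<and> (2 * int (a + 1) + 1, False) \<in> c) \<and>
      (\<forall>j\<in>{1..b}. (2 * int j, j \<notin> I) \<notin> c) \<and>
      (2 * int (b + 1), b + 1 \<notin> I) \<in> c \<and> (2 * int (b + 1) + 1, b + 1 \<notin> I) \<in> c"
    then show "level_event I a b j c" unfolding level_event_def Let_def by auto
  next
    assume A: "\<forall>j\<in>{..max a b + 1}. level_event I a b j c"
    have L: "level_event I a b j c" if "j \<le> max a b + 1" for j using A that by simp
    show "(0, False) \<in> c" "(1, False) \<in> c" "(0, True) \<in> c" "(1, True) \<notin> c"
      using L[of 0] by (simp_all add: level_event_def)
    show "(2 * int (a + 1), False) \<in> c" "(2 * int (a + 1) + 1, False) \<in> c"
      using L[of "a + 1"] by (simp_all add: level_event_def Let_def)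
    show "(2 * int (b + 1), b + 1 \<notin> I) \<in> c" "(2 * int (b + 1) + 1, b + 1 \<notin> I) \<in> c"
      using L[of "b + 1"] by (simp_all add: level_event_def Let_def)
    show "(2 * int j, False) \<notin> c" if "j \<in> {1..a}" for j
      using L[of j] that unfolding level_event_def Let_def by fastforce
    show "(2 * int j, j \<notin> I) \<notin> c" if "j \<in> {1..b}" for j
      using L[of j] that unfolding level_event_def Let_def by fastforce
  qed
  finally show ?thesis .
qed


definition level_lamps :: "nat \<Rightarrow> (int \<times> bool) set" where
  "level_lamps j = {2 * int j, 2 * int j + 1} \<times> UNIV"

lemma level_lamps_disjoint: "i \<noteq> j \<Longrightarrow> level_lamps i \<inter> level_lamps j = {}"
  by (auto simp: level_lamps_def)

lemma depends_on_level_event: "depends_on (level_lamps j) (level_event I a b j)"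
proof (rule depends_on_conv)
  show "finite (level_lamps j)" by (simp add: level_lamps_def)
  fix c c' assume eq: "c \<inter> level_lamps j = c' \<inter> level_lamps j"
  have mem: "(2 * int j, s) \<in> c \<longleftrightarrow> (2 * int j, s) \<in> c'" "(2 * int j + 1, s) \<in> c \<longleftrightarrow> (2 * int j + 1, s) \<in> c'" for s
    using eq by (auto simp: level_lamps_def)
  have "j = 0 \<Longrightarrow> (0, s) \<in> c \<longleftrightarrow> (0, s) \<in> c'" "j = 0 \<Longrightarrow> (1, s) \<in> c \<longleftrightarrow> (1, s) \<in> c'" for s
    using mem[of s] by simp_all
  then show "level_event I a b j c = level_event I a b j c'"
    unfolding level_event_def Let_def mem by (cases "j = 0") simp_all
qed

lemma probability_good_eq_prod:
  "probability (good (twisted_levels I) (a, b)) = (\<Prod>j\<le>max a b + 1. probability (level_event I a b j))"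
proof -
  have "good (twisted_levels I) (a, b) = (\<lambda>c. \<forall>j\<in>{..max a b + 1}. level_event I a b j c)"
    by (rule ext) (rule good_iff_level_events)
  then show ?thesis
    using probability_independent_family[of "{..max a b + 1}" level_lamps "level_event I a b"]
    by (simp add: depends_on_level_event level_lamps_disjoint)
qed

lemma probability_level_event:
  "probability (level_event I a b 0) = 1 / 16"
  "1 \<le> j \<Longrightarrow> j \<le> a \<Longrightarrow> j \<le> b \<Longrightarrow> probability (level_event I a b j) = (if j \<in> I then 1 / 2 else 1 / 4)"
  "probability (level_event I a a (a + 1)) = (if a + 1 \<in> I then 1 / 4 else 1 / 16)"
  "a < b \<Longrightarrow> probability (level_event I a b (a + 1)) = (if a + 1 \<in> I then 0 else 1 / 8)"
  "b < a \<Longrightarrow> probability (level_event I a b (b + 1)) = (if b + 1 \<in> I then 0 else 1 / 8)"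
  "a + 1 < j \<Longrightarrow> j \<le> b \<Longrightarrow> probability (level_event I a b j) = 1 / 2"
  "b + 1 < j \<Longrightarrow> j \<le> a \<Longrightarrow> probability (level_event I a b j) = 1 / 2"
  "a < b \<Longrightarrow> probability (level_event I a b (b + 1)) = 1 / 4"
  "b < a \<Longrightarrow> probability (level_event I a b (a + 1)) = 1 / 4"
proof -
  have pattern: "probability A = (1 / 2) ^ (card P + card N)"
    if "finite P" "finite N" "P \<inter> N = {}" "\<And>c. A c \<longleftrightarrow> P \<subseteq> c \<and> N \<inter> c = {}" for A P N
  proof -
    have "A = (\<lambda>c. P \<subseteq> c \<and> N \<inter> c = {})" by (rule ext) (rule that(4))
    then show ?thesis using probability_pattern[OF that(1-3)] by simp
  qed
  let ?l = "\<lambda>j s. (2 * int j, s)" and ?m = "\<lambda>j s. (2 * int j + 1, s)"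
  show "probability (level_event I a b 0) = 1 / 16"
    by (subst pattern[of "{(0, False), (1, False), (0, True)}" "{(1, True)}"])
      (auto simp: level_event_def power_one_over)
  show "probability (level_event I a b j) = (if j \<in> I then 1 / 2 else 1 / 4)" if "1 \<le> j" "j \<le> a" "j \<le> b" for j
    by (subst pattern[of "{}" "{?l j False, ?l j (j \<notin> I)}"])
      (use that in \<open>auto simp: level_event_def Let_def power2_eq_square\<close>)
  show "probability (level_event I a a (a + 1)) = (if a + 1 \<in> I then 1 / 4 else 1 / 16)"
    by (subst pattern[of "{?l (a + 1) False, ?m (a + 1) False, ?l (a + 1) (a + 1 \<notin> I), ?m (a + 1) (a + 1 \<notin> I)}" "{}"])
      (auto simp: level_event_def Let_def card_insert_if power_one_over)
  show "probability (level_event I a b (a + 1)) = (if a + 1 \<in> I then 0 else 1 / 8)" if "a < b"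
  proof (cases "a + 1 \<in> I")
    case True
    then have "level_event I a b (a + 1) = (\<lambda>c. False)"
      using that by (auto simp: level_event_def fun_eq_iff)
    then show ?thesis using True by (simp add: probability_False)
  next
    case False
    then show ?thesis using that
      by (subst pattern[of "{?l (a + 1) False, ?m (a + 1) False}" "{?l (a + 1) True}"])
        (auto simp: level_event_def Let_def power_one_over)
  qed
  show "probability (level_event I a b (b + 1)) = (if b + 1 \<in> I then 0 else 1 / 8)" if "b < a"
  proof (cases "b + 1 \<in> I")
    case True
    then have "level_event I a b (b + 1) = (\<lambda>c. False)"
      using that by (auto simp: level_event_def fun_eq_iff)
    then show ?thesis using True by (simp add: probability_False)
  next
    case False
    then show ?thesis using that
      by (subst pattern[of "{?l (b + 1) True, ?m (b + 1) True}" "{?l (b + 1) False}"])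
        (auto simp: level_event_def Let_def power_one_over)
  qed
  show "probability (level_event I a b j) = 1 / 2" if "a + 1 < j" "j \<le> b" for j
    by (subst pattern[of "{}" "{?l j (j \<notin> I)}"]) (use that in \<open>auto simp: level_event_def Let_def\<close>)
  show "probability (level_event I a b j) = 1 / 2" if "b + 1 < j" "j \<le> a" for j
    by (subst pattern[of "{}" "{?l j False}"]) (use that in \<open>auto simp: level_event_def Let_def\<close>)
  show "probability (level_event I a b (b + 1)) = 1 / 4" if "a < b"
    by (subst pattern[of "{?l (b + 1) (b + 1 \<notin> I), ?m (b + 1) (b + 1 \<notin> I)}" "{}"])
      (use that in \<open>auto simp: level_event_def Let_def power2_eq_square\<close>)
  show "probability (level_event I a b (a + 1)) = 1 / 4" if "b < a"
    by (subst pattern[of "{?l (a + 1) False, ?m (a + 1) False}" "{}"])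
      (use that in \<open>auto simp: level_event_def Let_def power2_eq_square\<close>)
qed

text \<open>The probability that both arms are stale at the levels \<open>1\<close>, ..., \<open>m\<close>.\<close>

definition common_prefix_weight :: "nat set \<Rightarrow> nat \<Rightarrow> real" where
  "common_prefix_weight I m = (\<Prod>j\<in>{1..m}. if j \<in> I then 1 / 2 else 1 / 4)"

lemma prod_split_levels:
  fixes f :: "nat \<Rightarrow> real"
  assumes "a < b"
  shows "(\<Prod>j\<le>b + 1. f j) = f 0 * (\<Prod>j\<in>{1..a}. f j) * f (a + 1) * (\<Prod>j\<in>{a + 2..b}. f j) * f (b + 1)"
proof -
  have "{..b + 1} = insert 0 ({1..a} \<union> insert (a + 1) ({a + 2..b} \<union> {b + 1}))" using assms by auto
  moreover have "prod f ({a + 2..b} \<union> {b + 1}) = prod f {a + 2..b} * f (b + 1)"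
    by (subst prod.union_disjoint) auto
  moreover have "prod f (insert (a + 1) ({a + 2..b} \<union> {b + 1})) = f (a + 1) * prod f ({a + 2..b} \<union> {b + 1})"
    using assms by (intro prod.insert) auto
  moreover have "prod f ({1..a} \<union> insert (a + 1) ({a + 2..b} \<union> {b + 1})) =
      prod f {1..a} * prod f (insert (a + 1) ({a + 2..b} \<union> {b + 1}))"
    using assms by (intro prod.union_disjoint) auto
  moreover have "prod f (insert 0 ({1..a} \<union> insert (a + 1) ({a + 2..b} \<union> {b + 1}))) =
      f 0 * prod f ({1..a} \<union> insert (a + 1) ({a + 2..b} \<union> {b + 1}))"
    by (intro prod.insert) auto
  ultimately show ?thesis by (simp only: mult.assoc)
qed

lemma probability_good_diagonal:
  "probability (good (twisted_levels I) (a, a)) =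
    common_prefix_weight I a / 16 * (if a + 1 \<in> I then 1 / 4 else 1 / 16)"
proof -
  have split: "(\<Prod>j\<le>a + 1. f j) = f 0 * ((\<Prod>j\<in>{1..a}. f j) * f (a + 1))" for f :: "nat \<Rightarrow> real"
  proof -
    have "(\<Prod>j\<le>a + 1. f j) = f 0 * (\<Prod>j\<in>{1..a + 1}. f j)"
      by (simp add: atMost_atLeast0 prod.atLeast_Suc_atMost)
    then show ?thesis by simp
  qed
  have "(\<Prod>j\<in>{1..a}. probability (level_event I a a j)) = common_prefix_weight I a"
    unfolding common_prefix_weight_def by (rule prod.cong) (simp_all add: probability_level_event)
  then show ?thesis
    by (simp only: probability_good_eq_prod max.idem split probability_level_event)
qed

text \<open>At the level where the shorter arm stops, the longer one is stale, which is impossible if both see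
  the same lamps. Above this level only the longer arm is constrained.\<close>

lemma probability_good_off_diagonal:
  assumes "a < b"
  shows "probability (good (twisted_levels I) (a, b)) =
      common_prefix_weight I a / 16 * ((if a + 1 \<in> I then 0 else 1 / 8) * (1 / 4) * (1 / 2) ^ (b - a - 1))"
    "probability (good (twisted_levels I) (b, a)) =
      common_prefix_weight I a / 16 * ((if a + 1 \<in> I then 0 else 1 / 8) * (1 / 4) * (1 / 2) ^ (b - a - 1))"
proof -
  have max: "max a b = b" "max b a = b" using assms by simp_all
  have 1: "(\<Prod>j\<in>{1..a}. probability (level_event I a b j)) = common_prefix_weight I a"
    "(\<Prod>j\<in>{1..a}. probability (level_event I b a j)) = common_prefix_weight I a"
    unfolding common_prefix_weight_def using assms
    by (auto intro!: prod.cong simp: probability_level_event)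
  have 2: "(\<Prod>j\<in>{a + 2..b}. probability (level_event I a b j)) = (1 / 2) ^ (b - a - 1)"
    "(\<Prod>j\<in>{a + 2..b}. probability (level_event I b a j)) = (1 / 2) ^ (b - a - 1)"
    by (simp_all add: probability_level_event)
  show "probability (good (twisted_levels I) (a, b)) =
      common_prefix_weight I a / 16 * ((if a + 1 \<in> I then 0 else 1 / 8) * (1 / 4) * (1 / 2) ^ (b - a - 1))"
    unfolding probability_good_eq_prod max prod_split_levels[OF assms] 1 2 probability_level_event(1)
      probability_level_event(4)[OF assms] probability_level_event(8)[OF assms] by simp
  show "probability (good (twisted_levels I) (b, a)) =
      common_prefix_weight I a / 16 * ((if a + 1 \<in> I then 0 else 1 / 8) * (1 / 4) * (1 / 2) ^ (b - a - 1))"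
    unfolding probability_good_eq_prod max prod_split_levels[OF assms] 1 2 probability_level_event(1)
      probability_level_event(5)[OF assms] probability_level_event(9)[OF assms] by simp
qed


section \<open>The dimension as a function of the index set\<close>

text \<open>The probability, given that both arms are stale below level \<open>j\<close>, that an arm stops there and both end
  in \<open>X\<close>. For \<open>j \<notin> I\<close> this is \<open>1 / 16\<close>, if both stop at once, plus \<open>1 / 8\<close> for the two cases in which the
  other arm survives and ends in \<open>X\<close> with conditional probability \<open>1 / 2\<close>.\<close>

definition stop_weight :: "nat set \<Rightarrow> nat \<Rightarrow> real" where
  "stop_weight I j = (if j \<in> I then 1 / 4 else 3 / 16)"

text \<open>The factor \<open>1 / 16\<close> is the probability of a base \<open>X\<close> with partner \<open>Y\<close>.\<close>

definition dimension_series :: "nat set \<Rightarrow> nat \<Rightarrow> real" where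
  "dimension_series I m = common_prefix_weight I m * stop_weight I (m + 1) / 16"

lemma common_prefix_weight_Suc:
  "common_prefix_weight I (Suc m) = common_prefix_weight I m * (if Suc m \<in> I then 1 / 2 else 1 / 4)"
  by (simp add: common_prefix_weight_def)

lemma common_prefix_weight_pos: "0 < common_prefix_weight I m"
  by (simp add: common_prefix_weight_def prod_pos)

lemma common_prefix_weight_le:
  "common_prefix_weight I (m + k) \<le> common_prefix_weight I m * (1 / 2) ^ k"
proof (induction k)
  case (Suc k)
  have "common_prefix_weight I (m + Suc k) \<le> common_prefix_weight I (m + k) * (1 / 2)"
    using common_prefix_weight_pos[of I "m + k"] by (simp add: common_prefix_weight_Suc)
  also have "\<dots> \<le> common_prefix_weight I m * (1 / 2) ^ k * (1 / 2)"
    by (rule mult_right_mono[OF Suc]) simp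
  finally show ?case by (simp add: mult_ac)
qed simp

lemma sum_square_symmetric:
  fixes g :: "nat \<times> nat \<Rightarrow> real"
  shows "(\<Sum>\<tau>\<in>{..<N} \<times> {..<N}. g \<tau>) = (\<Sum>m<N. g (m, m) + (\<Sum>b\<in>{m<..<N}. g (m, b) + g (b, m)))"
proof (induction N)
  case (Suc N)
  have eq: "{..<Suc N} \<times> {..<Suc N} = ({..<N} \<times> {..<N}) \<union> ((\<lambda>a. (a, N)) ` {..<N} \<union> ((\<lambda>a. (N, a)) ` {..<N} \<union> {(N, N)}))"
    by auto
  have "(\<Sum>\<tau>\<in>{..<Suc N} \<times> {..<Suc N}. g \<tau>) = (\<Sum>\<tau>\<in>{..<N} \<times> {..<N}. g \<tau>) +
      ((\<Sum>\<tau>\<in>(\<lambda>a. (a, N)) ` {..<N}. g \<tau>) + ((\<Sum>\<tau>\<in>(\<lambda>a. (N, a)) ` {..<N}. g \<tau>) + g (N, N)))"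
    unfolding eq by (subst sum.union_disjoint, simp, simp, force)+ simp
  also have "\<dots> = (\<Sum>\<tau>\<in>{..<N} \<times> {..<N}. g \<tau>) + ((\<Sum>m<N. g (m, N) + g (N, m)) + g (N, N))"
    by (simp add: sum.reindex inj_on_def sum.distrib)
  also have "\<dots> = (\<Sum>m<N. (g (m, m) + (\<Sum>b\<in>{m<..<N}. g (m, b) + g (b, m))) + (g (m, N) + g (N, m))) + g (N, N)"
    unfolding Suc by (simp add: sum.distrib)
  also have "\<dots> = (\<Sum>m<N. g (m, m) + (\<Sum>b\<in>{m<..<Suc N}. g (m, b) + g (b, m))) + g (N, N)"
  proof -
    have "(\<Sum>b\<in>{m<..<Suc N}. g (m, b) + g (b, m)) = (\<Sum>b\<in>{m<..<N}. g (m, b) + g (b, m)) + (g (m, N) + g (N, m))"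
      if "m < N" for m
    proof -
      have "{m<..<Suc N} = insert N {m<..<N}" using that by auto
      then show ?thesis by (simp add: add.commute)
    qed
    then show ?thesis by (simp add: add.assoc)
  qed
  also have "\<dots> = (\<Sum>m<Suc N. g (m, m) + (\<Sum>b\<in>{m<..<Suc N}. g (m, b) + g (b, m)))"
  proof -
    have "{N<..<Suc N} = {}" by auto
    then show ?thesis by simp
  qed
  finally show ?case .
qed simp

lemma geometric_tail_sum:
  fixes m N :: nat
  assumes "m < N"
  shows "(\<Sum>b\<in>{m<..<N}. (1 / 2 :: real) ^ (b - m - 1)) = 2 - 2 * (1 / 2) ^ (N - m - 1)"
  using assms
proof (induction N)
  case (Suc N)
  show ?case
  proof (cases "m = N")
    case False
    then have "m < N" using Suc(2) by simp
    moreover have "{m<..<Suc N} = insert N {m<..<N}" using \<open>m < N\<close> by auto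
    moreover have "Suc N - m - 1 = Suc (N - m - 1)" using \<open>m < N\<close> by simp
    ultimately show ?thesis using Suc(1) by simp
  qed simp
qed simp

text \<open>The correction accounts for the longer arms that the truncation at \<open>N\<close> cuts off.\<close>

lemma sum_probability_good:
  "(\<Sum>\<tau>\<in>{..<N} \<times> {..<N}. probability (good (twisted_levels I) \<tau>)) =
    (\<Sum>m<N. dimension_series I m) -
    (\<Sum>m<N. common_prefix_weight I m / 16 * (if m + 1 \<in> I then 0 else 1 / 8) * (1 / 2) ^ (N - m - 1))"
  unfolding sum_square_symmetric sum_subtractf[symmetric]
proof (rule sum.cong[OF refl])
  fix m assume "m \<in> {..<N}"
  then have m: "m < N" by simp
  let ?K = "common_prefix_weight I m / 16" and ?s = "if m + 1 \<in> I then 0 else 1 / 8 :: real"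
  let ?P = "\<lambda>\<tau>. probability (good (twisted_levels I) \<tau>)"
  have "(\<Sum>b\<in>{m<..<N}. ?P (m, b) + ?P (b, m)) = (\<Sum>b\<in>{m<..<N}. ?K * ?s * (1 / 2) * (1 / 2) ^ (b - m - 1))"
    by (rule sum.cong[OF refl]) (simp add: probability_good_off_diagonal)
  also have "\<dots> = ?K * ?s * (1 / 2) * (2 - 2 * (1 / 2) ^ (N - m - 1))"
    by (simp only: sum_distrib_left[symmetric] geometric_tail_sum[OF m])
  also have "\<dots> = ?K * ?s - ?K * ?s * (1 / 2) ^ (N - m - 1)"
  proof -
    have "y * (1 / 2) * (2 - 2 * x) = y - y * x" for x y :: real by (simp add: field_simps)
    then show ?thesis .
  qed
  finally have off: "(\<Sum>b\<in>{m<..<N}. ?P (m, b) + ?P (b, m)) = ?K * ?s - ?K * ?s * (1 / 2) ^ (N - m - 1)" .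
  have "dimension_series I m = ?P (m, m) + ?K * ?s"
    by (simp add: probability_good_diagonal dimension_series_def stop_weight_def)
  with off show "?P (m, m) + (\<Sum>b\<in>{m<..<N}. ?P (m, b) + ?P (b, m)) =
      dimension_series I m - ?K * ?s * (1 / 2) ^ (N - m - 1)"
    by simp
qed

lemma dimension_series_nonneg: "0 \<le> dimension_series I m"
  using common_prefix_weight_pos[of I m] by (simp add: dimension_series_def stop_weight_def)

lemma dimension_series_le:
  "dimension_series I (m + k) \<le> common_prefix_weight I m / 64 * (1 / 2) ^ k"
proof -
  have "dimension_series I (m + k) \<le> common_prefix_weight I (m + k) / 64"
    using common_prefix_weight_pos[of I "m + k"] by (simp add: dimension_series_def stop_weight_def)
  then show ?thesis using common_prefix_weight_le[of I m k] by simp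
qed

lemma summable_dimension_series: "summable (dimension_series I)"
proof (rule summable_comparison_test')
  show "summable (\<lambda>k. common_prefix_weight I 0 / 64 * (1 / 2 :: real) ^ k)"
    by (intro summable_mult summable_geometric) simp
  show "norm (dimension_series I n) \<le> common_prefix_weight I 0 / 64 * (1 / 2) ^ n" if "n \<ge> 0" for n
    using dimension_series_le[of I 0 n] dimension_series_nonneg[of I n] by simp
qed

lemma sum_probability_good_tendsto:
  "(\<lambda>n. \<Sum>\<tau>\<in>{..<2 * n} \<times> {..<2 * n}. probability (good (twisted_levels I) \<tau>)) \<longlonglongrightarrow> suminf (dimension_series I)"
proof -
  let ?err = "\<lambda>N. \<Sum>m<N. common_prefix_weight I m / 16 * (if m + 1 \<in> I then 0 else 1 / 8) * (1 / 2) ^ (N - m - 1)"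
  have "?err \<longlonglongrightarrow> 0"
  proof (rule real_tendsto_sandwich)
    show "\<forall>\<^sub>F N in sequentially. 0 \<le> ?err N"
      using common_prefix_weight_pos by (intro always_eventually allI sum_nonneg mult_nonneg_nonneg) (auto simp: less_imp_le)
    have "?err N \<le> real N * (2 * (1 / 2) ^ N)" for N
    proof -
      have "?err N \<le> (\<Sum>m<N. 2 * (1 / 2) ^ N)"
      proof (rule sum_mono)
        fix m assume "m \<in> {..<N}"
        then have N: "N = m + (N - m - 1) + 1" by simp
        have "common_prefix_weight I m \<le> (1 / 2) ^ m"
          using common_prefix_weight_le[of I 0 m] by (simp add: common_prefix_weight_def)
        then have "common_prefix_weight I m / 16 * (if m + 1 \<in> I then 0 else 1 / 8) \<le> (1 / 2) ^ m"
          using common_prefix_weight_pos[of I m] by auto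
        then have "common_prefix_weight I m / 16 * (if m + 1 \<in> I then 0 else 1 / 8) * (1 / 2) ^ (N - m - 1)
          \<le> (1 / 2) ^ m * (1 / 2) ^ (N - m - 1)" by (rule mult_right_mono) simp
        also have "\<dots> = 2 * (1 / 2) ^ N"
          by (subst (2) N) (simp add: power_add)
        finally show "common_prefix_weight I m / 16 * (if m + 1 \<in> I then 0 else 1 / 8) * (1 / 2) ^ (N - m - 1)
          \<le> 2 * (1 / 2) ^ N" .
      qed
      then show ?thesis by simp
    qed
    then show "\<forall>\<^sub>F N in sequentially. ?err N \<le> real N * (2 * (1 / 2) ^ N)" by simp
    show "(\<lambda>N. real N * (2 * (1 / 2) ^ N)) \<longlonglongrightarrow> 0" by real_asymp
  qed simp
  moreover have "(\<lambda>N. \<Sum>m<N. dimension_series I m) \<longlonglongrightarrow> suminf (dimension_series I)"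
    by (rule summable_LIMSEQ[OF summable_dimension_series])
  ultimately have "(\<lambda>N. (\<Sum>m<N. dimension_series I m) - ?err N) \<longlonglongrightarrow> suminf (dimension_series I) - 0"
    by (intro tendsto_diff)
  then have "(\<lambda>N. \<Sum>\<tau>\<in>{..<N} \<times> {..<N}. probability (good (twisted_levels I) \<tau>)) \<longlonglongrightarrow> suminf (dimension_series I)"
    by (simp add: sum_probability_good)
  moreover have "filterlim (\<lambda>n::nat. 2 * n) sequentially sequentially" by real_asymp
  ultimately show ?thesis by (rule filterlim_compose)
qed

lemma lex_less_cases:
  assumes "lex_less I J"
  obtains n where "n \<in> J" "n \<notin> I" "\<And>i. i < n \<Longrightarrow> i \<in> I \<longleftrightarrow> i \<in> J"
proof -
  let ?n = "LEAST n. n \<in> sym_diff I J"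
  have "?n \<in> J" "?n \<notin> I" using assms by (simp_all add: lex_less_def Let_def)
  moreover have "i \<in> I \<longleftrightarrow> i \<in> J" if "i < ?n" for i
    using not_less_Least[OF that] by blast
  ultimately show ?thesis by (rule that)
qed

text \<open>Let \<open>n = k + 1\<close> be the first difference. The terms before \<open>k\<close> agree, and with the common weight \<open>C\<close> of
  the first \<open>k\<close> levels, the rest of the series is at most \<open>C / 16 * 5 / 16\<close> for \<open>I\<close>, by comparison with a geometric
  series. For \<open>J\<close>, the terms \<open>k\<close> and \<open>k + 1\<close> alone contribute at least \<open>C / 16 * 11 / 32\<close>.\<close>

lemma suminf_dimension_series_strict_mono:
  assumes "lex_less I J" "J \<subseteq> {1..}"
  shows "suminf (dimension_series I) < suminf (dimension_series J)"
proof -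
  obtain n where n: "n \<in> J" "n \<notin> I" and agree: "\<And>i. i < n \<Longrightarrow> i \<in> I \<longleftrightarrow> i \<in> J"
    using lex_less_cases[OF assms(1)] by blast
  have "n \<noteq> 0" using n(1) assms(2) by auto
  then obtain k where k: "n = Suc k" using not0_implies_Suc by blast
  define C where "C = common_prefix_weight I k"
  have prefix: "common_prefix_weight I m = common_prefix_weight J m" if "m \<le> k" for m
    unfolding common_prefix_weight_def using agree that k by (intro prod.cong) auto
  have C: "C = common_prefix_weight J k" "0 < C"
    using prefix[of k] common_prefix_weight_pos by (simp_all add: C_def)
  have start: "(\<Sum>m<k. dimension_series I m) = (\<Sum>m<k. dimension_series J m)"
    using agree k by (intro sum.cong) (auto simp: dimension_series_def stop_weight_def prefix)
  have "suminf (dimension_series I) = suminf (\<lambda>m. dimension_series I (m + Suc k)) + (\<Sum>m<Suc k. dimension_series I m)"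
    by (rule suminf_split_initial_segment[OF summable_dimension_series])
  also have "suminf (\<lambda>m. dimension_series I (m + Suc k)) \<le> suminf (\<lambda>m. common_prefix_weight I (Suc k) / 64 * (1 / 2 :: real) ^ m)"
  proof (rule suminf_le)
    show "dimension_series I (m + Suc k) \<le> common_prefix_weight I (Suc k) / 64 * (1 / 2) ^ m" for m
      using dimension_series_le[of I "Suc k" m] by (simp add: add.commute)
    show "summable (\<lambda>m. dimension_series I (m + Suc k))"
      using summable_dimension_series by (rule summable_ignore_initial_segment)
    show "summable (\<lambda>m. common_prefix_weight I (Suc k) / 64 * (1 / 2 :: real) ^ m)"
      by (intro summable_mult summable_geometric) simp
  qed
  also have "suminf (\<lambda>m. common_prefix_weight I (Suc k) / 64 * (1 / 2 :: real) ^ m) = C / 128"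
  proof -
    have "suminf (\<lambda>m. x * (1 / 2 :: real) ^ m) = x * 2" for x
      by (subst suminf_mult) (simp_all add: suminf_geometric summable_geometric)
    then show ?thesis using n k by (simp only:) (simp add: common_prefix_weight_Suc C_def)
  qed
  also have "(\<Sum>m<Suc k. dimension_series I m) = (\<Sum>m<k. dimension_series J m) + C * 3 / 256"
    using n k by (simp add: start) (simp add: dimension_series_def stop_weight_def C_def)
  finally have upper: "suminf (dimension_series I) \<le> (\<Sum>m<k. dimension_series J m) + C * 5 / 256" by simp
  have "(\<Sum>m<k. dimension_series J m) + C * 11 / 512 \<le> (\<Sum>m<Suc (Suc k). dimension_series J m)"
  proof -
    have "C / 64 \<le> dimension_series J k"
      using n k by (simp add: dimension_series_def stop_weight_def C)
    moreover have "C * 3 / 512 \<le> dimension_series J (Suc k)"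
      using n k C(2) by (auto simp: dimension_series_def stop_weight_def common_prefix_weight_Suc C(1)[symmetric])
    ultimately show ?thesis by simp
  qed
  also have "\<dots> \<le> suminf (dimension_series J)"
    by (rule sum_le_suminf[OF summable_dimension_series]) (auto simp: dimension_series_nonneg)
  finally show ?thesis using upper C(2) by simp
qed

section \<open>Free groups\<close>

lemma inv_letter_inv_letter [simp]: "inv_letter (inv_letter a) = a"
  by (simp add: inv_letter_def)

lemma reduced_Nil [simp]: "reduced []"
  by (simp add: reduced_def)

lemma reduced_Cons: "reduced (a # w) \<longleftrightarrow> reduced w \<and> (w \<noteq> [] \<longrightarrow> hd w \<noteq> inv_letter a)"
  by (cases w) (auto simp: reduced_def)

lemma reduced_push_letter: "reduced w \<Longrightarrow> reduced (push_letter a w)"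
  by (cases w) (auto simp: push_letter_def reduced_Cons)

lemma push_letter_cancel: "reduced w \<Longrightarrow> push_letter (inv_letter a) (push_letter a w) = w"
  by (cases w) (auto simp: push_letter_def reduced_Cons neq_Nil_conv)

lemma reduced_foldr_push: "reduced z \<Longrightarrow> reduced (foldr push_letter v z)"
  by (induction v) (auto intro: reduced_push_letter)

lemma reduced_reduce: "reduced (reduce w)"
  by (simp add: reduce_def reduced_foldr_push)

lemma reduce_reduced: "reduced w \<Longrightarrow> reduce w = w"
  by (induction w) (auto simp: reduce_def reduced_Cons push_letter_def)

text \<open>Cancelling in a word does not change the operator that it induces, if opposite letters induce
  inverse operators on the set \<open>P\<close>. This is applied to the action of letters on reduced words, which yields
  associativity, and to their action on lamps.\<close>

lemma foldr_push_letter: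
  assumes "\<And>a x. P x \<Longrightarrow> f (inv_letter a) (f a x) = x" "\<And>a x. P x \<Longrightarrow> P (f a x)" "P x"
  shows "foldr f (push_letter a w) x = f a (foldr f w x)"
proof -
  have P: "P (foldr f w x)" for w by (induction w) (auto intro: assms(2,3))
  show ?thesis
  proof (cases "w \<noteq> [] \<and> hd w = inv_letter a")
    case True
    then obtain v where v: "w = inv_letter a # v" by (cases w) auto
    then show ?thesis using assms(1)[OF P, of "inv_letter a" v] by (simp add: push_letter_def)
  next
    case False
    then have "push_letter a w = a # w" unfolding push_letter_def by (rule if_not_P)
    then show ?thesis by simp
  qed
qed

lemma foldr_reduce:
  assumes "\<And>a x. P x \<Longrightarrow> f (inv_letter a) (f a x) = x" "\<And>a x. P x \<Longrightarrow> P (f a x)" "P x"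
  shows "foldr f (reduce w) x = foldr f w x"
proof (induction w)
  case (Cons a w)
  have "foldr f (reduce (a # w)) x = foldr f (push_letter a (reduce w)) x" by (simp add: reduce_def)
  also have "\<dots> = f a (foldr f (reduce w) x)" by (rule foldr_push_letter[where P = P]) (use assms in auto)
  finally show ?case by (simp add: Cons)
qed (simp add: reduce_def)

text \<open>Reduced words multiply like the permutations of the set of reduced words that they induce.\<close>

lemma foldr_push_reduce: "reduced z \<Longrightarrow> foldr push_letter (reduce v) z = foldr push_letter v z"
  by (rule foldr_reduce[where P = reduced]) (auto simp: push_letter_cancel reduced_push_letter)

lemma reduce_append: "reduce (v @ w) = foldr push_letter v (reduce w)"
  by (simp add: reduce_def)

lemma reduce_append_reduce: "reduce (v @ reduce w) = reduce (v @ w)" "reduce (reduce v @ w) = reduce (v @ w)"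
  by (simp_all add: reduce_append reduce_reduced reduced_reduce foldr_push_reduce)

lemma set_push_letter: "set (push_letter a w) \<subseteq> insert a (set w)"
  by (cases w) (auto simp: push_letter_def)

lemma set_reduce: "set (reduce w) \<subseteq> set w"
proof (induction w)
  case (Cons a w)
  then show ?case using set_push_letter[of a "reduce w"] by (auto simp: reduce_def)
qed (simp add: reduce_def)

lemma reduce_inverse: "reduce (rev (map inv_letter w) @ w) = []"
proof (induction w)
  case (Cons a w)
  have "reduce (rev (map inv_letter (a # w)) @ (a # w)) =
    foldr push_letter (rev (map inv_letter w)) (push_letter (inv_letter a) (push_letter a (reduce w)))"
    by (simp add: reduce_def)
  also have "\<dots> = reduce (rev (map inv_letter w) @ w)"
    by (simp add: push_letter_cancel reduced_reduce reduce_append)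
  finally show ?case using Cons by simp
qed (simp add: reduce_def)

lemma group_free_group: "group (free_group S)"
proof (rule groupI)
  have carrier: "reduce w \<in> carrier (free_group S)" if "set w \<subseteq> S \<times> UNIV" for w
    using that set_reduce[of w] by (auto simp: free_group_def reduced_reduce in_lists_conv_set)
  fix x y z assume "x \<in> carrier (free_group S)" "y \<in> carrier (free_group S)" "z \<in> carrier (free_group S)"
  then have xyz: "set x \<subseteq> S \<times> UNIV" "set y \<subseteq> S \<times> UNIV" "reduced x"
    by (auto simp: free_group_def in_lists_conv_set)
  then show "x \<otimes>\<^bsub>free_group S\<^esub> y \<in> carrier (free_group S)"
    using carrier[of "x @ y"] by (simp add: free_group_def)
  show "x \<otimes>\<^bsub>free_group S\<^esub> y \<otimes>\<^bsub>free_group S\<^esub> z = x \<otimes>\<^bsub>free_group S\<^esub> (y \<otimes>\<^bsub>free_group S\<^esub> z)"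
    by (simp add: free_group_def reduce_append_reduce)
  show "\<one>\<^bsub>free_group S\<^esub> \<otimes>\<^bsub>free_group S\<^esub> x = x"
    using xyz by (simp add: free_group_def reduce_reduced)
  have "set (rev (map inv_letter x)) \<subseteq> S \<times> UNIV" using xyz(1) by (auto simp: inv_letter_def)
  then show "\<exists>y\<in>carrier (free_group S). y \<otimes>\<^bsub>free_group S\<^esub> x = \<one>\<^bsub>free_group S\<^esub>"
    by (intro bexI[of _ "reduce (rev (map inv_letter x))"] carrier)
      (simp_all only: free_group_def monoid.select_convs reduce_append_reduce reduce_inverse)
qed (simp add: free_group_def)

interpretation F2: group F2
  by (rule group_free_group)

lemma F2_carrier: "w \<in> carrier F2 \<longleftrightarrow> reduced w"
  by (auto simp: free_group_def in_lists_conv_set)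

lemma F2_mult: "v \<otimes>\<^bsub>F2\<^esub> w = reduce (v @ w)"
  by (simp add: free_group_def)

lemma F2_one: "\<one>\<^bsub>F2\<^esub> = []"
  by (simp add: free_group_def)

section \<open>An action of the free group on lamps\<close>

text \<open>The generator \<open>False\<close> is \<open>s\<close>, and \<open>True\<close> is \<open>t\<close>; the latter acts as an involution.\<close>

definition letter_act :: "int set \<Rightarrow> bool \<times> bool \<Rightarrow> int \<times> bool \<Rightarrow> int \<times> bool" where
  "letter_act F a = (\<lambda>(n, b). if fst a then (n, b \<noteq> (n \<in> F)) else (if snd a then n + 1 else n - 1, b))"

definition word_act :: "int set \<Rightarrow> F2_word \<Rightarrow> int \<times> bool \<Rightarrow> int \<times> bool" where
  "word_act F w x = foldr (letter_act F) w x"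

lemma letter_act_inv: "letter_act F (inv_letter a) (letter_act F a x) = x"
  by (auto simp: letter_act_def inv_letter_def split: prod.splits if_splits)

lemma word_act_mult: "word_act F (v \<otimes>\<^bsub>F2\<^esub> w) x = word_act F v (word_act F w x)"
  unfolding word_act_def F2_mult
  by (subst foldr_reduce[where P = "\<lambda>_. True"]) (auto simp: letter_act_inv)

lemma word_act_one: "word_act F [] x = x"
  by (simp add: word_act_def)

lemma word_act_inv:
  assumes "g \<in> carrier F2"
  shows "word_act F (inv\<^bsub>F2\<^esub> g) (word_act F g x) = x" "word_act F g (word_act F (inv\<^bsub>F2\<^esub> g) x) = x"
  using assms by (simp_all add: word_act_mult[symmetric] F2_one word_act_one)

lemma inj_word_act: "g \<in> carrier F2 \<Longrightarrow> inj (word_act F g)"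
  by (rule inj_on_inverseI[where g = "word_act F (inv\<^bsub>F2\<^esub> g)"]) (simp add: word_act_inv)

lemma word_act_replicate:
  "word_act F (replicate k (False, True)) (n, b) = (n + int k, b)"
  "word_act F (replicate k (False, False)) (n, b) = (n - int k, b)"
  by (induction k) (auto simp: word_act_def letter_act_def)

lemma reduced_replicate: "reduced (replicate k a)"
  by (induction k) (auto simp: reduced_Cons hd_replicate inv_letter_def prod_eq_iff)

text \<open>A group element that takes the lamp \<open>(0, False)\<close> to the given one.\<close>

definition lamp_word :: "int \<times> bool \<Rightarrow> F2_word" where
  "lamp_word = (\<lambda>(n, b). replicate (nat \<bar>n\<bar>) (False, n \<ge> 0) @ (if b then [(True, True)] else []))"

lemma lamp_word_carrier: "lamp_word x \<in> carrier F2"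
proof -
  obtain n b where x: "x = (n, b)" by (cases x)
  have "reduced (replicate k a @ (if b then [(True, True)] else []))" if "\<not> fst a" for k and a :: "bool \<times> bool"
    using that by (induction k) (auto simp: reduced_Cons hd_append hd_replicate inv_letter_def prod_eq_iff)
  then show ?thesis by (simp add: F2_carrier lamp_word_def x)
qed

lemma word_act_lamp_word:
  assumes "0 \<in> F"
  shows "word_act F (lamp_word x) (0, False) = x"
proof -
  obtain n b where x: "x = (n, b)" by (cases x)
  have "word_act F (lamp_word x) (0, False) = word_act F (replicate (nat \<bar>n\<bar>) (False, n \<ge> 0)) (0, b)"
    using assms by (simp add: x lamp_word_def word_act_def letter_act_def)
  also have "\<dots> = x" by (cases "n \<ge> 0") (simp_all add: x word_act_replicate)
  finally show ?thesis .
qed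

section \<open>Invariant subgroups from the action\<close>

lemma group_Z2_sum: "group Z2_sum"
  by simp

lemma comm_group_Z2_sum: "comm_group Z2_sum"
  by (rule group.group_comm_groupI[OF group_Z2_sum]) (auto simp: add.commute)

lemma Z2_sum_carrier:
  "v \<in> carrier Z2_sum \<longleftrightarrow> v \<in> (\<Pi>\<^sub>E g\<in>carrier F2. {0..<2}) \<and> finite {g \<in> carrier F2. v g \<noteq> 0}"
  by (simp add: carrier_sum_group carrier_integer_mod_group)

text \<open>The lamps that an element of the direct sum lights, when the coordinate \<open>g\<close> operates the lamp
  \<open>word_act F g (0, False)\<close>.\<close>

definition lit :: "int set \<Rightarrow> (F2_word \<Rightarrow> int) \<Rightarrow> (int \<times> bool) set" where
  "lit F v = {x. odd (\<Sum>g | g \<in> carrier F2 \<and> v g \<noteq> 0 \<and> word_act F g (0, False) = x. v g)}"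

lemma lit_iff:
  assumes "finite S" "S \<subseteq> carrier F2" "{g \<in> carrier F2. v g \<noteq> 0} \<subseteq> S"
  shows "x \<in> lit F v \<longleftrightarrow> odd (\<Sum>g\<in>{g \<in> S. word_act F g (0, False) = x}. v g)"
proof -
  have "(\<Sum>g | g \<in> carrier F2 \<and> v g \<noteq> 0 \<and> word_act F g (0, False) = x. v g) =
    (\<Sum>g\<in>{g \<in> S. word_act F g (0, False) = x}. v g)"
    by (rule sum.mono_neutral_left) (use assms in auto)
  then show ?thesis by (simp add: lit_def)
qed

lemma even_sum_mod_2: "even (\<Sum>g\<in>S. f g mod (2::int)) \<longleftrightarrow> even (\<Sum>g\<in>S. f g)"
  by (induction S rule: infinite_finite_induct) auto

lemma lit_mult:
  assumes "v \<in> carrier Z2_sum" "w \<in> carrier Z2_sum"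
  shows "lit F (v \<otimes>\<^bsub>Z2_sum\<^esub> w) = sym_diff (lit F v) (lit F w)"
proof -
  let ?S = "{g \<in> carrier F2. v g \<noteq> 0} \<union> {g \<in> carrier F2. w g \<noteq> 0}"
  have fin: "finite ?S" using assms by (simp add: Z2_sum_carrier)
  have vw: "(v \<otimes>\<^bsub>Z2_sum\<^esub> w) g = (v g + w g) mod 2" if "g \<in> carrier F2" for g using that by simp
  have "x \<in> lit F (v \<otimes>\<^bsub>Z2_sum\<^esub> w) \<longleftrightarrow> x \<in> sym_diff (lit F v) (lit F w)" for x
  proof -
    let ?S' = "{g \<in> ?S. word_act F g (0, False) = x}"
    have "x \<in> lit F (v \<otimes>\<^bsub>Z2_sum\<^esub> w) \<longleftrightarrow> odd (\<Sum>g\<in>?S'. (v \<otimes>\<^bsub>Z2_sum\<^esub> w) g)"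
      by (rule lit_iff[OF fin]) (auto simp del: mult_sum_group simp: vw)
    also have "(\<Sum>g\<in>?S'. (v \<otimes>\<^bsub>Z2_sum\<^esub> w) g) = (\<Sum>g\<in>?S'. (v g + w g) mod 2)"
      by (rule sum.cong[OF refl], rule vw) auto
    also have "odd \<dots> \<longleftrightarrow> odd ((\<Sum>g\<in>?S'. v g) + (\<Sum>g\<in>?S'. w g))"
      by (simp only: even_sum_mod_2 sum.distrib)
    also have "\<dots> \<longleftrightarrow> (x \<in> lit F v) \<noteq> (x \<in> lit F w)"
      using lit_iff[OF fin, of v x F] lit_iff[OF fin, of w x F] by auto
    finally show ?thesis by blast
  qed
  then show ?thesis by blast
qed

lemma finite_lit:
  assumes "v \<in> carrier Z2_sum"
  shows "finite (lit F v)"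
proof (rule finite_subset)
  show "finite ((\<lambda>g. word_act F g (0, False)) ` {g \<in> carrier F2. v g \<noteq> 0})"
    using assms by (simp add: Z2_sum_carrier)
  show "lit F v \<subseteq> (\<lambda>g. word_act F g (0, False)) ` {g \<in> carrier F2. v g \<noteq> 0}"
  proof
    fix x assume "x \<in> lit F v"
    then have "{g. g \<in> carrier F2 \<and> v g \<noteq> 0 \<and> word_act F g (0, False) = x} \<noteq> {}"
      by (metis (no_types, lifting) lit_def mem_Collect_eq sum.empty even_zero)
    then show "x \<in> (\<lambda>g. word_act F g (0, False)) ` {g \<in> carrier F2. v g \<noteq> 0}" by auto
  qed
qed

lemma lit_surj:
  assumes "0 \<in> F" "finite S"
  obtains v where "v \<in> carrier Z2_sum" "lit F v = S"
proof
  let ?v = "\<lambda>g\<in>carrier F2. if g \<in> lamp_word ` S then 1 else (0::int)"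
  have sub: "{g \<in> carrier F2. ?v g \<noteq> 0} \<subseteq> lamp_word ` S" by auto
  have car: "lamp_word ` S \<subseteq> carrier F2" using lamp_word_carrier by auto
  have fin: "finite (lamp_word ` S)" using assms(2) by simp
  show "?v \<in> carrier Z2_sum"
    unfolding Z2_sum_carrier using finite_subset[OF sub fin] by auto
  have "x \<in> lit F ?v \<longleftrightarrow> x \<in> S" for x
  proof -
    have "{g \<in> lamp_word ` S. word_act F g (0, False) = x} = (if x \<in> S then {lamp_word x} else {})"
      by (auto simp: word_act_lamp_word[OF assms(1)])
    then show ?thesis unfolding lit_iff[OF fin car sub] by (simp add: lamp_word_carrier)
  qed
  then show "lit F ?v = S" by blast
qed

lemma translation_closed:
  assumes "g \<in> carrier F2" "v \<in> carrier Z2_sum"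
  shows "translation g v \<in> carrier Z2_sum"
proof -
  have "{h \<in> carrier F2. translation g v h \<noteq> 0} \<subseteq> (\<lambda>h. g \<otimes>\<^bsub>F2\<^esub> h) ` {h \<in> carrier F2. v h \<noteq> 0}"
  proof
    fix h assume "h \<in> {h \<in> carrier F2. translation g v h \<noteq> 0}"
    then show "h \<in> (\<lambda>h. g \<otimes>\<^bsub>F2\<^esub> h) ` {h \<in> carrier F2. v h \<noteq> 0}"
      using assms(1) by (intro image_eqI[where x = "inv\<^bsub>F2\<^esub> g \<otimes>\<^bsub>F2\<^esub> h"])
        (auto simp: translation_def F2.m_assoc[symmetric])
  qed
  then have "finite {h \<in> carrier F2. translation g v h \<noteq> 0}"
    by (rule finite_subset) (use assms(2) in \<open>simp add: Z2_sum_carrier\<close>)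
  moreover have "translation g v \<in> (\<Pi>\<^sub>E g\<in>carrier F2. {0..<2})"
    using assms by (auto simp: Z2_sum_carrier translation_def PiE_iff)
  ultimately show ?thesis unfolding Z2_sum_carrier by blast
qed

lemma translation_mult:
  assumes "g \<in> carrier F2" "h \<in> carrier F2"
  shows "translation g (translation h v) = translation (g \<otimes>\<^bsub>F2\<^esub> h) v"
  using assms by (auto simp: translation_def fun_eq_iff F2.inv_mult_group F2.m_assoc)

lemma translation_one:
  assumes "v \<in> carrier Z2_sum"
  shows "translation \<one>\<^bsub>F2\<^esub> v = v"
  using assms by (auto simp: translation_def fun_eq_iff Z2_sum_carrier PiE_iff extensional_def)

lemma lit_translation:
  assumes g: "g \<in> carrier F2" and v: "v \<in> carrier Z2_sum"
  shows "lit F (translation g v) = word_act F g ` lit F v"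
proof -
  let ?S = "{h \<in> carrier F2. v h \<noteq> 0}" and ?m = "\<lambda>h. g \<otimes>\<^bsub>F2\<^esub> h"
  have fin: "finite ?S" using v by (simp add: Z2_sum_carrier)
  have supp: "{h \<in> carrier F2. translation g v h \<noteq> 0} \<subseteq> ?m ` ?S"
  proof
    fix h assume "h \<in> {h \<in> carrier F2. translation g v h \<noteq> 0}"
    then show "h \<in> ?m ` ?S"
      using g by (intro image_eqI[where x = "inv\<^bsub>F2\<^esub> g \<otimes>\<^bsub>F2\<^esub> h"])
        (auto simp: translation_def F2.m_assoc[symmetric])
  qed
  have "word_act F g y \<in> lit F (translation g v) \<longleftrightarrow> y \<in> lit F v" for y
  proof -
    have "word_act F g y \<in> lit F (translation g v) \<longleftrightarrow>
      odd (\<Sum>h\<in>{h \<in> ?m ` ?S. word_act F h (0, False) = word_act F g y}. translation g v h)"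
      by (rule lit_iff) (use fin g supp in auto)
    also have "{h \<in> ?m ` ?S. word_act F h (0, False) = word_act F g y} =
      ?m ` {h \<in> ?S. word_act F h (0, False) = y}"
      by (auto simp: word_act_mult inj_eq[OF inj_word_act[OF g]])
    also have "(\<Sum>h\<in>\<dots>. translation g v h) = (\<Sum>h\<in>{h \<in> ?S. word_act F h (0, False) = y}. translation g v (?m h))"
      by (rule sum.reindex_cong[OF _ refl refl]) (use g in \<open>auto simp: inj_on_def\<close>)
    also have "\<dots> = (\<Sum>h\<in>{h \<in> ?S. word_act F h (0, False) = y}. v h)"
      by (rule sum.cong) (use g in \<open>auto simp: translation_def F2.m_assoc[symmetric]\<close>)
    also have "odd \<dots> \<longleftrightarrow> y \<in> lit F v"
      by (rule lit_iff[symmetric]) (use fin in auto)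
    finally show ?thesis .
  qed
  note mem = this
  show ?thesis
  proof (intro equalityI subsetI)
    fix x assume "x \<in> lit F (translation g v)"
    then have "word_act F (inv\<^bsub>F2\<^esub> g) x \<in> lit F v"
      using mem[of "word_act F (inv\<^bsub>F2\<^esub> g) x"] by (simp add: word_act_inv[OF g])
    then show "x \<in> word_act F g ` lit F v"
      by (intro image_eqI[where x = "word_act F (inv\<^bsub>F2\<^esub> g) x"]) (simp_all add: word_act_inv[OF g])
  qed (auto simp: mem)
qed

text \<open>For \<open>S = {}\<close> this is the invariant subgroup, and for finite \<open>S\<close> its cosets, one for each \<open>S\<close>.\<close>

definition lamp_coset :: "int set \<Rightarrow> (int \<times> bool) set \<Rightarrow> (F2_word \<Rightarrow> int) set" where
  "lamp_coset F S = {v \<in> carrier Z2_sum. lit F v = S}"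

lemma lit_one: "lit F \<one>\<^bsub>Z2_sum\<^esub> = {}"
  using lit_mult[of "\<one>\<^bsub>Z2_sum\<^esub>" "\<one>\<^bsub>Z2_sum\<^esub>" F] group.is_monoid[OF group_Z2_sum]
  by (simp only: monoid.one_closed monoid.l_one) blast

lemma lit_inv:
  assumes "v \<in> carrier Z2_sum"
  shows "lit F (inv\<^bsub>Z2_sum\<^esub> v) = lit F v"
proof -
  have "sym_diff (lit F (inv\<^bsub>Z2_sum\<^esub> v)) (lit F v) = {}"
    using lit_mult[OF group.inv_closed[OF group_Z2_sum assms] assms, of F] lit_one
    by (simp only: group.l_inv[OF group_Z2_sum assms])
  then show ?thesis by blast
qed

lemma subgroup_lamp_coset: "subgroup (lamp_coset F {}) Z2_sum"
proof (rule group.subgroupI[OF group_Z2_sum])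
  show "lamp_coset F {} \<subseteq> carrier Z2_sum" by (auto simp: lamp_coset_def)
  show "lamp_coset F {} \<noteq> {}"
    using lit_one group.is_monoid[OF group_Z2_sum] monoid.one_closed unfolding lamp_coset_def by blast
  show "inv\<^bsub>Z2_sum\<^esub> v \<in> lamp_coset F {}" if "v \<in> lamp_coset F {}" for v
    using that group.inv_closed[OF group_Z2_sum] by (simp only: lamp_coset_def mem_Collect_eq lit_inv)
  show "v \<otimes>\<^bsub>Z2_sum\<^esub> w \<in> lamp_coset F {}" if "v \<in> lamp_coset F {}" "w \<in> lamp_coset F {}" for v w
    using that monoid.m_closed[OF group.is_monoid[OF group_Z2_sum]]
    by (simp only: lamp_coset_def mem_Collect_eq lit_mult) blast
qed

lemma normal_lamp_coset: "lamp_coset F {} \<lhd> Z2_sum"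
  by (rule comm_group.subgroup_imp_normal[OF comm_group_Z2_sum subgroup_lamp_coset])

lemma translation_invariant_lamp_coset: "translation_invariant (lamp_coset F {})"
  unfolding translation_invariant_def lamp_coset_def
  by (auto simp del: sum_group simp: lit_translation translation_closed)

lemma r_coset_lamp_coset:
  assumes v: "v \<in> carrier Z2_sum"
  shows "lamp_coset F {} #>\<^bsub>Z2_sum\<^esub> v = lamp_coset F (lit F v)"
proof -
  note mon = group.is_monoid[OF group_Z2_sum]
  have "w \<in> lamp_coset F {} #>\<^bsub>Z2_sum\<^esub> v \<longleftrightarrow> w \<in> lamp_coset F (lit F v)" for w
  proof
    assume "w \<in> lamp_coset F {} #>\<^bsub>Z2_sum\<^esub> v"
    then obtain k where "k \<in> lamp_coset F {}" "w = k \<otimes>\<^bsub>Z2_sum\<^esub> v" unfolding r_coset_def by blast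
    then show "w \<in> lamp_coset F (lit F v)"
      using v monoid.m_closed[OF mon] unfolding lamp_coset_def by (simp only: mem_Collect_eq lit_mult) blast
  next
    assume w: "w \<in> lamp_coset F (lit F v)"
    then have wc: "w \<in> carrier Z2_sum" by (simp only: lamp_coset_def mem_Collect_eq)
    let ?k = "w \<otimes>\<^bsub>Z2_sum\<^esub> inv\<^bsub>Z2_sum\<^esub> v"
    note iv = group.inv_closed[OF group_Z2_sum v]
    have "lit F ?k = {}" using w unfolding lit_mult[OF wc iv] lit_inv[OF v] lamp_coset_def by blast
    then have k: "?k \<in> lamp_coset F {}" using monoid.m_closed[OF mon wc iv] by (simp only: lamp_coset_def mem_Collect_eq)
    have "?k \<otimes>\<^bsub>Z2_sum\<^esub> v = w"
      by (simp only: monoid.m_assoc[OF mon wc iv v] group.l_inv[OF group_Z2_sum v] monoid.r_one[OF mon wc])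
    with k show "w \<in> lamp_coset F {} #>\<^bsub>Z2_sum\<^esub> v" unfolding r_coset_def by blast
  qed
  then show ?thesis by blast
qed

lemma quotient_carrier:
  assumes "0 \<in> F"
  shows "carrier (Z2_sum Mod lamp_coset F {}) = lamp_coset F ` {S. finite S}"
proof (intro equalityI subsetI)
  fix C assume "C \<in> carrier (Z2_sum Mod lamp_coset F {})"
  then obtain v where v: "v \<in> carrier Z2_sum" "C = lamp_coset F {} #>\<^bsub>Z2_sum\<^esub> v"
    unfolding FactGroup_def RCOSETS_def by auto
  then show "C \<in> lamp_coset F ` {S. finite S}" using r_coset_lamp_coset[OF v(1)] finite_lit[OF v(1)] by simp
next
  fix C assume "C \<in> lamp_coset F ` {S. finite S}"
  then obtain S where S: "finite S" "C = lamp_coset F S" by blast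
  obtain v where v: "v \<in> carrier Z2_sum" "lit F v = S" by (rule lit_surj[OF assms S(1)])
  then show "C \<in> carrier (Z2_sum Mod lamp_coset F {})"
    using r_coset_lamp_coset[OF v(1), of F] S(2) unfolding FactGroup_def RCOSETS_def by auto
qed

lemma quotient_mult:
  assumes "0 \<in> F" "finite S" "finite R"
  shows "lamp_coset F S \<otimes>\<^bsub>Z2_sum Mod lamp_coset F {}\<^esub> lamp_coset F R = lamp_coset F (sym_diff S R)"
proof -
  obtain v where v: "v \<in> carrier Z2_sum" "lit F v = S" by (rule lit_surj[OF assms(1,2)])
  obtain w where w: "w \<in> carrier Z2_sum" "lit F w = R" by (rule lit_surj[OF assms(1,3)])
  have vw: "v \<otimes>\<^bsub>Z2_sum\<^esub> w \<in> carrier Z2_sum"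
    by (rule monoid.m_closed[OF group.is_monoid[OF group_Z2_sum] v(1) w(1)])
  have "(lamp_coset F {} #>\<^bsub>Z2_sum\<^esub> v) <#>\<^bsub>Z2_sum\<^esub> (lamp_coset F {} #>\<^bsub>Z2_sum\<^esub> w) =
      lamp_coset F {} #>\<^bsub>Z2_sum\<^esub> (v \<otimes>\<^bsub>Z2_sum\<^esub> w)"
    by (rule normal.rcos_sum[OF normal_lamp_coset v(1) w(1)])
  then show ?thesis
    unfolding r_coset_lamp_coset[OF v(1)] r_coset_lamp_coset[OF w(1)] r_coset_lamp_coset[OF vw]
      lit_mult[OF v(1) w(1)] v(2) w(2) by (simp add: FactGroup_def)
qed

lemma quotient_one: "\<one>\<^bsub>Z2_sum Mod lamp_coset F {}\<^esub> = lamp_coset F {}"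
  by (simp add: FactGroup_def)

lemma coset_translation_lamp_coset:
  assumes g: "g \<in> carrier F2"
  shows "coset_translation g (lamp_coset F S) = lamp_coset F (word_act F g ` S)"
proof (intro equalityI subsetI)
  fix w assume "w \<in> coset_translation g (lamp_coset F S)"
  then obtain v where "v \<in> carrier Z2_sum" "lit F v = S" "w = translation g v"
    unfolding coset_translation_def lamp_coset_def by blast
  then show "w \<in> lamp_coset F (word_act F g ` S)"
    unfolding lamp_coset_def using translation_closed[OF g] lit_translation[OF g] by blast
next
  fix w assume "w \<in> lamp_coset F (word_act F g ` S)"
  then have w: "w \<in> carrier Z2_sum" "lit F w = word_act F g ` S" unfolding lamp_coset_def by blast+
  let ?v = "translation (inv\<^bsub>F2\<^esub> g) w"
  note ig = F2.inv_closed[OF g]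
  have "lit F ?v = S"
    unfolding lit_translation[OF ig w(1)] w(2) by (simp add: image_image word_act_inv[OF g])
  then have "?v \<in> lamp_coset F S" using translation_closed[OF ig w(1)] unfolding lamp_coset_def by blast
  moreover have "w = translation g ?v"
    using translation_mult[OF g ig, of w] translation_one[OF w(1)] F2.r_inv[OF g] by (simp only:)
  ultimately show "w \<in> coset_translation g (lamp_coset F S)" unfolding coset_translation_def by blast
qed

lemma lamp_coset_inj:
  assumes "0 \<in> F" "finite S" "lamp_coset F S = lamp_coset F R"
  shows "S = R"
proof -
  obtain v where v: "v \<in> carrier Z2_sum" "lit F v = S" by (rule lit_surj[OF assms(1,2)])
  then have "v \<in> lamp_coset F R" using assms(3) unfolding lamp_coset_def by blast
  then show ?thesis using v(2) unfolding lamp_coset_def by blast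
qed

abbreviation lamp_semidirect :: "int set \<Rightarrow> ((F2_word \<Rightarrow> int) set \<times> F2_word) monoid" where
  "lamp_semidirect F \<equiv> quotient_semidirect (lamp_coset F {})"

lemma lamp_semidirect_carrier:
  assumes "0 \<in> F"
  shows "carrier (lamp_semidirect F) = lamp_coset F ` {S. finite S} \<times> carrier F2"
  unfolding semidirect_product_def partial_object.select_convs quotient_carrier[OF assms] ..

lemma lamp_semidirect_mult:
  assumes "0 \<in> F" "finite S" "finite R" "h \<in> carrier F2"
  shows "(lamp_coset F S, g) \<otimes>\<^bsub>lamp_semidirect F\<^esub> (lamp_coset F R, h) =
    (lamp_coset F (sym_diff (word_act F (inv\<^bsub>F2\<^esub> h) ` S) R), g \<otimes>\<^bsub>F2\<^esub> h)"
  unfolding semidirect_product_def monoid.select_convs prod.case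
    coset_translation_lamp_coset[OF F2.inv_closed[OF assms(4)]]
  by (subst quotient_mult[OF assms(1) finite_imageI[OF assms(2)] assms(3)]) (rule refl)

lemma lamp_semidirect_one: "\<one>\<^bsub>lamp_semidirect F\<^esub> = (lamp_coset F {}, [])"
  by (simp only: semidirect_product_def monoid.select_convs quotient_one F2_one)

lemma group_lamp_semidirect:
  assumes F: "0 \<in> F"
  shows "group (lamp_semidirect F)"
proof (rule groupI)
  let ?G = "lamp_semidirect F"
  note mult = lamp_semidirect_mult[OF F] and car = lamp_semidirect_carrier[OF F]
  have Nil: "[] \<in> carrier F2" using F2.one_closed by (simp only: F2_one)
  show "\<one>\<^bsub>?G\<^esub> \<in> carrier ?G" unfolding lamp_semidirect_one car using Nil by blast
  fix x y z assume "x \<in> carrier ?G" "y \<in> carrier ?G" "z \<in> carrier ?G"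
  then obtain S g R h T k where
    x: "x = (lamp_coset F S, g)" "finite S" "g \<in> carrier F2" and
    y: "y = (lamp_coset F R, h)" "finite R" "h \<in> carrier F2" and
    z: "z = (lamp_coset F T, k)" "finite T" "k \<in> carrier F2"
    unfolding car by blast
  have gh: "g \<otimes>\<^bsub>F2\<^esub> h \<in> carrier F2" and hk: "h \<otimes>\<^bsub>F2\<^esub> k \<in> carrier F2"
    using x y z by (simp_all add: F2.m_closed)
  show "x \<otimes>\<^bsub>?G\<^esub> y \<in> carrier ?G"
    unfolding x(1) y(1) mult[OF x(2) y(2,3)] car using x(2) y(2) gh by simp
  have fin: "finite (sym_diff (word_act F (inv\<^bsub>F2\<^esub> h) ` S) R)" "finite (sym_diff (word_act F (inv\<^bsub>F2\<^esub> k) ` R) T)"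
    using x y z by simp_all
  show "x \<otimes>\<^bsub>?G\<^esub> y \<otimes>\<^bsub>?G\<^esub> z = x \<otimes>\<^bsub>?G\<^esub> (y \<otimes>\<^bsub>?G\<^esub> z)"
  proof -
    let ?a = "word_act F (inv\<^bsub>F2\<^esub> k)"
    have inj: "inj ?a" by (rule inj_word_act[OF F2.inv_closed[OF z(3)]])
    have "?a ` word_act F (inv\<^bsub>F2\<^esub> h) ` S = word_act F (inv\<^bsub>F2\<^esub> (h \<otimes>\<^bsub>F2\<^esub> k)) ` S"
      using y(3) z(3) by (simp add: image_image F2.inv_mult_group word_act_mult)
    then have "sym_diff (?a ` sym_diff (word_act F (inv\<^bsub>F2\<^esub> h) ` S) R) T =
      sym_diff (word_act F (inv\<^bsub>F2\<^esub> (h \<otimes>\<^bsub>F2\<^esub> k)) ` S) (sym_diff (?a ` R) T)"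
      unfolding image_Un image_set_diff[OF inj] by blast
    then show ?thesis
      unfolding x(1) y(1) z(1) mult[OF x(2) y(2,3)] mult[OF y(2) z(2,3)] mult[OF fin(1) z(2,3)]
        mult[OF x(2) fin(2) hk] using x y z by (simp add: F2.m_assoc)
  qed
  show "\<one>\<^bsub>?G\<^esub> \<otimes>\<^bsub>?G\<^esub> x = x"
    unfolding lamp_semidirect_one x(1) mult[OF finite.emptyI x(2,3)]
    using F2.l_one[OF x(3)] by (simp add: F2_one)
  have fin': "finite (word_act F g ` S)" using x(2) by simp
  have "(lamp_coset F (word_act F g ` S), inv\<^bsub>F2\<^esub> g) \<otimes>\<^bsub>?G\<^esub> x = \<one>\<^bsub>?G\<^esub>"
    unfolding x(1) mult[OF fin' x(2,3)] lamp_semidirect_one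
    using F2.l_inv[OF x(3)] by (simp add: image_image word_act_inv[OF x(3)] F2_one)
  moreover have "(lamp_coset F (word_act F g ` S), inv\<^bsub>F2\<^esub> g) \<in> carrier ?G"
    unfolding car using fin' x(3) by simp
  ultimately show "\<exists>y\<in>carrier ?G. y \<otimes>\<^bsub>?G\<^esub> x = \<one>\<^bsub>?G\<^esub>" by blast
qed

section \<open>The family of groups\<close>

text \<open>The vertices of the arms are separated because their components in the free group are the reduced
  words \<open>s\<close> to the power \<open>2 * j\<close>, with or without an initial letter \<open>t\<close>.\<close>

lemma two_arms_lamp_semidirect:
  assumes F: "0 \<in> F"
  shows "two_arms (lamp_semidirect F) (\<lambda>S. (lamp_coset F S, []))
    (lamp_coset F {}, [(False, True), (False, True)]) (lamp_coset F {}, [(True, True)]) F"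
proof -
  let ?G = "lamp_semidirect F" and ?U = "\<lambda>S. (lamp_coset F S, [] :: F2_word)"
  let ?rr = "[(False, True), (False, True)] :: F2_word" and ?tt = "[(True, True)] :: F2_word"
  let ?r = "(lamp_coset F {}, ?rr)" and ?t = "(lamp_coset F {}, ?tt)"
  interpret G: group ?G by (rule group_lamp_semidirect[OF F])
  note mult = lamp_semidirect_mult[OF F]
  have one: "[] \<in> carrier F2" "inv\<^bsub>F2\<^esub> [] = []"
    using F2.one_closed F2.inv_one by (simp_all only: F2_one)
  have rr: "?rr \<in> carrier F2" and tt: "?tt \<in> carrier F2"
    by (simp_all add: F2_carrier reduced_Cons inv_letter_def)
  have F2_Nil: "g \<otimes>\<^bsub>F2\<^esub> [] = g" "[] \<otimes>\<^bsub>F2\<^esub> g = g" if "g \<in> carrier F2" for g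
    using F2.r_one[OF that] F2.l_one[OF that] by (simp_all only: F2_one)
  have conj: "(lamp_coset F {}, g) \<otimes>\<^bsub>?G\<^esub> ?U S = ?U (\<pi> ` S) \<otimes>\<^bsub>?G\<^esub> (lamp_coset F {}, g)"
    if "finite S" "g \<in> carrier F2" "\<And>x. word_act F g x = \<pi> x" for S g \<pi>
    using that(1) unfolding mult[OF finite.emptyI that(1) one(1)] mult[OF finite_imageI[OF that(1)] finite.emptyI that(2)]
    by (simp add: F2_Nil[OF that(2)] image_image word_act_inv[OF that(2)] flip: that(3))
  have act_r: "word_act F ?rr x = shift 1 x" and act_t: "word_act F ?tt x = flip F x" for x
    by (simp_all add: word_act_def letter_act_def shift_def flip_def split: prod.split)
  have closed: "?r \<in> carrier ?G" "?t \<in> carrier ?G"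
    unfolding lamp_semidirect_carrier[OF F] using rr tt by simp_all
  have lamp_group: "lamp_group ?G ?U"
  proof (unfold_locales)
    fix S :: "(int \<times> bool) set" assume S: "finite S"
    show "?U S \<in> carrier ?G" unfolding lamp_semidirect_carrier[OF F] using S one by simp
    show "S = {}" if "?U S = \<one>\<^bsub>?G\<^esub>"
      using lamp_coset_inj[OF F S] that unfolding lamp_semidirect_one by simp
    fix R :: "(int \<times> bool) set" assume R: "finite R"
    show "?U S \<otimes>\<^bsub>?G\<^esub> ?U R = ?U (sym_diff S R)"
      unfolding mult[OF S R one(1)] by (simp add: one word_act_one F2_Nil[OF one(1)])
  qed
  have snd_pow: "\<exists>S. finite S \<and> ?r [^]\<^bsub>?G\<^esub> (j::nat) = (lamp_coset F S, replicate (2 * j) (False, True))" for j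
  proof (induction j)
    case 0
    show ?case unfolding G.nat_pow_0 lamp_semidirect_one by auto
  next
    case (Suc j)
    then obtain S where S: "finite S" "?r [^]\<^bsub>?G\<^esub> j = (lamp_coset F S, replicate (2 * j) (False, True))" by blast
    have "replicate (2 * j) (False, True) @ ?rr = replicate (2 * Suc j) (False, True)"
    proof -
      have "2 * Suc j = 2 * j + 2" by simp
      then show ?thesis by (simp only: replicate_add) (simp add: numeral_2_eq_2)
    qed
    then have "replicate (2 * j) (False, True) \<otimes>\<^bsub>F2\<^esub> ?rr = replicate (2 * Suc j) (False, True)"
      by (simp only: F2_mult reduce_reduced[OF reduced_replicate])
    then show ?case
      unfolding G.nat_pow_Suc S(2) mult[OF S(1) finite.emptyI rr] using S(1) by auto
  qed
  have snd_vertex: "\<exists>S. finite S \<and> (if \<beta> then ?t else \<one>\<^bsub>?G\<^esub>) \<otimes>\<^bsub>?G\<^esub> ?r [^]\<^bsub>?G\<^esub> (j::nat) =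
      (lamp_coset F S, (if \<beta> then ?tt else []) @ replicate (2 * j) (False, True))" for \<beta> j
  proof -
    obtain S where S: "finite S" "?r [^]\<^bsub>?G\<^esub> j = (lamp_coset F S, replicate (2 * j) (False, True))"
      using snd_pow by blast
    have eq: "(if \<beta> then ?t else \<one>\<^bsub>?G\<^esub>) = (lamp_coset F {}, if \<beta> then ?tt else [])"
      by (simp add: lamp_semidirect_one)
    have car: "replicate (2 * j) (False, True) \<in> carrier F2" by (simp only: F2_carrier reduced_replicate)
    have "reduced ((if \<beta> then ?tt else []) @ replicate (2 * j) (False, True))"
      using reduced_replicate[of "2 * j" "(False, True)"]
      by (auto simp: reduced_Cons hd_replicate inv_letter_def)
    then show ?thesis
      unfolding eq S(2) mult[OF finite.emptyI S(1) car] F2_mult using S(1) by (auto simp: reduce_reduced)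
  qed
  show ?thesis
  proof (rule two_arms.intro[OF lamp_group two_arms_axioms.intro])
    show "?r \<in> carrier ?G" "?t \<in> carrier ?G" by (rule closed)+
    fix S :: "(int \<times> bool) set" assume S: "finite S"
    show "?r \<otimes>\<^bsub>?G\<^esub> ?U S = ?U (shift 1 ` S) \<otimes>\<^bsub>?G\<^esub> ?r" by (rule conj[OF S rr act_r])
    show "?t \<otimes>\<^bsub>?G\<^esub> ?U S = ?U (flip F ` S) \<otimes>\<^bsub>?G\<^esub> ?t" by (rule conj[OF S tt act_t])
    fix \<beta>' \<beta> and j' j :: nat
    assume eq: "?U S \<otimes>\<^bsub>?G\<^esub> ((if \<beta>' then ?t else \<one>\<^bsub>?G\<^esub>) \<otimes>\<^bsub>?G\<^esub> ?r [^]\<^bsub>?G\<^esub> j') =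
      (if \<beta> then ?t else \<one>\<^bsub>?G\<^esub>) \<otimes>\<^bsub>?G\<^esub> ?r [^]\<^bsub>?G\<^esub> j"
    let ?w = "\<lambda>\<beta> j. (if \<beta> then ?tt else []) @ replicate (2 * j) (False, True)"
    obtain R' where R': "finite R'" "(if \<beta>' then ?t else \<one>\<^bsub>?G\<^esub>) \<otimes>\<^bsub>?G\<^esub> ?r [^]\<^bsub>?G\<^esub> j' = (lamp_coset F R', ?w \<beta>' j')"
      using snd_vertex by blast
    obtain R where R: "finite R" "(if \<beta> then ?t else \<one>\<^bsub>?G\<^esub>) \<otimes>\<^bsub>?G\<^esub> ?r [^]\<^bsub>?G\<^esub> j = (lamp_coset F R, ?w \<beta> j)"
      using snd_vertex by blast
    have w: "?w \<beta>' j' \<in> carrier F2"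
      using reduced_replicate[of "2 * j'" "(False, True)"]
      by (auto simp: F2_carrier reduced_Cons hd_replicate inv_letter_def)
    have "?w \<beta>' j' = ?w \<beta> j"
      using eq unfolding R'(2) R(2) mult[OF S R'(1) w] by (simp only: F2_Nil[OF w] prod.inject)
    then show "\<beta> = \<beta>' \<and> j = j'"
      by (cases j; cases j') (auto split: if_splits dest: arg_cong[of _ _ length])
  qed
qed

theorem theorem1p1:
  shows "\<exists>(V :: nat set \<Rightarrow> (F2_word \<Rightarrow> int) set)
          (Q :: nat set \<Rightarrow> (F2_word \<Rightarrow> int) set \<times> F2_word \<Rightarrow> rat).
      (\<forall>I\<in>Pow {1..}. subgroup (V I) Z2_sum \<and> translation_invariant (V I)) \<and>
      (\<forall>I\<in>Pow {1..}. Q I \<in> rational_group_ring (quotient_semidirect (V I))) \<and>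
      monotone_on (Pow {1..}) lex_less (<)
        (\<lambda>I. vn_dim (quotient_semidirect (V I))
               (ell2_kernel (quotient_semidirect (V I))
                 (\<lambda>\<xi> x. group_ring_op (quotient_semidirect (V I)) (Q I) \<xi> x - 4 * \<xi> x)))"
proof -
  define V where "V I = lamp_coset (twisted_levels I) {}" for I
  define realises where "realises I q \<longleftrightarrow> q \<in> rational_group_ring (quotient_semidirect (V I)) \<and>
      vn_dim (quotient_semidirect (V I)) (ell2_kernel (quotient_semidirect (V I))
        (\<lambda>\<xi> x. group_ring_op (quotient_semidirect (V I)) q \<xi> x - 4 * \<xi> x)) = suminf (dimension_series I)" for I q
  have ex: "\<exists>q. realises I q" for I
  proof -
    have "0 \<in> twisted_levels I" by (simp add: twisted_levels_def)
    then interpret two_arms "lamp_semidirect (twisted_levels I)" "\<lambda>S. (lamp_coset (twisted_levels I) S, [])"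
      "(lamp_coset (twisted_levels I) {}, [(False, True), (False, True)])"
      "(lamp_coset (twisted_levels I) {}, [(True, True)])" "twisted_levels I"
      by (rule two_arms_lamp_semidirect)
    obtain q where q: "q \<in> rational_group_ring (quotient_semidirect (V I))"
      "ell2_kernel (quotient_semidirect (V I))
        (\<lambda>\<xi> x. group_ring_op (quotient_semidirect (V I)) q \<xi> x - 4 * \<xi> x) = harmonic"
      unfolding V_def using harmonic_is_kernel by blast
    show ?thesis
      unfolding realises_def
    proof (rule exI[of _ q], rule conjI[OF q(1)], unfold q(2))
      show "vn_dim (quotient_semidirect (V I)) harmonic = suminf (dimension_series I)"
        unfolding V_def by (rule vn_dim_harmonic[OF sum_probability_good_tendsto])
    qed
  qed
  define Q where "Q I = (SOME q. realises I q)" for I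
  have "realises I (Q I)" for I unfolding Q_def by (rule someI_ex[OF ex])
  then have Q: "Q I \<in> rational_group_ring (quotient_semidirect (V I))"
    "vn_dim (quotient_semidirect (V I)) (ell2_kernel (quotient_semidirect (V I))
        (\<lambda>\<xi> x. group_ring_op (quotient_semidirect (V I)) (Q I) \<xi> x - 4 * \<xi> x)) = suminf (dimension_series I)" for I
    unfolding realises_def by blast+
  show ?thesis
  proof (intro exI[of _ V] exI[of _ Q] conjI ballI)
    show "subgroup (V I) Z2_sum" "translation_invariant (V I)" for I
      unfolding V_def by (rule subgroup_lamp_coset, rule translation_invariant_lamp_coset)
    show "Q I \<in> rational_group_ring (quotient_semidirect (V I))" for I by (rule Q(1))
    show "monotone_on (Pow {1..}) lex_less (<)
        (\<lambda>I. vn_dim (quotient_semidirect (V I))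
               (ell2_kernel (quotient_semidirect (V I))
                 (\<lambda>\<xi> x. group_ring_op (quotient_semidirect (V I)) (Q I) \<xi> x - 4 * \<xi> x)))"
      unfolding Q(2) by (rule monotone_onI) (simp add: suminf_dimension_series_strict_mono)
  qed
qed

end
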